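(* Let $J\subseteq I$, let $\mathsf v$ be a $J$-parameter system, and let $\mathsf F$ be a fundamental domain for the action of $\mathbb T_J$ on $\mathbb W^J$. With respect to the basis $\mathsf B_{\mathsf F}=\{\varpi_{J,\mathsf v}(X_u)\mid u\in\mathsf F\}$ of $M_{J,\mathsf v}$, the matrix entries of $\pi_{J,\mathsf v}(T_w)$, with $w\in\widetilde W$, are $$[\pi_{J,\mathsf v}(T_w)]_{u,v}=\sum_{\{p\in\mathcal P_J(\vec w,u)\,\mid\,\theta(p,\mathsf F)=v\}}\mathcal Q_{J,\mathsf v}(p)\,\zeta_J^{\mathrm{wt}(p,\mathsf F)}\qquad\text{for }u,v\in\mathsf F,$$ where $\vec w$ is any choice of reduced expression for $w$.
   Context: Root system and groups. $\Phi$ is an irreducible, not necessarily reduced, crystallographic root system of rank $n$ in an $n$-dimensional Euclidean space $(V,\langle\cdot,\cdot\rangle)$, with simple roots $\alpha_i$, $i\in I=\{1,\dots,n\}$ (Bourbaki labelling), positive roots $\Phi^+$, highest root $\varphi$, and $\alpha^\vee=2\alpha/\langle\alpha,\alpha\rangle$. If $\Phi$ is not reduced it is of type $BC_n$: $V=\mathbb R^n$, $\alpha_j=e_j-e_{j+1}$ ($j<n$), $\alpha_n=e_n$, $\Phi^+=\{e_i\pm e_j\ (i<j),\ e_k,\ 2e_k\}$. $\Phi_0=\{\alpha\in\Phi:\alpha/2\notin\Phi\}$, $\Phi_0^+=\Phi_0\cap\Phi^+$. Let $\omega_i\in V$ satisfy $\langle\omega_i,\alpha_j\rangle=\delta_{ij}$,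 $P=\bigoplus_i\mathbb Z\omega_i$, $Q=\mathbb Z\Phi^\vee\subseteq P$. For $\alpha\in\Phi$, $k\in\mathbb Z$: $H_{\alpha,k}=\{x\in V:\langle x,\alpha\rangle=k\}$, $s_{\alpha,k}(x)=x-(\langle x,\alpha\rangle-k)\alpha^\vee$, $s_\alpha=s_{\alpha,0}$, $s_i=s_{\alpha_i}$, $s_0=s_{\varphi,1}$. $W_0=\langle s_1,\dots,s_n\rangle$; $W=Q\rtimes W_0$ is a Coxeter group with generators $s_0,\dots,s_n$ and length $\ell$; $\widetilde W=P\rtimes W_0$, $\lambda\in P$ acting as the translation $t_\lambda$. Each $w\in\widetilde W$ is uniquely $w=t_{\mathrm{wt}(w)}\theta(w)$ with $\mathrm{wt}(w)\in P$, $\theta(w)\in W_0$. For $w\in W_0$, $\Phi(w)=\{\alpha\in\Phi_0^+:w^{-1}\alpha\in-\Phi_0^+\}$. $A_0=\{x\in V:0\le\langle x,\alpha\rangle\le1\ \forall\alpha\in\Phi^+\}$; $\Sigma$ is the stabiliser of $A_0$ in $\widetilde W$; $\widetilde W=W\rtimes\Sigma$, $\ell(w\sigma)=\ell(w)$, $\sigma s_i\sigma^{-1}=s_{\sigma(i)}$. A reduced expression of $w$ is $w=s_{i_1}\cdots s_{i_\ell}\sigma$ with $\ell=\ell(w)$, $\sigma\in\Sigma$. The crossing $w\to ws_i$ is positive (resp. negative) if $ws_iA_0$ lies in $\{\langle x,\alpha\rangle\ge k\}$ (resp. $\{\langle x,\alpha\rangle\le k\}$), where $H_{\alpha,k}$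 with $\alpha\in\Phi^+$ separates $wA_0$ and $ws_iA_0$. Affine roots are expressions $\alpha+k\delta$ ($\alpha\in\Phi,k\in\mathbb Z$), $\alpha_0=-\varphi+\delta$, $u(\alpha+k\delta)=u\alpha+k\delta$ for $u\in W_0$. Objects attached to $J\subseteq I$. $W_J=\langle s_j:j\in J\rangle$ with longest element $\mathsf w_J$; $W^J$ is the set of minimal length representatives of cosets $W_Jw$, $w\in W_0$; $\Phi_J$ is the set of roots in the span of $\{\alpha_j\}_{j\in J}$, $\Phi_J^+=\Phi_J\cap\Phi^+$; $Q_J=\sum_{\alpha\in\Phi_J}\mathbb Z\alpha^\vee$. Write $\theta(w)=\theta_J(w)\theta^J(w)$ with $\theta_J(w)\in W_J$, $\theta^J(w)\in W^J$. $\mathcal A_J=\{x\in V:0\le\langle x,\alpha\rangle\le1\ \forall\alpha\in\Phi_J^+\}$, $\mathbb W^J=\{w\in\widetilde W:wA_0\subseteq\mathcal A_J\}$, $P^{(J)}=P\cap\mathcal A_J$. For $\lambda\in P^{(J)}$: $J_\lambda=\{j\in J:\langle\lambda,\alpha_j\rangle\ne0\}$, $\mathsf y_\lambda=\mathsf w_{J\setminus J_\lambda}\mathsf w_J$, $\tau_\lambda=t_\lambda\mathsf y_\lambda$. $\mathbb T_J=\{\tau_\lambda:\lambda\in P^{(J)}\}$ is an abelian subgroup of $\widetilde W$ acting freely on $\mathbb W^J$ by left multiplication. A fundamental domain is a subset $\mathsf F\subseteq\mathbb W^J$ such that each $w\in\mathbb W^J$ has a unique expression $w=\tau_\lambda u$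 with $\lambda\in P^{(J)}$, $u\in\mathsf F$; then $\mathrm{wt}(w,\mathsf F)=\lambda$, $\theta(w,\mathsf F)=u$. Hecke algebra. $\mathsf q_0,\dots,\mathsf q_n$ are commuting invertible indeterminates with $\mathsf q_i=\mathsf q_j$ whenever $s_i,s_j$ are conjugate in $\widetilde W$ (so $\mathsf q_0=\mathsf q_1$ if $\Phi=A_1$, $\mathsf q_0=\mathsf q_n$ if $\Phi=C_n$), $\mathsf R=\mathbb Z[\mathsf q_0^{\pm1},\dots,\mathsf q_n^{\pm1}]$. $\widetilde{\mathcal H}$ is the $\mathsf R$-algebra with basis $\{T_w:w\in\widetilde W\}$, $T_wT_v=T_{wv}$ if $\ell(wv)=\ell(w)+\ell(v)$, $T_wT_{s_i}=T_{ws_i}+(\mathsf q_i-\mathsf q_i^{-1})T_w$ if $\ell(ws_i)=\ell(w)-1$; $T_i=T_{s_i}$. For any expression $w=s_{i_1}\cdots s_{i_\ell}\sigma$, $X_w=T_{i_1}^{\epsilon_1}\cdots T_{i_\ell}^{\epsilon_\ell}T_\sigma$, where $\epsilon_k=\pm1$ is the sign of the crossing $s_{i_1}\cdots s_{i_{k-1}}\to s_{i_1}\cdots s_{i_k}$; this is independent of the expression and $\{X_w\}$ is a basis of $\widetilde{\mathcal H}$. $J$-parameter system: a family $\mathsf v=(\mathsf v_\alpha)_{\alpha\in\Phi_J}$ in $\mathsf R^\times$ with (1) $\mathsf v_\alpha=\mathsf v_\beta$ if $\beta\in W_J\alpha$; (2) $\mathsf v_{\alpha_j}\in\{\mathsf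 q_j,-\mathsf q_j^{-1}\}$ for $j\in J$ with $2\alpha_j\notin\Phi_J$; (3) if $\Phi_J$ is not reduced, $\mathsf v_{2\alpha_n}\in\{\mathsf q_0,-\mathsf q_0^{-1}\}$ and $\mathsf v_{\alpha_n}\mathsf v_{2\alpha_n}\in\{\mathsf q_n,-\mathsf q_n^{-1}\}$. Set $\mathsf v_{\alpha+k\delta}=\mathsf v_\alpha$ for $\alpha\in\Phi_J$ and $\mathsf v_\beta=1$ for $\beta\notin\Phi_J+\mathbb Z\delta$. For $\lambda\in P$, $y\in W_J$: $\mathsf v^\lambda=\prod_{\alpha\in\Phi_J^+}\mathsf v_\alpha^{\langle\lambda,\alpha\rangle}$, $\mathsf v(y)=\prod_{\alpha\in\Phi(y)}\mathsf v_\alpha\mathsf v_{2\alpha}$. Ring. $\zeta^\lambda=\prod_i\zeta_i^{a_i}$ for $\lambda=\sum a_i\omega_i$; $\mathsf R[\zeta_J]$ is the quotient of $\mathsf R[\zeta_i^{\pm1}:i\in I]$ by the ideal generated by $\zeta^\gamma-1$, $\gamma\in Q_J$; $\zeta_J^\lambda$ is the image of $\zeta^\lambda$. Module. $(\pi_{J,\mathsf v},M_{J,\mathsf v})$ is the right $\widetilde{\mathcal H}$-module, free over $\mathsf R[\zeta_J]$ with basis $\{\mathbf m_u:u\in W^J\}$, with $\mathbf m_u\cdot T_\sigma=\zeta_J^{\mathrm{wt}(u\sigma)}\mathbf m_{\theta^J(u\sigma)}$ ($\sigma\in\Sigma$) and, for $i\in\{0\}\cup I$: $\mathbf m_u\cdot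 T_i=\zeta_J^{\mathrm{wt}(us_i)}\mathbf m_{\theta^J(us_i)}$ if $u\to us_i$ is positive and $us_i\in\mathbb W^J$; $\mathbf m_u\cdot T_i=\zeta_J^{\mathrm{wt}(us_i)}\mathbf m_{\theta^J(us_i)}+(\mathsf q_i-\mathsf q_i^{-1})\mathbf m_u$ if $u\to us_i$ is negative and $us_i\in\mathbb W^J$; $\mathbf m_u\cdot T_i=\mathsf v_{u\alpha_i}\mathsf v_{2u\alpha_i}\mathbf m_u$ if $us_i\notin\mathbb W^J$. The $\mathsf R$-linear map $\varpi_{J,\mathsf v}:\widetilde{\mathcal H}\to M_{J,\mathsf v}$ is given by $\varpi_{J,\mathsf v}(X_w)=\mathsf v^{\mathrm{wt}(w)}\zeta_J^{\mathrm{wt}(w)}\mathsf v(\theta_J(w))^{-1}\mathbf m_{\theta^J(w)}$. For a basis $(b_u)$, matrix entries are defined by $b_u\cdot h=\sum_v[\pi_{J,\mathsf v}(h)]_{u,v}b_v$. Paths. Let $\vec w=s_{i_1}\cdots s_{i_\ell}\sigma$ and $v\in\mathbb W^J$. $\mathcal P_J(\vec w,v)$ is the set of positively $J$-folded alcove paths of type $\vec w$ starting at $v$: sequences $p=(v_0,\dots,v_\ell,v_\ell\sigma)$ with all $v_k\in\mathbb W^J$, $v_0=v$, $v_k\in\{v_{k-1},v_{k-1}s_{i_k}\}$, and such that if $v_{k-1}=v_k$ and $v_{k-1}s_{i_k}\in\mathbb W^J$ then $v_{k-1}\to v_{k-1}s_{i_k}$ is negative. Step $k$ with $v_k=v_{k-1}$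 is an $i_k$-fold if $v_{k-1}s_{i_k}\in\mathbb W^J$, and a bounce otherwise; a bounce is positive (resp. negative) if $v_{k-1}A_0$ is on the positive (resp. negative) side of the hyperplane separating $v_{k-1}A_0$ and $v_{k-1}s_{i_k}A_0$, and it occurs on that hyperplane, which is of the form $H_{\alpha,0}$ (resp. $H_{\alpha,1}$) with $\alpha\in\Phi_J^+$. $f_i(p)$ is the number of $i$-folds; for $\alpha\in\Phi_J^+$, $b_\alpha(p)$ is the number of positive bounces occurring on $H_{\alpha,0}$ plus the number of negative bounces occurring on $H_{\alpha,1}$. $\mathcal Q_{J,\mathsf v}(p)=\prod_{\alpha\in\Phi_J^+}\mathsf v_\alpha^{b_\alpha(p)}\prod_{i\in\{0\}\cup I}(\mathsf q_i-\mathsf q_i^{-1})^{f_i(p)}$. With $\mathrm{end}(p)=v_\ell\sigma$, set $\mathrm{wt}(p,\mathsf F)=\mathrm{wt}(\mathrm{end}(p),\mathsf F)$ and $\theta(p,\mathsf F)=\theta(\mathrm{end}(p),\mathsf F)$. *)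

theory Defs
  imports
    "HOL-Analysis.Analysis"
    "HOL-Algebra.QuotRing"
    "HOL-Algebra.Module"
    "HOL-Library.Poly_Mapping"
begin

section \<open>Root systems\<close>

text \<open>
  The ambient Euclidean space is the type \<open>'a\<close>; its dimension is the rank \<open>n\<close>.
  Simple roots are numbered \<open>1, ..., n\<close>.
\<close>

record 'a based_roots =
  roots :: "'a set"
  sroot :: "nat \<Rightarrow> 'a"

definition fin_idx :: "'a::euclidean_space based_roots \<Rightarrow> nat set" where
  "fin_idx D = {1..DIM('a)}"

definition aff_idx :: "'a::euclidean_space based_roots \<Rightarrow> nat set" where
  "aff_idx D = {0..DIM('a)}"

definition coroot :: "'a::euclidean_space \<Rightarrow> 'a" where
  "coroot \<beta> = (2 / (\<beta> \<bullet> \<beta>)) *\<^sub>R \<beta>"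

definition aff_refl :: "'a::euclidean_space \<Rightarrow> int \<Rightarrow> 'a \<Rightarrow> 'a" where
  "aff_refl \<beta> k x = x - (x \<bullet> \<beta> - of_int k) *\<^sub>R coroot \<beta>"

definition root_system :: "'a::euclidean_space set \<Rightarrow> bool" where
  "root_system \<Phi> \<longleftrightarrow>
     finite \<Phi> \<and> span \<Phi> = UNIV \<and> 0 \<notin> \<Phi> \<and>
     (\<forall>\<beta>\<in>\<Phi>. aff_refl \<beta> 0 ` \<Phi> = \<Phi>) \<and>
     (\<forall>\<beta>\<in>\<Phi>. \<forall>\<gamma>\<in>\<Phi>. \<gamma> \<bullet> coroot \<beta> \<in> \<int>)"

definition irreducible_roots :: "'a::euclidean_space set \<Rightarrow> bool" where
  "irreducible_roots \<Phi> \<longleftrightarrow>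
     \<Phi> \<noteq> {} \<and>
     \<not> (\<exists>A B. A \<noteq> {} \<and> B \<noteq> {} \<and> A \<union> B = \<Phi> \<and> A \<inter> B = {} \<and> (\<forall>a\<in>A. \<forall>b\<in>B. a \<bullet> b = 0))"

definition nonneg_comb :: "'a::euclidean_space based_roots \<Rightarrow> 'a \<Rightarrow> bool" where
  "nonneg_comb D x \<longleftrightarrow> (\<exists>c :: nat \<Rightarrow> nat. x = (\<Sum>i\<in>fin_idx D. real (c i) *\<^sub>R sroot D i))"

text \<open>
  Only one feature of the standard labelling of the simple roots is ever used: in type \<open>BC\<^sub>n\<close>
  the simple root whose double is a root is the one numbered \<open>n\<close> (the last assumption).
\<close>

locale irreducible_root_datum =
  fixes D :: "'a::euclidean_space based_roots"
  assumes root_system: "root_system (roots D)"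
    and irreducible: "irreducible_roots (roots D)"
    and sroot_inj: "inj_on (sroot D) (fin_idx D)"
    and sroot_indep: "independent (sroot D ` fin_idx D)"
    and sroot_roots: "sroot D ` fin_idx D \<subseteq> roots D"
    and root_comb: "\<And>\<beta>. \<beta> \<in> roots D \<Longrightarrow> nonneg_comb D \<beta> \<or> nonneg_comb D (- \<beta>)"
    and last_label: "\<And>i. i \<in> fin_idx D \<Longrightarrow> 2 *\<^sub>R sroot D i \<in> roots D \<Longrightarrow> i = DIM('a)"

definition pos_roots :: "'a::euclidean_space based_roots \<Rightarrow> 'a set" where
  "pos_roots D = {\<beta> \<in> roots D. nonneg_comb D \<beta>}"

definition highest_root :: "'a::euclidean_space based_roots \<Rightarrow> 'a" where
  "highest_root D = (THE \<phi>. \<phi> \<in> roots D \<and> (\<forall>\<beta>\<in>roots D. nonneg_comb D (\<phi> - \<beta>)))"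

definition ind_pos_roots :: "'a::euclidean_space based_roots \<Rightarrow> 'a set" where
  "ind_pos_roots D = {\<beta> \<in> pos_roots D. (1/2) *\<^sub>R \<beta> \<notin> roots D}"

definition fund_coweight :: "'a::euclidean_space based_roots \<Rightarrow> nat \<Rightarrow> 'a" where
  "fund_coweight D i = (THE x. \<forall>j\<in>fin_idx D. x \<bullet> sroot D j = (if i = j then 1 else 0))"

definition coweights :: "'a::euclidean_space based_roots \<Rightarrow> 'a set" where
  "coweights D = {x. \<exists>a :: nat \<Rightarrow> int. x = (\<Sum>i\<in>fin_idx D. of_int (a i) *\<^sub>R fund_coweight D i)}"


section \<open>Weyl groups\<close>

text \<open>
  All Weyl groups are realised as groups of affine transformations of the ambient space, with
  composition as multiplication.
\<close>

definition sgen :: "'a::euclidean_space based_roots \<Rightarrow> nat \<Rightarrow> 'a \<Rightarrow> 'a" where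
  "sgen D i = (if i = 0 then aff_refl (highest_root D) 1 else aff_refl (sroot D i) 0)"

definition wprod :: "'a::euclidean_space based_roots \<Rightarrow> nat list \<Rightarrow> 'a \<Rightarrow> 'a" where
  "wprod D js = foldr (\<lambda>i w. sgen D i \<circ> w) js id"

definition par_weyl :: "'a::euclidean_space based_roots \<Rightarrow> nat set \<Rightarrow> ('a \<Rightarrow> 'a) set" where
  "par_weyl D J = {wprod D js | js. set js \<subseteq> J}"

abbreviation fin_weyl :: "'a::euclidean_space based_roots \<Rightarrow> ('a \<Rightarrow> 'a) set" where
  "fin_weyl D \<equiv> par_weyl D (fin_idx D)"

definition transl :: "'a::euclidean_space \<Rightarrow> 'a \<Rightarrow> 'a" where
  "transl \<mu> x = \<mu> + x"

definition ext_weyl :: "'a::euclidean_space based_roots \<Rightarrow> ('a \<Rightarrow> 'a) set" where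
  "ext_weyl D = {transl \<mu> \<circ> u | \<mu> u. \<mu> \<in> coweights D \<and> u \<in> fin_weyl D}"

text \<open>For \<open>w = transl \<mu> \<circ> u\<close> with \<open>u\<close> linear, \<open>wt w = \<mu>\<close> and \<open>lin w = u\<close>.\<close>

definition wt :: "('a::euclidean_space \<Rightarrow> 'a) \<Rightarrow> 'a" where
  "wt w = w 0"

definition lin :: "('a::euclidean_space \<Rightarrow> 'a) \<Rightarrow> 'a \<Rightarrow> 'a" where
  "lin w = (\<lambda>x. w x - w 0)"

definition alcove0 :: "'a::euclidean_space based_roots \<Rightarrow> 'a set" where
  "alcove0 D = {x. \<forall>\<beta>\<in>pos_roots D. 0 \<le> x \<bullet> \<beta> \<and> x \<bullet> \<beta> \<le> 1}"

definition alcove_stab :: "'a::euclidean_space based_roots \<Rightarrow> ('a \<Rightarrow> 'a) set" where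
  "alcove_stab D = {\<sigma> \<in> ext_weyl D. \<sigma> ` alcove0 D = alcove0 D}"

definition expression ::
  "'a::euclidean_space based_roots \<Rightarrow> ('a \<Rightarrow> 'a) \<Rightarrow> nat list \<Rightarrow> ('a \<Rightarrow> 'a) \<Rightarrow> bool" where
  "expression D w js \<sigma> \<longleftrightarrow>
     set js \<subseteq> aff_idx D \<and> \<sigma> \<in> alcove_stab D \<and> w = wprod D js \<circ> \<sigma>"

text \<open>
  Since the extended group is the semidirect product of the Coxeter group \<open>W\<close> by the stabiliser of
  the fundamental alcove, this is the Coxeter length on \<open>W\<close> extended by \<open>\<ell>(w\<sigma>) = \<ell>(w)\<close>.
\<close>

definition len :: "'a::euclidean_space based_roots \<Rightarrow> ('a \<Rightarrow> 'a) \<Rightarrow> nat" where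
  "len D w = (LEAST l. \<exists>js \<sigma>. expression D w js \<sigma> \<and> l = length js)"

definition reduced_expression ::
  "'a::euclidean_space based_roots \<Rightarrow> ('a \<Rightarrow> 'a) \<Rightarrow> nat list \<Rightarrow> ('a \<Rightarrow> 'a) \<Rightarrow> bool" where
  "reduced_expression D w js \<sigma> \<longleftrightarrow> expression D w js \<sigma> \<and> length js = len D w"

definition inv_roots :: "'a::euclidean_space based_roots \<Rightarrow> ('a \<Rightarrow> 'a) \<Rightarrow> 'a set" where
  "inv_roots D w = {\<beta> \<in> ind_pos_roots D. - (inv_into UNIV w \<beta>) \<in> ind_pos_roots D}"

definition crosses_up ::
  "'a::euclidean_space based_roots \<Rightarrow> ('a \<Rightarrow> 'a) \<Rightarrow> ('a \<Rightarrow> 'a) \<Rightarrow> 'a \<Rightarrow> int \<Rightarrow> bool" where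
  "crosses_up D w w' \<beta> k \<longleftrightarrow>
     w ` alcove0 D \<subseteq> {x. x \<bullet> \<beta> \<le> of_int k} \<and> w' ` alcove0 D \<subseteq> {x. of_int k \<le> x \<bullet> \<beta>}"

definition positive_crossing ::
  "'a::euclidean_space based_roots \<Rightarrow> ('a \<Rightarrow> 'a) \<Rightarrow> nat \<Rightarrow> bool" where
  "positive_crossing D w i \<longleftrightarrow> (\<exists>\<beta>\<in>pos_roots D. \<exists>k. crosses_up D w (w \<circ> sgen D i) \<beta> k)"

definition negative_crossing ::
  "'a::euclidean_space based_roots \<Rightarrow> ('a \<Rightarrow> 'a) \<Rightarrow> nat \<Rightarrow> bool" where
  "negative_crossing D w i \<longleftrightarrow> (\<exists>\<beta>\<in>pos_roots D. \<exists>k. crosses_up D (w \<circ> sgen D i) w \<beta> k)"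

text \<open>The pair \<open>(\<beta>, k)\<close> stands for the affine root \<open>\<beta> + k\<delta>\<close>.\<close>

definition aff_sroot :: "'a::euclidean_space based_roots \<Rightarrow> nat \<Rightarrow> 'a \<times> int" where
  "aff_sroot D i = (if i = 0 then (- highest_root D, 1) else (sroot D i, 0))"

definition aff_root_act :: "('a::euclidean_space \<Rightarrow> 'a) \<Rightarrow> 'a \<times> int \<Rightarrow> 'a \<times> int" where
  "aff_root_act u b = (u (fst b), snd b)"

definition aff_root_double :: "'a::euclidean_space \<times> int \<Rightarrow> 'a \<times> int" where
  "aff_root_double b = (2 *\<^sub>R fst b, 2 * snd b)"


section \<open>Parabolic data\<close>

definition par_roots :: "'a::euclidean_space based_roots \<Rightarrow> nat set \<Rightarrow> 'a set" where
  "par_roots D J = roots D \<inter> span (sroot D ` J)"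

definition par_pos_roots :: "'a::euclidean_space based_roots \<Rightarrow> nat set \<Rightarrow> 'a set" where
  "par_pos_roots D J = par_roots D J \<inter> pos_roots D"

definition par_coroot_lattice :: "'a::euclidean_space based_roots \<Rightarrow> nat set \<Rightarrow> 'a set" where
  "par_coroot_lattice D J =
     {x. \<exists>c :: 'a \<Rightarrow> int. x = (\<Sum>\<beta>\<in>par_roots D J. of_int (c \<beta>) *\<^sub>R coroot \<beta>)}"

definition longest :: "'a::euclidean_space based_roots \<Rightarrow> nat set \<Rightarrow> 'a \<Rightarrow> 'a" where
  "longest D J = (THE y. y \<in> par_weyl D J \<and> (\<forall>x\<in>par_weyl D J. len D x \<le> len D y))"

definition min_reps :: "'a::euclidean_space based_roots \<Rightarrow> nat set \<Rightarrow> ('a \<Rightarrow> 'a) set" where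
  "min_reps D J = {u \<in> fin_weyl D. \<forall>y\<in>par_weyl D J. len D u \<le> len D (y \<circ> u)}"

definition lin_par ::
  "'a::euclidean_space based_roots \<Rightarrow> nat set \<Rightarrow> ('a \<Rightarrow> 'a) \<Rightarrow> 'a \<Rightarrow> 'a" where
  "lin_par D J w = (THE y. y \<in> par_weyl D J \<and> (\<exists>u\<in>min_reps D J. lin w = y \<circ> u))"

definition lin_min ::
  "'a::euclidean_space based_roots \<Rightarrow> nat set \<Rightarrow> ('a \<Rightarrow> 'a) \<Rightarrow> 'a \<Rightarrow> 'a" where
  "lin_min D J w = (THE u. u \<in> min_reps D J \<and> (\<exists>y\<in>par_weyl D J. lin w = y \<circ> u))"

definition par_alcove :: "'a::euclidean_space based_roots \<Rightarrow> nat set \<Rightarrow> 'a set" where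
  "par_alcove D J = {x. \<forall>\<beta>\<in>par_pos_roots D J. 0 \<le> x \<bullet> \<beta> \<and> x \<bullet> \<beta> \<le> 1}"

definition par_ext_weyl :: "'a::euclidean_space based_roots \<Rightarrow> nat set \<Rightarrow> ('a \<Rightarrow> 'a) set" where
  "par_ext_weyl D J = {w \<in> ext_weyl D. w ` alcove0 D \<subseteq> par_alcove D J}"

definition par_coweights :: "'a::euclidean_space based_roots \<Rightarrow> nat set \<Rightarrow> 'a set" where
  "par_coweights D J = coweights D \<inter> par_alcove D J"

definition tau :: "'a::euclidean_space based_roots \<Rightarrow> nat set \<Rightarrow> 'a \<Rightarrow> 'a \<Rightarrow> 'a" where
  "tau D J \<mu> =
     transl \<mu> \<circ> (longest D (J - {j\<in>J. \<mu> \<bullet> sroot D j \<noteq> 0}) \<circ> longest D J)"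

definition fundamental_domain ::
  "'a::euclidean_space based_roots \<Rightarrow> nat set \<Rightarrow> ('a \<Rightarrow> 'a) set \<Rightarrow> bool" where
  "fundamental_domain D J F \<longleftrightarrow>
     F \<subseteq> par_ext_weyl D J \<and>
     (\<forall>w\<in>par_ext_weyl D J. 
        \<exists>!z. fst z \<in> par_coweights D J \<and> snd z \<in> F \<and> w = tau D J (fst z) \<circ> snd z)"

definition dom_wt ::
  "'a::euclidean_space based_roots \<Rightarrow> nat set \<Rightarrow> ('a \<Rightarrow> 'a) set \<Rightarrow> ('a \<Rightarrow> 'a) \<Rightarrow> 'a" where
  "dom_wt D J F w = (THE \<mu>. \<mu> \<in> par_coweights D J \<and> (\<exists>u\<in>F. w = tau D J \<mu> \<circ> u))"

definition dom_rep ::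
  "'a::euclidean_space based_roots \<Rightarrow> nat set \<Rightarrow> ('a \<Rightarrow> 'a) set \<Rightarrow> ('a \<Rightarrow> 'a) \<Rightarrow> 'a \<Rightarrow> 'a" where
  "dom_rep D J F w = (THE u. u \<in> F \<and> (\<exists>\<mu>\<in>par_coweights D J. w = tau D J \<mu> \<circ> u))"


section \<open>Coefficient rings\<close>

text \<open>
  A monomial \<open>\<Prod>x\<^sub>i\<^bsup>a i\<^esup>\<close> is its finitely supported exponent function, and a Laurent polynomial is a
  finitely supported function on monomials with the convolution product.
\<close>

type_synonym monomial = "nat \<Rightarrow>\<^sub>0 int"
type_synonym qpoly = "monomial \<Rightarrow>\<^sub>0 int"
type_synonym zpoly = "monomial \<Rightarrow>\<^sub>0 qpoly"

definition laurent_ring :: "nat set \<Rightarrow> 'c::comm_ring_1 set \<Rightarrow> (monomial \<Rightarrow>\<^sub>0 'c) ring" where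
  "laurent_ring S A =
     \<lparr>carrier = {p. (\<forall>e\<in>Poly_Mapping.keys p. Poly_Mapping.keys e \<subseteq> S) \<and>
                    (\<forall>e. Poly_Mapping.lookup p e \<in> A)},
      mult = (*), one = 1, zero = 0, add = (+)\<rparr>"

definition gen_conj :: "'a::euclidean_space based_roots \<Rightarrow> nat \<Rightarrow> nat \<Rightarrow> bool" where
  "gen_conj D i j \<longleftrightarrow> (\<exists>g\<in>ext_weyl D. g \<circ> sgen D i = sgen D j \<circ> g)"

text \<open>
  The parameters are identified along conjugacy of generators by using one variable per conjugacy
  class, numbered by the least index in the class.
\<close>

definition qvar :: "'a::euclidean_space based_roots \<Rightarrow> nat \<Rightarrow> nat" where
  "qvar D i = (LEAST j. j \<in> aff_idx D \<and> gen_conj D i j)"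

definition qring :: "'a::euclidean_space based_roots \<Rightarrow> qpoly ring" where
  "qring D = laurent_ring (qvar D ` aff_idx D) UNIV"

definition qpar :: "'a::euclidean_space based_roots \<Rightarrow> nat \<Rightarrow> qpoly" where
  "qpar D i = Poly_Mapping.single (Poly_Mapping.single (qvar D i) 1) 1"

definition qdiff :: "'a::euclidean_space based_roots \<Rightarrow> nat \<Rightarrow> qpoly" where
  "qdiff D i = qpar D i \<ominus>\<^bsub>qring D\<^esub> inv\<^bsub>qring D\<^esub> (qpar D i)"

definition zring :: "'a::euclidean_space based_roots \<Rightarrow> zpoly ring" where
  "zring D = laurent_ring (fin_idx D) (carrier (qring D))"

text \<open>The \<open>i\<close>-th coordinate of \<open>\<mu>\<close> in the basis of fundamental coweights is \<open>\<mu> \<bullet> \<alpha>\<^sub>i\<close>.\<close>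

definition zmon :: "'a::euclidean_space based_roots \<Rightarrow> 'a \<Rightarrow> zpoly" where
  "zmon D \<mu> =
     Poly_Mapping.single (\<Sum>i\<in>fin_idx D. Poly_Mapping.single i \<lfloor>\<mu> \<bullet> sroot D i\<rfloor>) 1"

definition zideal :: "'a::euclidean_space based_roots \<Rightarrow> nat set \<Rightarrow> zpoly set" where
  "zideal D J =
     Idl\<^bsub>zring D\<^esub> {zmon D \<gamma> \<ominus>\<^bsub>zring D\<^esub> \<one>\<^bsub>zring D\<^esub> | \<gamma>. \<gamma> \<in> par_coroot_lattice D J}"

definition zringJ :: "'a::euclidean_space based_roots \<Rightarrow> nat set \<Rightarrow> zpoly set ring" where
  "zringJ D J = zring D Quot zideal D J"

definition zmonJ :: "'a::euclidean_space based_roots \<Rightarrow> nat set \<Rightarrow> 'a \<Rightarrow> zpoly set" where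
  "zmonJ D J \<mu> = zideal D J +>\<^bsub>zring D\<^esub> zmon D \<mu>"

definition embJ :: "'a::euclidean_space based_roots \<Rightarrow> nat set \<Rightarrow> qpoly \<Rightarrow> zpoly set" where
  "embJ D J r = zideal D J +>\<^bsub>zring D\<^esub> Poly_Mapping.single 0 r"


section \<open>Parameter systems\<close>

locale parameter_system =
  fixes D :: "'a::euclidean_space based_roots" and J :: "nat set" and v :: "'a \<Rightarrow> qpoly"
  assumes v_unit: "\<And>\<beta>. \<beta> \<in> par_roots D J \<Longrightarrow> v \<beta> \<in> Units (qring D)"
    and v_orbit: "\<And>\<beta> y. \<beta> \<in> par_roots D J \<Longrightarrow> y \<in> par_weyl D J \<Longrightarrow> v (y \<beta>) = v \<beta>"
    and v_simple: "\<And>j. j \<in> J \<Longrightarrow> 2 *\<^sub>R sroot D j \<notin> par_roots D J \<Longrightarrow>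
      v (sroot D j) \<in> {qpar D j, \<ominus>\<^bsub>qring D\<^esub> (inv\<^bsub>qring D\<^esub> (qpar D j))}"
    and v_nonreduced_0: "\<exists>\<beta>\<in>par_roots D J. 2 *\<^sub>R \<beta> \<in> par_roots D J \<Longrightarrow>
      v (2 *\<^sub>R sroot D DIM('a)) \<in> {qpar D 0, \<ominus>\<^bsub>qring D\<^esub> (inv\<^bsub>qring D\<^esub> (qpar D 0))}"
    and v_nonreduced_n: "\<exists>\<beta>\<in>par_roots D J. 2 *\<^sub>R \<beta> \<in> par_roots D J \<Longrightarrow>
      v (sroot D DIM('a)) \<otimes>\<^bsub>qring D\<^esub> v (2 *\<^sub>R sroot D DIM('a))
        \<in> {qpar D DIM('a), \<ominus>\<^bsub>qring D\<^esub> (inv\<^bsub>qring D\<^esub> (qpar D DIM('a)))}"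

definition v_aff ::
  "'a::euclidean_space based_roots \<Rightarrow> nat set \<Rightarrow> ('a \<Rightarrow> qpoly) \<Rightarrow> 'a \<times> int \<Rightarrow> qpoly" where
  "v_aff D J v b = (if fst b \<in> par_roots D J then v (fst b) else \<one>\<^bsub>qring D\<^esub>)"

definition v_wt ::
  "'a::euclidean_space based_roots \<Rightarrow> nat set \<Rightarrow> ('a \<Rightarrow> qpoly) \<Rightarrow> 'a \<Rightarrow> qpoly" where
  "v_wt D J v \<mu> = (\<Otimes>\<^bsub>qring D\<^esub>\<beta>\<in>par_pos_roots D J. v \<beta> [^]\<^bsub>qring D\<^esub> \<lfloor>\<mu> \<bullet> \<beta>\<rfloor>)"

definition v_inv ::
  "'a::euclidean_space based_roots \<Rightarrow> nat set \<Rightarrow> ('a \<Rightarrow> qpoly) \<Rightarrow> ('a \<Rightarrow> 'a) \<Rightarrow> qpoly" where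
  "v_inv D J v y =
     (\<Otimes>\<^bsub>qring D\<^esub>\<beta>\<in>inv_roots D y.
        v_aff D J v (\<beta>, 0) \<otimes>\<^bsub>qring D\<^esub> v_aff D J v (aff_root_double (\<beta>, 0)))"


section \<open>Bases and matrices\<close>

definition expansion ::
  "('r, 'x) ring_scheme \<Rightarrow> ('r, 'm, 'y) module_scheme \<Rightarrow> 'i set \<Rightarrow> ('i \<Rightarrow> 'm) \<Rightarrow> 'm
     \<Rightarrow> ('i \<Rightarrow> 'r) \<Rightarrow> bool" where
  "expansion R M B b x c \<longleftrightarrow>
     c \<in> B \<rightarrow>\<^sub>E carrier R \<and> finite {i\<in>B. c i \<noteq> \<zero>\<^bsub>R\<^esub>} \<and>
     x = (\<Oplus>\<^bsub>M\<^esub>i\<in>{i\<in>B. c i \<noteq> \<zero>\<^bsub>R\<^esub>}. c i \<odot>\<^bsub>M\<^esub> b i)"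

definition module_basis ::
  "('r, 'x) ring_scheme \<Rightarrow> ('r, 'm, 'y) module_scheme \<Rightarrow> 'i set \<Rightarrow> ('i \<Rightarrow> 'm) \<Rightarrow> bool" where
  "module_basis R M B b \<longleftrightarrow>
     b ` B \<subseteq> carrier M \<and> (\<forall>x\<in>carrier M. \<exists>!c. expansion R M B b x c)"

text \<open>Row convention: the image of the \<open>u\<close>-th basis vector is \<open>\<Sum>v. entry u v \<cdot> b v\<close>.\<close>

definition matrix_entry ::
  "('r, 'x) ring_scheme \<Rightarrow> ('r, 'm, 'y) module_scheme \<Rightarrow> 'i set \<Rightarrow> ('i \<Rightarrow> 'm) \<Rightarrow> ('m \<Rightarrow> 'm)
     \<Rightarrow> 'i \<Rightarrow> 'i \<Rightarrow> 'r" where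
  "matrix_entry R M B b f u v = (THE c. expansion R M B b (f (b u)) c) v"


section \<open>The extended affine Hecke algebra and its modules\<close>

locale hecke_algebra =
  fixes D :: "'a::euclidean_space based_roots"
    and H :: "(qpoly, 'h) module" and T :: "('a \<Rightarrow> 'a) \<Rightarrow> 'h"
  assumes H_ring: "ring H"
    and H_module: "module (qring D) H"
    and H_smult_l: "\<And>r x y. r \<in> carrier (qring D) \<Longrightarrow> x \<in> carrier H \<Longrightarrow> y \<in> carrier H \<Longrightarrow>
      (r \<odot>\<^bsub>H\<^esub> x) \<otimes>\<^bsub>H\<^esub> y = r \<odot>\<^bsub>H\<^esub> (x \<otimes>\<^bsub>H\<^esub> y)"
    and H_smult_r: "\<And>r x y. r \<in> carrier (qring D) \<Longrightarrow> x \<in> carrier H \<Longrightarrow> y \<in> carrier H \<Longrightarrow>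
      x \<otimes>\<^bsub>H\<^esub> (r \<odot>\<^bsub>H\<^esub> y) = r \<odot>\<^bsub>H\<^esub> (x \<otimes>\<^bsub>H\<^esub> y)"
    and T_basis: "module_basis (qring D) H (ext_weyl D) T"
    and T_mult: "\<And>w w'. w \<in> ext_weyl D \<Longrightarrow> w' \<in> ext_weyl D \<Longrightarrow>
      len D (w \<circ> w') = len D w + len D w' \<Longrightarrow> T w \<otimes>\<^bsub>H\<^esub> T w' = T (w \<circ> w')"
    and T_quad: "\<And>w i. w \<in> ext_weyl D \<Longrightarrow> i \<in> aff_idx D \<Longrightarrow>
      len D w = len D (w \<circ> sgen D i) + 1 \<Longrightarrow>
      T w \<otimes>\<^bsub>H\<^esub> T (sgen D i) = T (w \<circ> sgen D i) \<oplus>\<^bsub>H\<^esub> qdiff D i \<odot>\<^bsub>H\<^esub> T w"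

definition X_word ::
  "'a::euclidean_space based_roots \<Rightarrow> (qpoly, 'h) module \<Rightarrow> (('a \<Rightarrow> 'a) \<Rightarrow> 'h)
     \<Rightarrow> nat list \<Rightarrow> ('a \<Rightarrow> 'a) \<Rightarrow> 'h" where
  "X_word D H T js \<sigma> =
     foldr (\<lambda>k h. (if positive_crossing D (wprod D (take k js)) (js ! k)
                    then T (sgen D (js ! k)) else inv\<^bsub>H\<^esub> (T (sgen D (js ! k)))) \<otimes>\<^bsub>H\<^esub> h)
       [0..<length js] (T \<sigma>)"

text \<open>\<open>X_word\<close> takes the same value on all expressions of \<open>w\<close>, so the choice is immaterial.\<close>

definition X_elt ::
  "'a::euclidean_space based_roots \<Rightarrow> (qpoly, 'h) module \<Rightarrow> (('a \<Rightarrow> 'a) \<Rightarrow> 'h)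
     \<Rightarrow> ('a \<Rightarrow> 'a) \<Rightarrow> 'h" where
  "X_elt D H T w = (case SOME (js, \<sigma>). expression D w js \<sigma> of (js, \<sigma>) \<Rightarrow> X_word D H T js \<sigma>)"

text \<open>\<open>act x h\<close> is the right action \<open>x \<cdot> h\<close>; \<open>H\<close> acts by maps linear over \<open>zringJ D J\<close>.\<close>

locale hecke_right_module =
  fixes D :: "'a::euclidean_space based_roots" and J :: "nat set"
    and H :: "(qpoly, 'h) module"
    and M :: "(zpoly set, 'm) module" and act :: "'m \<Rightarrow> 'h \<Rightarrow> 'm"
  assumes M_module: "module (zringJ D J) M"
    and act_closed: "\<And>x h. x \<in> carrier M \<Longrightarrow> h \<in> carrier H \<Longrightarrow> act x h \<in> carrier M"
    and act_add_l: "\<And>x y h. x \<in> carrier M \<Longrightarrow> y \<in> carrier M \<Longrightarrow> h \<in> carrier H \<Longrightarrow>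
      act (x \<oplus>\<^bsub>M\<^esub> y) h = act x h \<oplus>\<^bsub>M\<^esub> act y h"
    and act_add_r: "\<And>x h k. x \<in> carrier M \<Longrightarrow> h \<in> carrier H \<Longrightarrow> k \<in> carrier H \<Longrightarrow>
      act x (h \<oplus>\<^bsub>H\<^esub> k) = act x h \<oplus>\<^bsub>M\<^esub> act x k"
    and act_mult: "\<And>x h k. x \<in> carrier M \<Longrightarrow> h \<in> carrier H \<Longrightarrow> k \<in> carrier H \<Longrightarrow>
      act x (h \<otimes>\<^bsub>H\<^esub> k) = act (act x h) k"
    and act_one: "\<And>x. x \<in> carrier M \<Longrightarrow> act x \<one>\<^bsub>H\<^esub> = x"
    and act_smult_l: "\<And>z x h. z \<in> carrier (zringJ D J) \<Longrightarrow> x \<in> carrier M \<Longrightarrow> h \<in> carrier H \<Longrightarrow>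
      act (z \<odot>\<^bsub>M\<^esub> x) h = z \<odot>\<^bsub>M\<^esub> act x h"
    and act_smult_r: "\<And>r x h. r \<in> carrier (qring D) \<Longrightarrow> x \<in> carrier M \<Longrightarrow> h \<in> carrier H \<Longrightarrow>
      act x (r \<odot>\<^bsub>H\<^esub> h) = embJ D J r \<odot>\<^bsub>M\<^esub> act x h"

locale induced_module = hecke_right_module D J H M act
  for D :: "'a::euclidean_space based_roots" and J and H :: "(qpoly, 'h) module"
    and M :: "(zpoly set, 'm) module" and act +
  fixes v :: "'a \<Rightarrow> qpoly" and T :: "('a \<Rightarrow> 'a) \<Rightarrow> 'h" and m :: "('a \<Rightarrow> 'a) \<Rightarrow> 'm"
  assumes m_basis: "module_basis (zringJ D J) M (min_reps D J) m"
    and act_T_stab: "\<And>u \<sigma>. u \<in> min_reps D J \<Longrightarrow> \<sigma> \<in> alcove_stab D \<Longrightarrow>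
      act (m u) (T \<sigma>) = zmonJ D J (wt (u \<circ> \<sigma>)) \<odot>\<^bsub>M\<^esub> m (lin_min D J (u \<circ> \<sigma>))"
    and act_T_pos: "\<And>u i. u \<in> min_reps D J \<Longrightarrow> i \<in> aff_idx D \<Longrightarrow>
      u \<circ> sgen D i \<in> par_ext_weyl D J \<Longrightarrow> positive_crossing D u i \<Longrightarrow>
      act (m u) (T (sgen D i)) =
        zmonJ D J (wt (u \<circ> sgen D i)) \<odot>\<^bsub>M\<^esub> m (lin_min D J (u \<circ> sgen D i))"
    and act_T_neg: "\<And>u i. u \<in> min_reps D J \<Longrightarrow> i \<in> aff_idx D \<Longrightarrow>
      u \<circ> sgen D i \<in> par_ext_weyl D J \<Longrightarrow> negative_crossing D u i \<Longrightarrow>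
      act (m u) (T (sgen D i)) =
        zmonJ D J (wt (u \<circ> sgen D i)) \<odot>\<^bsub>M\<^esub> m (lin_min D J (u \<circ> sgen D i))
        \<oplus>\<^bsub>M\<^esub> embJ D J (qdiff D i) \<odot>\<^bsub>M\<^esub> m u"
    and act_T_bounce: "\<And>u i. u \<in> min_reps D J \<Longrightarrow> i \<in> aff_idx D \<Longrightarrow>
      u \<circ> sgen D i \<notin> par_ext_weyl D J \<Longrightarrow>
      act (m u) (T (sgen D i)) =
        embJ D J (v_aff D J v (aff_root_act u (aff_sroot D i)) \<otimes>\<^bsub>qring D\<^esub>
                  v_aff D J v (aff_root_double (aff_root_act u (aff_sroot D i)))) \<odot>\<^bsub>M\<^esub> m u"

text \<open>
  The defining property of the linear map \<open>varpi\<close>; it determines \<open>varpi\<close> on the carrier of \<open>H\<close> because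
  the \<open>X_elt D H T w\<close> form a basis.
\<close>

locale varpi_map =
  fixes D :: "'a::euclidean_space based_roots" and J :: "nat set" and v :: "'a \<Rightarrow> qpoly"
    and H :: "(qpoly, 'h) module" and T :: "('a \<Rightarrow> 'a) \<Rightarrow> 'h"
    and M :: "(zpoly set, 'm) module" and m :: "('a \<Rightarrow> 'a) \<Rightarrow> 'm"
    and varpi :: "'h \<Rightarrow> 'm"
  assumes varpi_closed: "\<And>h. h \<in> carrier H \<Longrightarrow> varpi h \<in> carrier M"
    and varpi_add: "\<And>h k. h \<in> carrier H \<Longrightarrow> k \<in> carrier H \<Longrightarrow> varpi (h \<oplus>\<^bsub>H\<^esub> k) = varpi h \<oplus>\<^bsub>M\<^esub> varpi k"
    and varpi_smult: "\<And>r h. r \<in> carrier (qring D) \<Longrightarrow> h \<in> carrier H \<Longrightarrow>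
      varpi (r \<odot>\<^bsub>H\<^esub> h) = embJ D J r \<odot>\<^bsub>M\<^esub> varpi h"
    and varpi_X: "\<And>w. w \<in> ext_weyl D \<Longrightarrow>
      varpi (X_elt D H T w) =
        (embJ D J (v_wt D J v (wt w) \<otimes>\<^bsub>qring D\<^esub> inv\<^bsub>qring D\<^esub> (v_inv D J v (lin_par D J w)))
           \<otimes>\<^bsub>zringJ D J\<^esub> zmonJ D J (wt w))
        \<odot>\<^bsub>M\<^esub> m (lin_min D J w)"


section \<open>Folded alcove paths\<close>

text \<open>
  The path \<open>(v\<^sub>0, ..., v\<^sub>l, v\<^sub>l\<sigma>)\<close> is the list of these \<open>l + 2\<close> elements; step \<open>k < l\<close> below goes from
  \<open>p ! k\<close> to \<open>p ! Suc k\<close> and has type \<open>js ! k\<close>.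
\<close>

definition folded_paths ::
  "'a::euclidean_space based_roots \<Rightarrow> nat set \<Rightarrow> nat list \<Rightarrow> ('a \<Rightarrow> 'a) \<Rightarrow> ('a \<Rightarrow> 'a)
     \<Rightarrow> ('a \<Rightarrow> 'a) list set" where
  "folded_paths D J js \<sigma> s =
     {p. length p = length js + 2 \<and> set p \<subseteq> par_ext_weyl D J \<and> p ! 0 = s \<and>
         (\<forall>k<length js. p ! Suc k \<in> {p ! k, p ! k \<circ> sgen D (js ! k)} \<and>
            (p ! Suc k = p ! k \<longrightarrow> p ! k \<circ> sgen D (js ! k) \<in> par_ext_weyl D J \<longrightarrow>
               negative_crossing D (p ! k) (js ! k))) \<and>
         p ! Suc (length js) = p ! length js \<circ> \<sigma>}"

definition fold_count ::
  "'a::euclidean_space based_roots \<Rightarrow> nat set \<Rightarrow> nat list \<Rightarrow> ('a \<Rightarrow> 'a) list \<Rightarrow> nat \<Rightarrow> nat" where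
  "fold_count D J js p i =
     card {k. k < length js \<and> js ! k = i \<and> p ! Suc k = p ! k \<and>
              p ! k \<circ> sgen D (js ! k) \<in> par_ext_weyl D J}"

definition bounce_at ::
  "'a::euclidean_space based_roots \<Rightarrow> nat set \<Rightarrow> nat list \<Rightarrow> ('a \<Rightarrow> 'a) list \<Rightarrow> nat \<Rightarrow> bool" where
  "bounce_at D J js p k \<longleftrightarrow>
     k < length js \<and> p ! Suc k = p ! k \<and> p ! k \<circ> sgen D (js ! k) \<notin> par_ext_weyl D J"

definition bounce_count ::
  "'a::euclidean_space based_roots \<Rightarrow> nat set \<Rightarrow> nat list \<Rightarrow> ('a \<Rightarrow> 'a) list \<Rightarrow> 'a \<Rightarrow> nat" where
  "bounce_count D J js p \<beta> =
     card {k. bounce_at D J js p k \<and> crosses_up D (p ! k \<circ> sgen D (js ! k)) (p ! k) \<beta> 0} +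
     card {k. bounce_at D J js p k \<and> crosses_up D (p ! k) (p ! k \<circ> sgen D (js ! k)) \<beta> 1}"

definition path_weight ::
  "'a::euclidean_space based_roots \<Rightarrow> nat set \<Rightarrow> ('a \<Rightarrow> qpoly) \<Rightarrow> nat list
     \<Rightarrow> ('a \<Rightarrow> 'a) list \<Rightarrow> qpoly" where
  "path_weight D J v js p =
     (\<Otimes>\<^bsub>qring D\<^esub>\<beta>\<in>par_pos_roots D J. v \<beta> [^]\<^bsub>qring D\<^esub> bounce_count D J js p \<beta>)
     \<otimes>\<^bsub>qring D\<^esub> (\<Otimes>\<^bsub>qring D\<^esub>i\<in>aff_idx D. qdiff D i [^]\<^bsub>qring D\<^esub> fold_count D J js p i)"

end

theory Submission
  imports Defs
begin

text \<open>
  Write \<open>b\<^sub>w = varpi (X\<^sub>w)\<close>. Suppose that \<open>w A\<^sub>0\<close> lies in \<open>\<A>\<^sub>J\<close>. Then \<open>w = \<tau>\<^sub>\<mu> u\<close> with \<open>\<mu> = wt w\<close> and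
  \<open>u \<in> W\<^sup>J\<close> (\<open>par_ext_decomposition\<close>). The positive roots of \<open>\<Phi>\<^sub>J\<close> on which \<open>\<mu>\<close> takes the value 1 are
  the inversions of the linear part of \<open>\<tau>\<^sub>\<mu>\<close>, and \<open>\<mu>\<close> vanishes on the others; so the two scalars in the
  definition of \<open>varpi\<close> cancel (\<open>v_wt_eq_v_inv\<close>) and \<open>b\<^sub>w\<close> is the monomial of \<open>wt w\<close> times the basis
  vector of \<open>u\<close>. In particular \<open>\<tau>\<^sub>\<mu>\<close> acts on the family \<open>b\<close> by the monomial of \<open>\<mu>\<close>
  (\<open>bvec_aligned\<close>).

  Because \<open>\<tau>\<^sub>\<mu>\<close> preserves \<open>\<A>\<^sub>J\<close>, it preserves the distinction between crossings and bounces, and it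
  preserves the sign of a crossing inside \<open>\<A>\<^sub>J\<close>, whose wall is not parallel to a wall of \<open>\<A>\<^sub>J\<close>. The
  defining formulas for the action of \<open>T\<^sub>i\<close> on the vectors of \<open>W\<^sup>J\<close> therefore hold for all \<open>b\<^sub>w\<close>:
  \<open>b\<^sub>w T\<^sub>i\<close> is \<open>b\<close> of \<open>w s\<^sub>i\<close>, plus \<open>(q\<^sub>i - q\<^sub>i\<^sup>-\<^sup>1) b\<^sub>w\<close> at a negative crossing (\<open>act_crossing\<close>), or
  the product of the parameters of the hyperplanes hit times \<open>b\<^sub>w\<close> at a bounce (\<open>act_bounce\<close>). These
  are the steps of folded paths with their weights. Induction along a reduced word gives
  \<open>b\<^sub>u T\<^sub>w\<close> as the sum of \<open>Q(p) b\<close> over the ends of the paths \<open>p\<close> (\<open>act_path_sum\<close>), and moving the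
  ends into \<open>F\<close> by elements \<open>\<tau>\<^sub>\<mu>\<close> produces the matrix entries. The vectors \<open>b\<^sub>u\<close>, \<open>u \<in> F\<close>, form a
  basis because \<open>F\<close> and \<open>W\<^sup>J\<close> represent the same orbits (\<open>dom_bij_min_reps\<close>), so that they are unit
  multiples of the given basis vectors.

  The geometry rests on one fact: the \<open>i\<close>-th wall is the only hyperplane that separates \<open>A\<^sub>0\<close> from
  \<open>s\<^sub>i A\<^sub>0\<close> (\<open>separated_by_simple\<close>). Applied after \<open>w\<close>, it says that an affine root separating \<open>w A\<^sub>0\<close>
  from \<open>w s\<^sub>i A\<^sub>0\<close> pulls back to a multiple of the \<open>i\<close>-th affine simple root, so crossings and bounces
  are questions about one root. For \<open>i = 0\<close> this uses the highest root, whose existence follows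
  from irreducibility. Lengths enter because minimal representatives and longest elements are defined
  through them; for elements of \<open>W\<^sub>0\<close> the length is the number of inversions (\<open>fin_weyl_len\<close>), which
  turns both notions into sign conditions on roots.
\<close>

section \<open>Simple roots and their dual basis\<close>

lemma finite_fin_idx [simp]: "finite (fin_idx D)"
  by (simp add: fin_idx_def)

lemma aff_idx_eq: "aff_idx D = insert 0 (fin_idx D)"
  by (auto simp: aff_idx_def fin_idx_def)

lemma finite_aff_idx [simp]: "finite (aff_idx D)"
  by (simp add: aff_idx_def)

lemma zero_notin_fin_idx [simp]: "0 \<notin> fin_idx D"
  by (simp add: fin_idx_def)

lemma fin_idx_sub_aff_idx: "i \<in> fin_idx D \<Longrightarrow> i \<in> aff_idx D"
  by (simp add: aff_idx_eq)

lemma int_between_0_1: "(x::real) \<in> \<int> \<Longrightarrow> 0 \<le> x \<Longrightarrow> x \<le> 1 \<Longrightarrow> x = 0 \<or> x = 1"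
  by (auto elim!: Ints_cases)

lemma Ints_ge_1: "(x::real) \<in> \<int> \<Longrightarrow> 0 < x \<Longrightarrow> 1 \<le> x"
  by (auto elim!: Ints_cases)

lemma Nats_iff_Ints_ge_0: "(x::real) \<in> \<nat> \<longleftrightarrow> x \<in> \<int> \<and> 0 \<le> x"
  by (auto simp: Nats_altdef2)

context irreducible_root_datum
begin

lemma card_sroots: "card (sroot D ` fin_idx D) = DIM('a)"
  using sroot_inj by (simp add: card_image fin_idx_def)

lemma span_sroots: "span (sroot D ` fin_idx D) = UNIV"
proof -
  have "dim (sroot D ` fin_idx D) = DIM('a)"
    using dim_eq_card_independent[OF sroot_indep] card_sroots by simp
  then show ?thesis by (simp add: dim_eq_full)
qed

lemma dual_vector_exists:
  assumes "i \<in> fin_idx D"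
  shows "\<exists>x. \<forall>j\<in>fin_idx D. x \<bullet> sroot D j = (if i = j then 1 else 0)"
proof -
  obtain g :: "'a \<Rightarrow> real" where g: "linear g"
    "\<forall>x\<in>sroot D ` fin_idx D. g x = (if x = sroot D i then 1 else 0)"
    using linear_independent_extend[OF sroot_indep, of "\<lambda>x. if x = sroot D i then 1 else 0::real"]
    by auto
  define x where "x = (\<Sum>b\<in>Basis. g b *\<^sub>R b)"
  have "x \<bullet> y = g y" for y
  proof -
    have "g y = g (\<Sum>b\<in>Basis. (y \<bullet> b) *\<^sub>R b)" by (simp add: euclidean_representation)
    also have "\<dots> = (\<Sum>b\<in>Basis. (y \<bullet> b) * g b)"
      by (simp add: linear_sum[OF g(1)] linear_cmul[OF g(1)])
    finally show ?thesis by (simp add: x_def inner_sum_left inner_sum_right inner_commute mult.commute)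
  qed
  then show ?thesis using g(2) assms sroot_inj
    by (intro exI[of _ x]) (auto simp: inj_on_def)
qed

lemma inner_sroots_eqI:
  assumes "\<And>j. j \<in> fin_idx D \<Longrightarrow> x \<bullet> sroot D j = y \<bullet> sroot D j"
  shows "x = y"
proof -
  have "orthogonal (x - y) z" if "z \<in> span (sroot D ` fin_idx D)" for z
    using that by (rule orthogonal_to_span) (auto simp: orthogonal_def inner_diff_left assms)
  then have "orthogonal (x - y) (x - y)" using span_sroots by blast
  then show ?thesis by (simp add: orthogonal_self)
qed

lemma fund_coweight_sroot:
  assumes "i \<in> fin_idx D" "j \<in> fin_idx D"
  shows "fund_coweight D i \<bullet> sroot D j = (if i = j then 1 else 0)"
proof -
  let ?P = "\<lambda>x. \<forall>j\<in>fin_idx D. x \<bullet> sroot D j = (if i = j then 1 else 0)"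
  have "\<exists>!x. ?P x"
    using dual_vector_exists[OF assms(1)] by (metis inner_sroots_eqI)
  then have "?P (THE x. ?P x)" by (rule theI')
  then show ?thesis using assms(2) unfolding fund_coweight_def by simp
qed

lemma fund_coweight_expansion: "x = (\<Sum>i\<in>fin_idx D. (x \<bullet> sroot D i) *\<^sub>R fund_coweight D i)"
  by (rule inner_sroots_eqI)
    (simp add: inner_sum_left fund_coweight_sroot if_distrib cong: if_cong)

lemma sroot_comb_coeff:
  "i \<in> fin_idx D \<Longrightarrow> (\<Sum>j\<in>fin_idx D. c j *\<^sub>R sroot D j) \<bullet> fund_coweight D i = c i"
  by (simp add: inner_sum_left fund_coweight_sroot inner_commute[of "sroot D _"] if_distrib cong: if_cong)

lemma sroot_expansion: "x = (\<Sum>i\<in>fin_idx D. (x \<bullet> fund_coweight D i) *\<^sub>R sroot D i)"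
proof -
  have "x \<in> span (sroot D ` fin_idx D)" using span_sroots by simp
  then obtain u where u: "x = (\<Sum>v\<in>sroot D ` fin_idx D. u v *\<^sub>R v)"
    by (auto simp: span_finite)
  then have "x = (\<Sum>i\<in>fin_idx D. u (sroot D i) *\<^sub>R sroot D i)"
    by (simp add: sum.reindex[OF sroot_inj])
  then show ?thesis
    by (simp add: sroot_comb_coeff)
qed

lemma inner_expansion: "x \<bullet> y = (\<Sum>i\<in>fin_idx D. (y \<bullet> fund_coweight D i) * (x \<bullet> sroot D i))"
  by (subst (1) sroot_expansion[of y]) (simp add: inner_sum_right)

text \<open>
  The fundamental coweights read off coefficients, so that the order on roots and the coweight
  lattice become conditions on one number at a time.
\<close>

lemma nonneg_comb_iff: "nonneg_comb D x \<longleftrightarrow> (\<forall>i\<in>fin_idx D. x \<bullet> fund_coweight D i \<in> \<nat>)"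
proof
  assume "nonneg_comb D x"
  then show "\<forall>i\<in>fin_idx D. x \<bullet> fund_coweight D i \<in> \<nat>"
    unfolding nonneg_comb_def by (auto simp: sroot_comb_coeff)
next
  assume "\<forall>i\<in>fin_idx D. x \<bullet> fund_coweight D i \<in> \<nat>"
  then have "\<forall>i\<in>fin_idx D. \<exists>c. x \<bullet> fund_coweight D i = real c" by (auto elim: Nats_cases)
  then obtain c where "\<forall>i\<in>fin_idx D. x \<bullet> fund_coweight D i = real (c i)" by metis
  then show "nonneg_comb D x"
    unfolding nonneg_comb_def using sroot_expansion[of x] by (auto intro!: exI[of _ c])
qed

lemma nonneg_combD: "nonneg_comb D x \<Longrightarrow> i \<in> fin_idx D \<Longrightarrow> 0 \<le> x \<bullet> fund_coweight D i"
  by (auto simp: nonneg_comb_iff Nats_iff_Ints_ge_0)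

lemma nonneg_comb_add: "nonneg_comb D x \<Longrightarrow> nonneg_comb D y \<Longrightarrow> nonneg_comb D (x + y)"
  by (simp add: nonneg_comb_iff inner_add_left)

lemma nonneg_comb_antisym: "nonneg_comb D x \<Longrightarrow> nonneg_comb D (- x) \<Longrightarrow> x = 0"
  by (subst sroot_expansion[of x]) (fastforce intro: sum.neutral dest: nonneg_combD)

lemma coweights_iff: "x \<in> coweights D \<longleftrightarrow> (\<forall>i\<in>fin_idx D. x \<bullet> sroot D i \<in> \<int>)"
proof
  assume "x \<in> coweights D"
  then show "\<forall>i\<in>fin_idx D. x \<bullet> sroot D i \<in> \<int>"
    unfolding coweights_def
    by (auto simp: inner_sum_left fund_coweight_sroot if_distrib cong: if_cong)
next
  assume "\<forall>i\<in>fin_idx D. x \<bullet> sroot D i \<in> \<int>"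
  then have "\<forall>i\<in>fin_idx D. \<exists>c. x \<bullet> sroot D i = of_int c" by (auto elim: Ints_cases)
  then obtain c where "\<forall>i\<in>fin_idx D. x \<bullet> sroot D i = of_int (c i)" by metis
  then show "x \<in> coweights D"
    unfolding coweights_def using fund_coweight_expansion[of x] by (auto intro!: exI[of _ c])
qed

section \<open>Roots\<close>

lemma finite_roots: "finite (roots D)" using root_system by (simp add: root_system_def)
lemma root_nz: "\<beta> \<in> roots D \<Longrightarrow> \<beta> \<noteq> 0" using root_system by (auto simp: root_system_def)
lemma root_inner_pos: "\<beta> \<in> roots D \<Longrightarrow> 0 < \<beta> \<bullet> \<beta>" by (simp add: root_nz)
lemma refl_root: "\<beta> \<in> roots D \<Longrightarrow> \<gamma> \<in> roots D \<Longrightarrow> aff_refl \<beta> 0 \<gamma> \<in> roots D"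
  using root_system by (auto simp: root_system_def)
lemma coroot_int: "\<beta> \<in> roots D \<Longrightarrow> \<gamma> \<in> roots D \<Longrightarrow> \<gamma> \<bullet> coroot \<beta> \<in> \<int>"
  using root_system by (auto simp: root_system_def)

lemma sroot_root: "i \<in> fin_idx D \<Longrightarrow> sroot D i \<in> roots D" using sroot_roots by auto

lemma refl_eq: "aff_refl \<beta> 0 x = x - (x \<bullet> coroot \<beta>) *\<^sub>R \<beta>"
  by (simp add: aff_refl_def coroot_def mult.commute)

lemma coroot_self: "\<beta> \<noteq> 0 \<Longrightarrow> \<beta> \<bullet> coroot \<beta> = 2"
  by (simp add: coroot_def)

lemma refl_self: "\<beta> \<noteq> 0 \<Longrightarrow> aff_refl \<beta> 0 \<beta> = - \<beta>"
  by (simp add: refl_eq coroot_self scaleR_2)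

lemma refl_linear: "linear (aff_refl \<beta> 0)"
  by (rule linearI) (simp_all add: refl_eq algebra_simps inner_add_left)

lemma refl_invol: "\<beta> \<noteq> 0 \<Longrightarrow> aff_refl \<beta> 0 (aff_refl \<beta> 0 x) = x"
  by (simp add: refl_eq inner_diff_left coroot_self algebra_simps)

lemma refl_orthogonal:
  assumes "\<beta> \<noteq> 0"
  shows "orthogonal_transformation (aff_refl \<beta> 0)"
  unfolding orthogonal_transformation_def
proof (intro conjI allI refl_linear)
  fix x y
  have *: "\<beta> \<bullet> \<beta> \<noteq> 0" using assms by simp
  show "aff_refl \<beta> 0 x \<bullet> aff_refl \<beta> 0 y = x \<bullet> y"
    using * by (simp add: aff_refl_def coroot_def inner_diff_left inner_diff_right inner_commute field_simps)
qed

lemma root_uminus: "\<beta> \<in> roots D \<Longrightarrow> - \<beta> \<in> roots D"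
  using refl_root[of \<beta> \<beta>] by (simp add: refl_self root_nz)

lemma pos_root_root: "\<beta> \<in> pos_roots D \<Longrightarrow> \<beta> \<in> roots D" by (simp add: pos_roots_def)

lemma pos_or_neg: "\<beta> \<in> roots D \<Longrightarrow> \<beta> \<in> pos_roots D \<or> - \<beta> \<in> pos_roots D"
  using root_comb root_uminus by (auto simp: pos_roots_def)

lemma pos_not_neg: "\<beta> \<in> pos_roots D \<Longrightarrow> - \<beta> \<notin> pos_roots D"
  by (auto simp: pos_roots_def dest: nonneg_comb_antisym root_nz)

lemma neg_iff_not_pos: "\<beta> \<in> roots D \<Longrightarrow> - \<beta> \<in> pos_roots D \<longleftrightarrow> \<beta> \<notin> pos_roots D"
  using pos_or_neg pos_not_neg by blast

lemma sroot_nonneg: "i \<in> fin_idx D \<Longrightarrow> nonneg_comb D (sroot D i)"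
  by (auto simp: nonneg_comb_iff fund_coweight_sroot inner_commute[of "sroot D _"])

lemma sroot_pos: "i \<in> fin_idx D \<Longrightarrow> sroot D i \<in> pos_roots D"
  by (simp add: pos_roots_def sroot_root sroot_nonneg)

lemma root_coeff_int: "\<beta> \<in> roots D \<Longrightarrow> i \<in> fin_idx D \<Longrightarrow> \<beta> \<bullet> fund_coweight D i \<in> \<int>"
  using root_comb[of \<beta>] by (auto simp: nonneg_comb_iff Nats_iff_Ints_ge_0)

lemma pos_rootI:
  assumes "\<beta> \<in> roots D" "i \<in> fin_idx D" "0 < \<beta> \<bullet> fund_coweight D i"
  shows "\<beta> \<in> pos_roots D"
  using assms pos_or_neg[OF assms(1)] nonneg_combD[of "-\<beta>" i] by (auto simp: pos_roots_def)

lemma pos_coeff_ge_0: "\<beta> \<in> pos_roots D \<Longrightarrow> i \<in> fin_idx D \<Longrightarrow> 0 \<le> \<beta> \<bullet> fund_coweight D i"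
  by (auto simp: pos_roots_def intro: nonneg_combD)

lemma pos_has_coeff:
  assumes "\<beta> \<in> pos_roots D" obtains i where "i \<in> fin_idx D" "0 < \<beta> \<bullet> fund_coweight D i"
proof -
  have "\<exists>i\<in>fin_idx D. \<beta> \<bullet> fund_coweight D i \<noteq> 0"
  proof (rule ccontr)
    assume "\<not> ?thesis"
    then have "\<beta> = 0" by (subst sroot_expansion) (simp add: sum.neutral)
    then show False using assms pos_root_root root_nz by blast
  qed
  then show ?thesis using that assms pos_coeff_ge_0 by (metis order_le_less)
qed

lemma scaled_pos:
  assumes "\<beta> \<in> pos_roots D" "c > 0" "c *\<^sub>R \<beta> \<in> roots D" shows "c *\<^sub>R \<beta> \<in> pos_roots D"
proof -
  obtain i where "i \<in> fin_idx D" "0 < \<beta> \<bullet> fund_coweight D i" using pos_has_coeff[OF assms(1)] .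
  then show ?thesis using assms(2,3) by (intro pos_rootI[of _ i]) auto
qed

lemma coweights_root_int:
  assumes "x \<in> coweights D" "\<beta> \<in> roots D" shows "x \<bullet> \<beta> \<in> \<int>"
  unfolding inner_expansion[of x \<beta>]
  using assms by (intro Ints_sum Ints_mult root_coeff_int) (auto simp: coweights_iff)

lemma coweightsI: "(\<And>\<beta>. \<beta> \<in> roots D \<Longrightarrow> x \<bullet> \<beta> \<in> \<int>) \<Longrightarrow> x \<in> coweights D"
  by (simp add: coweights_iff sroot_root)

lemma coroot_coweight: "\<beta> \<in> roots D \<Longrightarrow> coroot \<beta> \<in> coweights D"
  by (rule coweightsI) (metis coroot_int inner_commute)

text \<open>
  Pairing each of the two roots with the coroot of the other gives the integers \<open>2c\<close> and \<open>2/c\<close>, whose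
  product is 4.
\<close>

lemma proportional_roots:
  assumes "\<beta> \<in> roots D" "c > 0" "c *\<^sub>R \<beta> \<in> roots D"
  shows "c = 1/2 \<or> c = 1 \<or> c = 2"
proof -
  have 1: "2 * c \<in> \<int>" using coroot_int[OF assms(1,3)] coroot_self[OF root_nz[OF assms(1)]]
    by (simp add: mult.commute)
  have "\<beta> \<bullet> coroot (c *\<^sub>R \<beta>) = 2 / c"
    using assms(2) root_inner_pos[OF assms(1)] by (simp add: coroot_def field_simps)
  then have 2: "2 / c \<in> \<int>" using coroot_int[OF assms(3,1)] by simp
  obtain a b where ab: "2 * c = of_int a" "2 / c = of_int b" using 1 2 by (auto elim!: Ints_cases)
  have "a > 0" "b > 0" using ab assms(2) by (smt (verit) of_int_0_less_iff zero_less_divide_iff)+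
  have "of_int (a * b) = (4::real)" using ab assms(2) by (simp flip: ab)
  then have "a * b = 4" by linarith
  then have "a dvd 4" by (metis dvd_triv_left)
  then have "a \<le> 4" by (simp add: zdvd_imp_le)
  then have "a \<in> {1,2,3,4}" using \<open>a > 0\<close> by auto
  then have "a \<in> {1,2,4}" using \<open>a dvd 4\<close> by auto
  then show ?thesis using ab(1) by auto
qed

lemma sroot_multiple:
  assumes "i \<in> fin_idx D" "c > 0" "c *\<^sub>R sroot D i \<in> roots D"
  shows "c = 1 \<or> c = 2"
proof -
  have "c \<in> \<int>" using root_coeff_int[OF assms(3,1)] assms(1)
    by (simp add: fund_coweight_sroot inner_commute[of "sroot D i"])
  then have "1 \<le> c" using Ints_ge_1 assms(2) by blast
  then show ?thesis using proportional_roots[OF sroot_root[OF assms(1)] assms(2,3)] by auto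
qed

lemma ind_multiple_unique:
  assumes "\<beta> \<in> roots D" "c > 0" "c *\<^sub>R \<beta> \<in> roots D" "(1/2) *\<^sub>R \<beta> \<notin> roots D"
    "(1/2) *\<^sub>R c *\<^sub>R \<beta> \<notin> roots D"
  shows "c = 1"
  using proportional_roots[OF assms(1-3)]
proof (elim disjE)
  assume "c = 1/2" then show ?thesis using assms(3,4) by metis
next
  assume "c = 2" then show ?thesis using assms(1,5) by simp
qed

section \<open>The highest root\<close>

text \<open>
  The reflection changes only the coefficient of \<open>\<alpha>\<^sub>i\<close>, and some other coefficient of \<open>\<beta>\<close> is positive.
\<close>

lemma simple_refl_pos:
  assumes "i \<in> fin_idx D" "\<beta> \<in> pos_roots D" "\<nexists>c. 0 < c \<and> \<beta> = c *\<^sub>R sroot D i"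
  shows "aff_refl (sroot D i) 0 \<beta> \<in> pos_roots D"
proof -
  have "\<exists>j\<in>fin_idx D. j \<noteq> i \<and> 0 < \<beta> \<bullet> fund_coweight D j"
  proof (rule ccontr)
    assume "\<not> ?thesis"
    then have 0: "\<beta> \<bullet> fund_coweight D j = 0" if "j \<in> fin_idx D" "j \<noteq> i" for j
      using pos_coeff_ge_0[OF assms(2) that(1)] that by force
    have "\<beta> = (\<Sum>j\<in>fin_idx D. (if j = i then \<beta> \<bullet> fund_coweight D i else 0) *\<^sub>R sroot D j)"
      using 0 by (subst sroot_expansion[of \<beta>]) (auto intro!: sum.cong)
    also have "\<dots> = (\<Sum>j\<in>fin_idx D. if j = i then (\<beta> \<bullet> fund_coweight D i) *\<^sub>R sroot D j else 0)"
      by (rule sum.cong) auto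
    also have "\<dots> = (\<beta> \<bullet> fund_coweight D i) *\<^sub>R sroot D i"
      using assms(1) by simp
    finally have *: "\<beta> = (\<beta> \<bullet> fund_coweight D i) *\<^sub>R sroot D i" .
    have "\<beta> \<noteq> 0" using assms(2) pos_root_root root_nz by blast
    then have "0 < \<beta> \<bullet> fund_coweight D i"
      using pos_coeff_ge_0[OF assms(2,1)] * by (metis order_le_less scaleR_zero_left)
    then show False using * assms(3) by blast
  qed
  then obtain j where j: "j \<in> fin_idx D" "j \<noteq> i" "0 < \<beta> \<bullet> fund_coweight D j" by auto
  have "aff_refl (sroot D i) 0 \<beta> \<bullet> fund_coweight D j = \<beta> \<bullet> fund_coweight D j"
    using j assms(1) by (simp add: refl_eq inner_diff_left inner_commute[of "sroot D _"] fund_coweight_sroot)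
  then show ?thesis
    using j pos_rootI refl_root[OF sroot_root[OF assms(1)] pos_root_root[OF assms(2)]] by metis
qed

definition height :: "'a \<Rightarrow> real" where
  "height x = (\<Sum>i\<in>fin_idx D. x \<bullet> fund_coweight D i)"

lemma height_diff: "height (x - y) = height x - height y"
  by (simp add: height_def inner_diff_left sum_subtractf)

lemma height_scale: "height (c *\<^sub>R x) = c * height x"
  by (simp add: height_def sum_distrib_left)

lemma height_sroot: "i \<in> fin_idx D \<Longrightarrow> height (sroot D i) = 1"
  by (simp add: height_def inner_commute[of "sroot D _"] fund_coweight_sroot)

lemma height_pos: "nonneg_comb D x \<Longrightarrow> x \<noteq> 0 \<Longrightarrow> 0 < height x"
proof (rule ccontr)
  assume x: "nonneg_comb D x" "x \<noteq> 0" "\<not> 0 < height x"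
  have "\<forall>i\<in>fin_idx D. x \<bullet> fund_coweight D i = 0"
  proof -
    have "height x \<ge> 0" unfolding height_def by (intro sum_nonneg nonneg_combD x)
    then have "height x = 0" using x by simp
    then show ?thesis
      unfolding height_def using x(1) by (subst (asm) sum_nonneg_eq_0_iff) (auto intro: nonneg_combD)
  qed
  then have "x = 0" by (subst sroot_expansion) (simp add: sum.neutral)
  then show False using x by simp
qed

text \<open>
  A positive root has positive inner product with itself, hence with some simple root of its
  support; reflecting in the latter lowers the height. This is the induction behind every statement
  that starts from the simple roots.
\<close>

lemma pos_root_induct [consumes 1, case_names multiple reflect]:
  assumes "\<gamma> \<in> pos_roots D"
    and multiple: "\<And>i c. i \<in> fin_idx D \<Longrightarrow> 0 < c \<Longrightarrow> c *\<^sub>R sroot D i \<in> roots D \<Longrightarrow> P (c *\<^sub>R sroot D i)"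
    and reflect: "\<And>\<gamma> i. \<gamma> \<in> pos_roots D \<Longrightarrow> i \<in> fin_idx D \<Longrightarrow> 0 < \<gamma> \<bullet> fund_coweight D i \<Longrightarrow>
      0 < \<gamma> \<bullet> sroot D i \<Longrightarrow> aff_refl (sroot D i) 0 \<gamma> \<in> pos_roots D \<Longrightarrow>
      P (aff_refl (sroot D i) 0 \<gamma>) \<Longrightarrow> P \<gamma>"
  shows "P \<gamma>"
  using assms(1)
proof (induction "card {\<delta> \<in> roots D. height \<delta> < height \<gamma>}" arbitrary: \<gamma> rule: less_induct)
  case less
  show ?case
  proof (cases "\<exists>i c. i \<in> fin_idx D \<and> 0 < c \<and> \<gamma> = c *\<^sub>R sroot D i")
    case True
    then show ?thesis using multiple less.prems pos_root_root by blast
  next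
    case False
    have "0 < \<gamma> \<bullet> \<gamma>" using less.prems pos_root_root root_inner_pos by blast
    then have "\<exists>i\<in>fin_idx D. 0 < (\<gamma> \<bullet> fund_coweight D i) * (\<gamma> \<bullet> sroot D i)"
      unfolding inner_expansion[of \<gamma> \<gamma>] by (meson not_le sum_nonpos)
    then obtain i where i: "i \<in> fin_idx D" "0 < (\<gamma> \<bullet> fund_coweight D i) * (\<gamma> \<bullet> sroot D i)" by auto
    then have i2: "0 < \<gamma> \<bullet> fund_coweight D i" "0 < \<gamma> \<bullet> sroot D i"
      using pos_coeff_ge_0[OF less.prems i(1)] by (auto simp: zero_less_mult_iff)
    let ?g = "aff_refl (sroot D i) 0 \<gamma>"
    have pos: "?g \<in> pos_roots D"
      using simple_refl_pos[OF i(1) less.prems] False i(1) by blast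
    have "0 < \<gamma> \<bullet> coroot (sroot D i)"
      using i2(2) root_inner_pos[OF sroot_root[OF i(1)]] by (simp add: coroot_def)
    then have lt: "height ?g < height \<gamma>"
      by (simp add: refl_eq height_diff height_scale height_sroot i(1))
    have "{\<delta> \<in> roots D. height \<delta> < height ?g} \<subset> {\<delta> \<in> roots D. height \<delta> < height \<gamma>}"
      using lt pos pos_root_root by force
    then have "card {\<delta> \<in> roots D. height \<delta> < height ?g} < card {\<delta> \<in> roots D. height \<delta> < height \<gamma>}"
      by (intro psubset_card_mono) (simp_all add: finite_roots)
    then have "P ?g" using less.hyps pos by blast
    then show ?thesis using reflect less.prems i i2 pos by blast
  qed
qed

text \<open>
  If both Cartan integers were at least 2, the squared length of \<open>\<beta> - \<gamma>\<close> would not be positive. So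
  one of them is 1, and then the difference is, up to sign, the reflection of one root in the other.
\<close>

lemma diff_root:
  assumes "\<beta> \<in> roots D" "\<gamma> \<in> roots D" "0 < \<beta> \<bullet> \<gamma>" "\<beta> \<noteq> \<gamma>"
  shows "\<beta> - \<gamma> \<in> roots D"
proof -
  let ?a = "\<beta> \<bullet> coroot \<gamma>" and ?b = "\<gamma> \<bullet> coroot \<beta>"
  have pos: "0 < \<beta> \<bullet> \<beta>" "0 < \<gamma> \<bullet> \<gamma>" using assms root_inner_pos by auto
  have a: "?a = 2 * (\<beta> \<bullet> \<gamma>) / (\<gamma> \<bullet> \<gamma>)" and b: "?b = 2 * (\<beta> \<bullet> \<gamma>) / (\<beta> \<bullet> \<beta>)"
    by (auto simp: coroot_def inner_commute)
  have "0 < ?a" "0 < ?b" unfolding a b using pos assms(3) by auto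
  obtain a' b' where ab: "?a = of_int a'" "?b = of_int b'"
    using coroot_int assms(1,2) by (metis Ints_cases)
  have *: "a' > 0" "b' > 0" using \<open>0 < ?a\<close> \<open>0 < ?b\<close> ab by auto
  have "a' = 1 \<or> b' = 1"
  proof (rule ccontr)
    assume "\<not> ?thesis"
    then have "?a \<ge> 2" "?b \<ge> 2" using * ab by auto
    then have "\<gamma> \<bullet> \<gamma> \<le> \<beta> \<bullet> \<gamma>" "\<beta> \<bullet> \<beta> \<le> \<beta> \<bullet> \<gamma>"
      using pos by (auto simp: a b field_simps)
    then have "(\<beta> - \<gamma>) \<bullet> (\<beta> - \<gamma>) \<le> 0"
      by (simp add: inner_diff_left inner_diff_right inner_commute)
    then show False using assms(4) by (metis inner_gt_zero_iff eq_iff_diff_eq_0 not_le)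
  qed
  then show ?thesis
  proof
    assume "a' = 1"
    then show ?thesis using refl_root[OF assms(2,1)] ab by (simp add: refl_eq)
  next
    assume "b' = 1"
    then have "\<gamma> - \<beta> \<in> roots D" using refl_root[OF assms(1,2)] ab by (simp add: refl_eq)
    then show ?thesis using root_uminus by fastforce
  qed
qed

lemma sroots_obtuse:
  assumes "i \<in> fin_idx D" "j \<in> fin_idx D" "i \<noteq> j"
  shows "sroot D i \<bullet> sroot D j \<le> 0"
proof (rule ccontr)
  assume "\<not> ?thesis"
  moreover have "sroot D i \<noteq> sroot D j" using assms sroot_inj by (auto simp: inj_on_def)
  ultimately have r: "sroot D i - sroot D j \<in> roots D"
    using assms by (intro diff_root) (auto simp: sroot_root)
  have c: "(sroot D i - sroot D j) \<bullet> fund_coweight D i = 1" "(sroot D i - sroot D j) \<bullet> fund_coweight D j = - 1"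
    using assms by (auto simp: inner_diff_left inner_commute[of "sroot D _"] fund_coweight_sroot)
  then have "sroot D i - sroot D j \<in> pos_roots D" using pos_rootI[OF r assms(1)] by simp
  then show False using pos_coeff_ge_0[OF _ assms(2)] c(2) by force
qed

definition maximal_root :: "'a \<Rightarrow> bool" where
  "maximal_root \<beta> \<longleftrightarrow> \<beta> \<in> roots D \<and> (\<forall>\<gamma>\<in>roots D. nonneg_comb D (\<gamma> - \<beta>) \<longrightarrow> \<gamma> = \<beta>)"

text \<open>
  A root of greatest height among those above \<open>\<gamma>\<close> is maximal.
\<close>

lemma maximal_root_above:
  assumes "\<gamma> \<in> roots D"
  obtains \<beta> where "maximal_root \<beta>" "nonneg_comb D (\<beta> - \<gamma>)"
proof -
  let ?A = "{\<beta> \<in> roots D. nonneg_comb D (\<beta> - \<gamma>)}"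
  have fin: "finite ?A" using finite_roots by simp
  have "nonneg_comb D 0" by (simp add: nonneg_comb_iff)
  then have "\<gamma> \<in> ?A" using assms by simp
  then have "Max (height ` ?A) \<in> height ` ?A" using fin by (intro Max_in) auto
  then obtain \<beta> where \<beta>: "\<beta> \<in> ?A" "height \<beta> = Max (height ` ?A)" by auto
  have "maximal_root \<beta>" unfolding maximal_root_def
  proof (intro conjI ballI impI)
    fix \<delta> assume \<delta>: "\<delta> \<in> roots D" "nonneg_comb D (\<delta> - \<beta>)"
    then have "\<delta> \<in> ?A" using \<beta>(1) nonneg_comb_add[of "\<delta> - \<beta>" "\<beta> - \<gamma>"] by simp
    then have "height \<delta> \<le> height \<beta>" using \<beta>(2) fin by simp
    then show "\<delta> = \<beta>" using height_pos[OF \<delta>(2)] by (auto simp: height_diff)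
  qed (use \<beta> in auto)
  then show ?thesis using that \<beta> by auto
qed

lemma maximal_root_dominant:
  assumes "maximal_root \<beta>" "i \<in> fin_idx D"
  shows "0 \<le> \<beta> \<bullet> sroot D i"
proof (rule ccontr)
  assume "\<not> ?thesis"
  then have neg: "\<beta> \<bullet> coroot (sroot D i) < 0"
    using root_inner_pos[OF sroot_root[OF assms(2)]]
    by (simp add: coroot_def mult_less_0_iff divide_less_0_iff)
  have r: "\<beta> \<in> roots D" using assms(1) by (simp add: maximal_root_def)
  let ?g = "aff_refl (sroot D i) 0 \<beta>"
  have "- (\<beta> \<bullet> coroot (sroot D i)) \<in> \<nat>"
    using coroot_int[OF sroot_root[OF assms(2)] r] neg by (simp add: Nats_iff_Ints_ge_0)
  moreover have "?g - \<beta> = (- (\<beta> \<bullet> coroot (sroot D i))) *\<^sub>R sroot D i" by (simp add: refl_eq)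
  ultimately have "nonneg_comb D (?g - \<beta>)"
    using sroot_nonneg[OF assms(2)] unfolding nonneg_comb_iff
    by (metis Nats_mult inner_scaleR_left)
  then have "?g = \<beta>" using assms(1) refl_root[OF sroot_root[OF assms(2)] r]
    by (simp add: maximal_root_def)
  then show False using neg root_nz[OF sroot_root[OF assms(2)]] by (simp add: refl_eq)
qed

lemma maximal_root_pos:
  assumes "maximal_root \<beta>" shows "\<beta> \<in> pos_roots D"
proof (rule ccontr)
  assume n: "\<beta> \<notin> pos_roots D"
  have r: "\<beta> \<in> roots D" using assms by (simp add: maximal_root_def)
  then have "nonneg_comb D (- \<beta>)" using n neg_iff_not_pos by (auto simp: pos_roots_def)
  then have "nonneg_comb D (- \<beta> - \<beta>)" using nonneg_comb_add[of "-\<beta>" "-\<beta>"] by simp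
  then have "- \<beta> = \<beta>" using assms root_uminus[OF r] by (simp add: maximal_root_def)
  then have "\<beta> + \<beta> = 0" by (metis add.right_inverse)
  then show False using root_nz[OF r] by (simp flip: scaleR_2)
qed

text \<open>
  The simple roots outside the support of a maximal root are orthogonal to those inside, because
  simple roots are pairwise obtuse and the maximal root is dominant. Irreducibility excludes such a
  splitting.
\<close>

lemma maximal_root_full_support:
  assumes "maximal_root \<beta>" "i \<in> fin_idx D"
  shows "0 < \<beta> \<bullet> fund_coweight D i"
proof (rule ccontr)
  assume i: "\<not> ?thesis"
  let ?c = "\<lambda>x j. x \<bullet> fund_coweight D j"
  have \<beta>: "\<beta> \<in> pos_roots D" using maximal_root_pos assms by blast
  define S where "S = {j \<in> fin_idx D. 0 < ?c \<beta> j}"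
  define U where "U = {j \<in> fin_idx D. ?c \<beta> j = 0}"
  have U: "fin_idx D = S \<union> U" "S \<inter> U = {}"
    using pos_coeff_ge_0[OF \<beta>] by (fastforce simp: S_def U_def)+
  have orth: "sroot D j \<bullet> sroot D k = 0" if j: "j \<in> S" and k: "k \<in> U" for j k
  proof -
    have kI: "k \<in> fin_idx D" using k U by auto
    have "sroot D k \<bullet> \<beta> = (\<Sum>l\<in>fin_idx D. ?c \<beta> l * (sroot D k \<bullet> sroot D l))"
      by (rule inner_expansion)
    moreover have "?c \<beta> l * (sroot D k \<bullet> sroot D l) \<le> 0" if "l \<in> fin_idx D" for l
      using that kI k pos_coeff_ge_0[OF \<beta> that] sroots_obtuse[of k l]
      by (cases "l = k") (auto simp: U_def mult_le_0_iff)
    moreover have "0 \<le> sroot D k \<bullet> \<beta>"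
      using maximal_root_dominant[OF assms(1) kI] by (simp add: inner_commute)
    ultimately have "(\<Sum>l\<in>fin_idx D. - (?c \<beta> l * (sroot D k \<bullet> sroot D l))) = 0"
      "\<forall>l\<in>fin_idx D. 0 \<le> - (?c \<beta> l * (sroot D k \<bullet> sroot D l))"
      by (auto simp: sum_negf sum_nonpos intro: antisym)
    then have "\<forall>l\<in>fin_idx D. ?c \<beta> l * (sroot D k \<bullet> sroot D l) = 0"
      by (subst (asm) sum_nonneg_eq_0_iff) auto
    then show ?thesis using j by (auto simp: S_def inner_commute)
  qed
  \<comment> \<open>Every root is supported in \<open>S\<close> or in \<open>U\<close>: no reflection in the induction below can mix the two.\<close>
  define A where "A = {\<gamma> \<in> roots D. \<forall>k\<in>U. ?c \<gamma> k = 0}"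
  define B where "B = {\<gamma> \<in> roots D. \<forall>k\<in>S. ?c \<gamma> k = 0}"
  have "\<gamma> \<in> A \<union> B" if "\<gamma> \<in> pos_roots D" for \<gamma>
    using that
  proof (induction rule: pos_root_induct)
    case (multiple i c)
    then show ?case using U
      by (auto simp: A_def B_def inner_commute[of "sroot D _"] fund_coweight_sroot)
  next
    case (reflect \<gamma> i)
    let ?g = "aff_refl (sroot D i) 0 \<gamma>"
    have iI: "sroot D i \<in> roots D" using reflect sroot_root by blast
    have g: "\<gamma> = ?g - (?g \<bullet> coroot (sroot D i)) *\<^sub>R sroot D i"
      using refl_invol[OF root_nz[OF iI], of \<gamma>] refl_eq by metis
    have ni: "?g \<bullet> sroot D i \<noteq> 0"
      using reflect(4) coroot_self[OF root_nz[OF iI]] root_inner_pos[OF iI]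
      by (simp add: refl_eq inner_diff_left coroot_def)
    have ortho: "x \<bullet> sroot D i = 0" if "\<And>k. k \<in> fin_idx D \<Longrightarrow> ?c x k = 0 \<or> sroot D i \<bullet> sroot D k = 0" for x
    proof -
      have "sroot D i \<bullet> x = 0"
        unfolding inner_expansion[of "sroot D i" x] using that by (intro sum.neutral) auto
      then show ?thesis by (simp add: inner_commute)
    qed
    have cf: "?c \<gamma> k = ?c ?g k" if "k \<in> fin_idx D" "k \<noteq> i" for k
      using that reflect(2) by (simp add: refl_eq inner_diff_left inner_commute[of "sroot D _"] fund_coweight_sroot)
    have r: "\<gamma> \<in> roots D" "?g \<in> roots D" using reflect pos_root_root by blast+
    show ?case
    proof (cases "?g \<in> A")
      case True
      have "i \<in> S"
      proof (rule ccontr)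
        assume "i \<notin> S"
        then have "i \<in> U" using U reflect by auto
        then have "?g \<bullet> sroot D i = 0" using True U orth
          by (intro ortho) (fastforce simp: A_def inner_commute)
        then show False using ni by simp
      qed
      then have "\<gamma> \<in> A" using cf True r U by (fastforce simp: A_def)
      then show ?thesis by simp
    next
      case False
      then have gB: "?g \<in> B" using reflect by auto
      have "i \<in> U"
      proof (rule ccontr)
        assume "i \<notin> U"
        then have "i \<in> S" using U reflect by auto
        then have "?g \<bullet> sroot D i = 0" using gB U orth
          by (intro ortho) (fastforce simp: B_def inner_commute)
        then show False using ni by simp
      qed
      then have "\<gamma> \<in> B" using cf gB r U by (fastforce simp: B_def)
      then show ?thesis by simp
    qed
  qed
  moreover have "- \<gamma> \<in> A \<union> B \<Longrightarrow> \<gamma> \<in> A \<union> B" if "\<gamma> \<in> roots D" for \<gamma>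
    using that by (auto simp: A_def B_def)
  ultimately have "A \<union> B = roots D"
    using pos_or_neg unfolding A_def B_def by blast
  moreover have "A \<inter> B = {}"
  proof -
    have "\<gamma> \<notin> B" if "\<gamma> \<in> A" for \<gamma>
    proof
      assume "\<gamma> \<in> B"
      then have "\<forall>k\<in>fin_idx D. ?c \<gamma> k = 0" using that U by (auto simp: A_def B_def)
      then have "\<gamma> = 0" by (subst sroot_expansion) (simp add: sum.neutral)
      then show False using that root_nz by (auto simp: A_def)
    qed
    then show ?thesis by auto
  qed
  moreover have "\<beta> \<in> A" using \<beta> pos_root_root by (auto simp: A_def U_def)
  moreover have "sroot D i \<in> B"
  proof -
    have "i \<in> U" using i pos_coeff_ge_0[OF \<beta> assms(2)] assms(2) by (auto simp: U_def)
    then show ?thesis using U assms(2)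
      by (auto simp: B_def sroot_root inner_commute[of "sroot D _"] fund_coweight_sroot)
  qed
  moreover have "a \<bullet> b = 0" if "a \<in> A" "b \<in> B" for a b
  proof -
    have ak: "a \<bullet> sroot D k = 0" if k: "k \<in> U" for k
    proof -
      have "?c a j = 0 \<or> sroot D k \<bullet> sroot D j = 0" if "j \<in> fin_idx D" for j
        using that orth[of j k] k \<open>a \<in> A\<close> U by (auto simp: A_def inner_commute)
      then have "sroot D k \<bullet> a = 0"
        unfolding inner_expansion[of "sroot D k" a] by (intro sum.neutral) auto
      then show ?thesis by (simp add: inner_commute)
    qed
    have "?c b j = 0 \<or> a \<bullet> sroot D j = 0" if "j \<in> fin_idx D" for j
      using that ak \<open>b \<in> B\<close> U by (auto simp: B_def)
    then show ?thesis unfolding inner_expansion[of a b] by (intro sum.neutral) auto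
  qed
  ultimately have "A \<noteq> {} \<and> B \<noteq> {} \<and> A \<union> B = roots D \<and> A \<inter> B = {} \<and> (\<forall>a\<in>A. \<forall>b\<in>B. a \<bullet> b = 0)"
    by (intro conjI) auto
  then show False using irreducible unfolding irreducible_roots_def by metis
qed

text \<open>
  By dominance and full support, two maximal roots have a positive inner product. If they were
  different, their difference would be a root, and one of them would lie below the other.
\<close>

lemma maximal_root_unique:
  assumes "maximal_root \<beta>" "maximal_root \<gamma>" shows "\<beta> = \<gamma>"
proof (rule ccontr)
  assume ne: "\<beta> \<noteq> \<gamma>"
  have r: "\<beta> \<in> roots D" "\<gamma> \<in> roots D" using assms by (auto simp: maximal_root_def)
  have ge: "0 \<le> (\<gamma> \<bullet> fund_coweight D i) * (\<beta> \<bullet> sroot D i)" if "i \<in> fin_idx D" for i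
    using maximal_root_full_support[OF assms(2) that] maximal_root_dominant[OF assms(1) that] by simp
  have "\<exists>i\<in>fin_idx D. \<beta> \<bullet> sroot D i \<noteq> 0"
    using inner_sroots_eqI[of \<beta> 0] root_nz[OF r(1)] by auto
  then obtain i where i: "i \<in> fin_idx D" "\<beta> \<bullet> sroot D i \<noteq> 0" by auto
  have "0 < (\<gamma> \<bullet> fund_coweight D i) * (\<beta> \<bullet> sroot D i)"
    using i(2) maximal_root_full_support[OF assms(2) i(1)] maximal_root_dominant[OF assms(1) i(1)] by simp
  then have "0 < \<beta> \<bullet> \<gamma>"
    unfolding inner_expansion[of \<beta> \<gamma>] by (intro sum_pos2[OF _ i(1)] ge) simp_all
  then have "\<beta> - \<gamma> \<in> roots D" using r ne by (intro diff_root) auto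
  then have "nonneg_comb D (\<beta> - \<gamma>) \<or> nonneg_comb D (\<gamma> - \<beta>)"
    using root_comb by fastforce
  then show False using assms ne unfolding maximal_root_def by metis
qed

lemma highest_root: "highest_root D \<in> roots D"
  and below_highest: "\<beta> \<in> roots D \<Longrightarrow> nonneg_comb D (highest_root D - \<beta>)"
proof -
  let ?P = "\<lambda>\<phi>. \<phi> \<in> roots D \<and> (\<forall>\<beta>\<in>roots D. nonneg_comb D (\<phi> - \<beta>))"
  have "roots D \<noteq> {}" using irreducible by (simp add: irreducible_roots_def)
  then obtain \<phi> where \<phi>: "maximal_root \<phi>" using maximal_root_above by auto
  have "?P \<phi>" using \<phi> maximal_root_above maximal_root_unique by (metis maximal_root_def)
  moreover have "\<phi>' = \<phi>" if "?P \<phi>'" for \<phi>'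
    using that \<open>?P \<phi>\<close> nonneg_comb_antisym[of "\<phi> - \<phi>'"] by auto
  ultimately have "?P (THE \<phi>. ?P \<phi>)" by (rule theI[where P="?P"])
  then have "?P (highest_root D)" unfolding highest_root_def .
  then show "highest_root D \<in> roots D" "\<beta> \<in> roots D \<Longrightarrow> nonneg_comb D (highest_root D - \<beta>)" by auto
qed

lemma highest_maximal: "maximal_root (highest_root D)"
  unfolding maximal_root_def
proof (intro conjI ballI impI highest_root)
  fix \<gamma> assume "\<gamma> \<in> roots D" "nonneg_comb D (\<gamma> - highest_root D)"
  then show "\<gamma> = highest_root D"
    using below_highest[of \<gamma>] nonneg_comb_antisym[of "\<gamma> - highest_root D"] by simp
qed

lemma highest_pos: "highest_root D \<in> pos_roots D"
  using maximal_root_pos highest_maximal by blast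

lemma highest_coroot_ge_0:
  assumes "\<beta> \<in> pos_roots D" shows "0 \<le> \<beta> \<bullet> coroot (highest_root D)"
proof -
  have "0 \<le> highest_root D \<bullet> \<beta>"
    unfolding inner_expansion[of "highest_root D" \<beta>]
    by (intro sum_nonneg mult_nonneg_nonneg pos_coeff_ge_0 assms maximal_root_dominant highest_maximal)
  then show ?thesis using root_inner_pos[OF highest_root] by (simp add: coroot_def inner_commute)
qed

text \<open>
  If \<open>\<beta>\<close> pairs to at least 2 with the coroot of the highest root \<open>\<phi>\<close>, then \<open>-s\<^sub>\<phi> \<beta> \<le> \<phi>\<close> forces
  \<open>\<beta> = \<phi>\<close>.
\<close>

lemma highest_coroot_values:
  assumes "\<beta> \<in> pos_roots D" "\<beta> \<noteq> highest_root D"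
  shows "\<beta> \<bullet> coroot (highest_root D) = 0 \<or> \<beta> \<bullet> coroot (highest_root D) = 1"
proof (rule ccontr)
  let ?\<phi> = "highest_root D" and ?c = "\<beta> \<bullet> coroot (highest_root D)"
  assume n: "\<not> ?thesis"
  have r: "\<beta> \<in> roots D" using assms pos_root_root by blast
  have ci: "?c \<in> \<int>" by (intro coroot_int highest_root r)
  have "2 \<le> ?c"
    using n ci highest_coroot_ge_0[OF assms(1)] by (auto elim!: Ints_cases)
  have "nonneg_comb D (?\<phi> - - aff_refl ?\<phi> 0 \<beta>)"
    by (intro below_highest root_uminus refl_root highest_root r)
  then have n1: "nonneg_comb D (\<beta> - ?\<phi> - (?c - 2) *\<^sub>R ?\<phi>)"
    by (simp add: refl_eq algebra_simps scaleR_2)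
  have "nonneg_comb D ((?c - 2) *\<^sub>R ?\<phi>)"
    using \<open>2 \<le> ?c\<close> ci highest_pos by (auto simp: nonneg_comb_iff pos_roots_def Nats_iff_Ints_ge_0)
  then have "nonneg_comb D (\<beta> - ?\<phi>)" using nonneg_comb_add[OF n1] by (metis diff_add_cancel)
  then show False using assms(2) highest_maximal r by (simp add: maximal_root_def)
qed

lemma highest_multiple:
  assumes "c > 0" "c *\<^sub>R highest_root D \<in> roots D"
  shows "c = 1/2 \<or> c = 1"
proof -
  have "c \<noteq> 2"
  proof
    assume "c = 2"
    then have "nonneg_comb D (highest_root D - 2 *\<^sub>R highest_root D)" using below_highest assms(2) by blast
    then have "nonneg_comb D (- highest_root D)" by (simp add: scaleR_2)
    then show False using highest_pos nonneg_comb_antisym root_nz highest_root by (auto simp: pos_roots_def)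
  qed
  then show ?thesis using proportional_roots[OF highest_root assms] by blast
qed

section \<open>The fundamental alcove and its walls\<close>

definition interior_point :: "'a \<Rightarrow> bool" where
  "interior_point p \<longleftrightarrow> (\<forall>\<beta>\<in>pos_roots D. 0 < p \<bullet> \<beta> \<and> p \<bullet> \<beta> < 1)"

text \<open>
  The sum of the fundamental coweights takes positive values on positive roots; scaling it down
  brings them below 1.
\<close>

lemma alcove_interior: "\<exists>p. interior_point p"
proof -
  define \<rho> where "\<rho> = (\<Sum>i\<in>fin_idx D. fund_coweight D i)"
  have \<rho>: "\<rho> \<bullet> \<beta> = height \<beta>" for \<beta> by (simp add: \<rho>_def height_def inner_sum_right inner_commute)
  have hp: "0 < height \<beta>" if "\<beta> \<in> pos_roots D" for \<beta>
    using that height_pos root_nz by (auto simp: pos_roots_def)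
  define N where "N = 1 + (\<Sum>\<beta>\<in>pos_roots D. height \<beta>)"
  have fin: "finite (pos_roots D)" using finite_roots by (simp add: pos_roots_def)
  have N: "height \<beta> < N" if "\<beta> \<in> pos_roots D" for \<beta>
    using member_le_sum[OF that, of height] hp fin by (force simp: N_def)
  have "N > 0" unfolding N_def using hp by (intro add_pos_nonneg sum_nonneg) (auto intro: less_imp_le)
  show ?thesis unfolding interior_point_def
  proof (intro exI[of _ "(1/N) *\<^sub>R \<rho>"] ballI)
    fix \<beta> assume "\<beta> \<in> pos_roots D"
    then show "0 < (1/N) *\<^sub>R \<rho> \<bullet> \<beta> \<and> (1/N) *\<^sub>R \<rho> \<bullet> \<beta> < 1"
      using hp N \<open>N > 0\<close> by (simp add: \<rho>)
  qed
qed

lemma alcove_interior_mem: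
  "interior_point p \<Longrightarrow> p \<in> alcove0 D"
  by (auto simp: interior_point_def alcove0_def less_imp_le)

lemma zero_in_alcove: "0 \<in> alcove0 D" by (simp add: alcove0_def)

text \<open>
  The sign of an affine root on \<open>A\<^sub>0\<close> is decided by two test points, the origin and an interior point.
\<close>

lemma alcove0_nonneg_iff:
  assumes "\<beta> \<in> roots D"
  shows "(\<forall>x\<in>alcove0 D. 0 \<le> x \<bullet> \<beta> + of_int k) \<longleftrightarrow>
    (\<beta> \<in> pos_roots D \<and> 0 \<le> k) \<or> (- \<beta> \<in> pos_roots D \<and> 1 \<le> k)" (is "?L \<longleftrightarrow> ?R")
proof
  assume L: ?L
  then have k: "0 \<le> k" using zero_in_alcove by force
  obtain p where p: "interior_point p" using alcove_interior by blast
  have "1 \<le> k" if "- \<beta> \<in> pos_roots D"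
  proof -
    have "0 \<le> p \<bullet> \<beta> + of_int k" using L alcove_interior_mem p by blast
    then have "0 < real_of_int k" using p that by (force simp: interior_point_def)
    then show ?thesis by simp
  qed
  then show ?R using k pos_or_neg[OF assms] by auto
next
  assume ?R
  then show ?L
  proof (elim disjE conjE, goal_cases)
    case 1 then show ?case by (auto simp: alcove0_def intro: add_nonneg_nonneg)
  next
    case 2
    show ?case
    proof
      fix x assume "x \<in> alcove0 D"
      then have "x \<bullet> - \<beta> \<le> 1" using 2 unfolding alcove0_def by blast
      then show "0 \<le> x \<bullet> \<beta> + of_int k" using 2(2) by simp
    qed
  qed
qed

lemma affine_root_nonzero:
  assumes "\<beta> \<in> roots D" "interior_point p"
  shows "p \<bullet> \<beta> + of_int k \<noteq> 0"
proof
  assume 0: "p \<bullet> \<beta> + of_int k = 0"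
  from pos_or_neg[OF assms(1)] show False
  proof
    assume "\<beta> \<in> pos_roots D"
    then have "0 < p \<bullet> \<beta>" "p \<bullet> \<beta> < 1" using assms(2) by (auto simp: interior_point_def)
    then have "real_of_int k < 0" "0 < real_of_int (k + 1)" using 0 by auto
    then show False by (simp only: of_int_0_less_iff of_int_less_0_iff)
  next
    assume "- \<beta> \<in> pos_roots D"
    then have "p \<bullet> \<beta> < 0" "-1 < p \<bullet> \<beta>" using assms(2) by (force simp: interior_point_def)+
    then have "0 < real_of_int k" "real_of_int (k - 1) < 0" using 0 by auto
    then show False by (simp only: of_int_0_less_iff of_int_less_0_iff)
  qed
qed

lemma alcove0_one_side:
  assumes "\<beta> \<in> roots D"
  shows "(\<forall>x\<in>alcove0 D. 0 \<le> x \<bullet> \<beta> + of_int k) \<or> (\<forall>x\<in>alcove0 D. x \<bullet> \<beta> + of_int k \<le> 0)"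
proof -
  have "(\<forall>x\<in>alcove0 D. 0 \<le> x \<bullet> (- \<beta>) + of_int (- k)) \<longleftrightarrow> (\<forall>x\<in>alcove0 D. x \<bullet> \<beta> + of_int k \<le> 0)"
    by auto
  moreover have "- (- \<beta>) = \<beta>" by simp
  ultimately show ?thesis
    using alcove0_nonneg_iff[OF assms, of k] alcove0_nonneg_iff[OF root_uminus[OF assms], of "-k"]
      pos_or_neg[OF assms] by (smt (verit))
qed

lemma alcove0_not_both:
  assumes "\<beta> \<in> roots D" "\<forall>x\<in>alcove0 D. 0 \<le> x \<bullet> \<beta> + of_int k" "\<forall>x\<in>alcove0 D. x \<bullet> \<beta> + of_int k \<le> 0"
  shows False
proof -
  obtain p where p: "interior_point p" using alcove_interior by blast
  have "p \<in> alcove0 D" using alcove_interior_mem[OF p] .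
  then have "p \<bullet> \<beta> + of_int k = 0" using assms(2,3) by force
  then show False using affine_root_nonzero[OF assms(1) p] by blast
qed

text \<open>The affine function of the \<open>i\<close>-th affine simple root, whose zero set is the \<open>i\<close>-th wall of \<open>A\<^sub>0\<close>.\<close>

abbreviation "wall i x \<equiv> x \<bullet> fst (aff_sroot D i) + of_int (snd (aff_sroot D i))"

lemma wall_nonneg: "i \<in> aff_idx D \<Longrightarrow> x \<in> alcove0 D \<Longrightarrow> 0 \<le> wall i x"
  using highest_pos sroot_pos by (auto simp: aff_sroot_def alcove0_def aff_idx_eq)

lemma aff_sroot_root: "i \<in> aff_idx D \<Longrightarrow> fst (aff_sroot D i) \<in> roots D"
  using highest_root sroot_root root_uminus by (auto simp: aff_sroot_def aff_idx_eq)

lemma sgen_eq: 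
  assumes "i \<in> aff_idx D"
  shows "sgen D i x = x - wall i x *\<^sub>R coroot (fst (aff_sroot D i))"
proof (cases "i = 0")
  case True
  have "coroot (- \<beta>) = - coroot \<beta>" for \<beta> :: 'a by (simp add: coroot_def)
  then show ?thesis using True
    by (simp add: sgen_def aff_sroot_def aff_refl_def scaleR_left_diff_distrib)
qed (simp add: sgen_def aff_sroot_def aff_refl_def)

lemma wall_sgen: 
  assumes "i \<in> aff_idx D" shows "wall i (sgen D i x) = - wall i x"
proof -
  have "coroot (fst (aff_sroot D i)) \<bullet> fst (aff_sroot D i) = 2"
    using coroot_self[OF root_nz[OF aff_sroot_root[OF assms]]] by (simp add: inner_commute)
  then show ?thesis by (simp add: sgen_eq[OF assms] inner_diff_left)
qed

lemma sgen_invol: "i \<in> aff_idx D \<Longrightarrow> sgen D i (sgen D i x) = x"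
  by (simp only: sgen_eq[of i "sgen D i x"] wall_sgen)
    (simp only: sgen_eq[of i x] scaleR_minus_left diff_minus_eq_add diff_add_cancel)

lemma sgen_0: "sgen D 0 x = aff_refl (highest_root D) 0 x + coroot (highest_root D)"
  by (simp add: sgen_def aff_refl_def algebra_simps)

lemma refl_inner_swap: "aff_refl \<beta> 0 x \<bullet> y = x \<bullet> aff_refl \<beta> 0 y"
  by (simp add: aff_refl_def coroot_def inner_diff_left inner_diff_right inner_commute)

text \<open>
  The hyperplane of the \<open>i\<close>-th affine simple root is the only one that separates the fundamental
  alcove from its image under \<open>s\<^sub>i\<close>; in the non-reduced case several affine roots define it, which
  is why the conclusion has a factor.
\<close>

lemma separated_by_simple:
  assumes i: "i \<in> aff_idx D" and \<beta>: "\<beta> \<in> roots D"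
    and pos: "\<forall>x\<in>alcove0 D. 0 \<le> x \<bullet> \<beta> + of_int k"
    and neg: "\<not> (\<forall>x\<in>alcove0 D. 0 \<le> sgen D i x \<bullet> \<beta> + of_int k)"
  shows "\<exists>c>0. \<beta> = c *\<^sub>R fst (aff_sroot D i) \<and> of_int k = c * of_int (snd (aff_sroot D i))"
proof -
  let ?\<phi> = "highest_root D"
  have pk: "(\<beta> \<in> pos_roots D \<and> 0 \<le> k) \<or> (- \<beta> \<in> pos_roots D \<and> 1 \<le> k)"
    using pos alcove0_nonneg_iff[OF \<beta>] by blast
  show ?thesis
  proof (cases "i = 0")
    case False
    then have iI: "i \<in> fin_idx D" using i by (simp add: aff_idx_eq)
    let ?g = "aff_refl (sroot D i) 0 \<beta>"
    have s: "sgen D i x \<bullet> \<beta> = x \<bullet> ?g" for x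
      using False by (simp add: sgen_def refl_inner_swap)
    have gr: "?g \<in> roots D" using refl_root[OF sroot_root[OF iI] \<beta>] .
    have neg': "\<not> ((?g \<in> pos_roots D \<and> 0 \<le> k) \<or> (- ?g \<in> pos_roots D \<and> 1 \<le> k))"
      using neg unfolding s alcove0_nonneg_iff[OF gr] .
    then have "k = 0" "?g \<notin> pos_roots D" using pos_or_neg[OF gr] pk by auto
    then show ?thesis using simple_refl_pos[OF iI] pk False by (auto simp: aff_sroot_def)
  next
    case True
    \<comment> \<open>The constant term changes by the pairing of \<open>\<beta>\<close> with the coroot of \<open>\<phi>\<close>, which compensates a
      change of sign of the gradient in all cases but \<open>\<beta> = - \<phi>\<close>, \<open>k = 1\<close>.\<close>
    let ?g = "aff_refl ?\<phi> 0 \<beta>" and ?c = "\<beta> \<bullet> coroot ?\<phi>"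
    have "?c \<in> \<int>" by (intro coroot_int highest_root \<beta>)
    then obtain c where c: "?c = of_int c" by (auto elim: Ints_cases)
    have s: "sgen D i x \<bullet> \<beta> + of_int k = x \<bullet> ?g + of_int (c + k)" for x
      using c by (simp add: True sgen_0 inner_add_left refl_inner_swap inner_commute[of "coroot _"])
    have gr: "?g \<in> roots D" using refl_root[OF highest_root \<beta>] .
    have neg': "\<not> ((?g \<in> pos_roots D \<and> 0 \<le> c + k) \<or> (- ?g \<in> pos_roots D \<and> 1 \<le> c + k))"
      using neg unfolding s alcove0_nonneg_iff[OF gr] .
    show ?thesis
    proof (cases "\<beta> \<in> pos_roots D")
      case pr: True
      then have k: "0 \<le> k" using pk pos_not_neg by blast
      have False
      proof (cases "\<beta> = ?\<phi>")
        case True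
        then have "c = 2" using c coroot_self[OF root_nz[OF highest_root]] by simp
        then show False using neg' k pos_or_neg[OF gr] by auto
      next
        case False
        then consider "c = 0" | "c = 1" using highest_coroot_values[OF pr] c by auto
        then show False
        proof cases
          case 1
          then have "?g = \<beta>" using c by (simp add: refl_eq)
          then show False using neg' k pr 1 by auto
        next
          case 2
          then show False using neg' k pos_or_neg[OF gr] by auto
        qed
      qed
      then show ?thesis ..
    next
      case npr: False
      then have mr: "- \<beta> \<in> pos_roots D" and k: "1 \<le> k" using pk by auto
      show ?thesis
      proof (cases "- \<beta> = ?\<phi>")
        case \<phi>: True
        then have \<beta>\<phi>: "\<beta> = - ?\<phi>" by (metis minus_minus)
        then have "c = - 2" "?g = ?\<phi>" using c coroot_self[OF root_nz[OF highest_root]]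
          by (simp_all add: refl_eq scaleR_2)
        then have "k = 1" using neg' k highest_pos by auto
        then show ?thesis using \<beta>\<phi> True by (auto simp: aff_sroot_def)
      next
        case False
        then consider "c = 0" | "c = -1" using highest_coroot_values[OF mr] c by auto
        then have False
        proof cases
          case 1
          then have "?g = \<beta>" using c by (simp add: refl_eq)
          then show False using neg' k mr 1 by auto
        next
          case 2
          then have g: "?g = ?\<phi> - - \<beta>" using c by (simp add: refl_eq)
          then have "nonneg_comb D ?g" using below_highest[OF pos_root_root[OF mr]] by simp
          then have "?g \<in> pos_roots D" using gr by (simp add: pos_roots_def)
          then show False using neg' k 2 by auto
        qed
        then show ?thesis ..
      qed
    qed
  qed
qed

end

section \<open>Weyl groups\<close>

text \<open>A name for the inverse map that does not clash with the inverse in a group or ring.\<close>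

abbreviation fun_inv :: "('b \<Rightarrow> 'b) \<Rightarrow> 'b \<Rightarrow> 'b" where
  "fun_inv f \<equiv> inv_into UNIV f"

lemma wprod_Nil [simp]: "wprod D [] = id" by (simp add: wprod_def)
lemma wprod_Cons [simp]: "wprod D (j # js) = sgen D j \<circ> wprod D js" by (simp add: wprod_def)
lemma wprod_append: "wprod D (ks @ js) = wprod D ks \<circ> wprod D js"
  by (induction ks) (simp_all add: comp_assoc)

lemma par_weyl_id: "id \<in> par_weyl D J" by (auto simp: par_weyl_def intro: exI[of _ "[]"])
lemma par_weyl_sgen: "j \<in> J \<Longrightarrow> sgen D j \<in> par_weyl D J"
  by (auto simp: par_weyl_def intro: exI[of _ "[j]"])
lemma par_weyl_mono: "J \<subseteq> K \<Longrightarrow> par_weyl D J \<subseteq> par_weyl D K" by (auto simp: par_weyl_def)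
lemma par_weyl_comp: "x \<in> par_weyl D J \<Longrightarrow> y \<in> par_weyl D J \<Longrightarrow> x \<circ> y \<in> par_weyl D J"
  by (auto simp: par_weyl_def) (metis Un_least set_append wprod_append)

lemma par_weyl_induct [consumes 1, case_names id step]:
  assumes "x \<in> par_weyl D J" "P id"
    "\<And>j x. j \<in> J \<Longrightarrow> x \<in> par_weyl D J \<Longrightarrow> P x \<Longrightarrow> P (sgen D j \<circ> x)"
  shows "P x"
proof -
  have "P (wprod D js)" if "set js \<subseteq> J" for js
    using that by (induction js) (auto simp: assms(2) par_weyl_def intro!: assms(3))
  then show ?thesis using assms(1) by (auto simp: par_weyl_def)
qed

context irreducible_root_datum
begin

lemma sgen_refl: "j \<in> fin_idx D \<Longrightarrow> sgen D j = aff_refl (sroot D j) 0"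
  by (auto simp: sgen_def)

lemma sgen_sgen: "i \<in> aff_idx D \<Longrightarrow> sgen D i \<circ> sgen D i = id"
  by (simp add: fun_eq_iff sgen_invol)

lemma fin_weyl_orth: "x \<in> fin_weyl D \<Longrightarrow> orthogonal_transformation x"
proof (induction rule: par_weyl_induct)
  case id show ?case by (simp add: id_def orthogonal_transformation_id)
next
  case (step j x)
  then show ?case
    by (intro orthogonal_transformation_compose) (auto simp: sgen_refl intro!: refl_orthogonal root_nz sroot_root)
qed

lemma fin_weyl_linear: "x \<in> fin_weyl D \<Longrightarrow> linear x"
  using fin_weyl_orth orthogonal_transformation_linear by blast

lemma fin_weyl_bij: "x \<in> fin_weyl D \<Longrightarrow> bij x"
  using fin_weyl_orth orthogonal_transformation_bij by blast

lemma fin_weyl_root: "x \<in> fin_weyl D \<Longrightarrow> \<beta> \<in> roots D \<Longrightarrow> x \<beta> \<in> roots D"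
  by (induction rule: par_weyl_induct) (auto simp: sgen_refl intro!: refl_root sroot_root)

lemma wprod_rev:
  assumes "set js \<subseteq> aff_idx D" shows "wprod D (rev js) \<circ> wprod D js = id"
proof (rule ext)
  show "(wprod D (rev js) \<circ> wprod D js) x = id x" for x
    using assms by (induction js arbitrary: x) (simp_all add: wprod_append sgen_invol)
qed

lemma par_weyl_inv:
  assumes "J \<subseteq> fin_idx D" "x \<in> par_weyl D J"
  shows "fun_inv x \<in> par_weyl D J"
proof -
  obtain js where js: "x = wprod D js" "set js \<subseteq> J" using assms by (auto simp: par_weyl_def)
  then have "set js \<subseteq> aff_idx D" "set (rev js) \<subseteq> aff_idx D"
    using assms(1) by (auto simp: aff_idx_eq)
  then have "wprod D (rev js) \<circ> wprod D js = id" "wprod D js \<circ> wprod D (rev js) = id"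
    using wprod_rev[of js] wprod_rev[of "rev js"] by auto
  then have "fun_inv x = wprod D (rev js)" using js(1) by (metis inv_unique_comp)
  then show ?thesis using js(2) by (auto simp: par_weyl_def intro!: exI[of _ "rev js"])
qed

lemma fin_weyl_inv: "x \<in> fin_weyl D \<Longrightarrow> fun_inv x \<in> fin_weyl D"
  by (rule par_weyl_inv) auto

lemma fin_weyl_inv_apply [simp]: 
  "x \<in> fin_weyl D \<Longrightarrow> fun_inv x (x y) = y" "x \<in> fin_weyl D \<Longrightarrow> x (fun_inv x y) = y"
  using fin_weyl_bij by (auto simp: bij_is_inj bij_is_surj surj_f_inv_f)

lemma fin_weyl_inv_inv: "x \<in> fin_weyl D \<Longrightarrow> fun_inv (fun_inv x) = x"
  using fin_weyl_bij inv_inv_eq by blast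

lemma fin_weyl_inv_comp: "x \<in> fin_weyl D \<Longrightarrow> y \<in> fin_weyl D \<Longrightarrow> fun_inv (x \<circ> y) = fun_inv y \<circ> fun_inv x"
  by (intro o_inv_distrib fin_weyl_bij)

lemma fin_weyl_inner: "x \<in> fin_weyl D \<Longrightarrow> x y \<bullet> z = y \<bullet> fun_inv x z"
  using fin_weyl_orth[of x] by (metis fin_weyl_inv_apply(2) orthogonal_transformation_def)

lemma fin_weyl_uminus: "x \<in> fin_weyl D \<Longrightarrow> x (- y) = - x y"
  by (simp add: fin_weyl_linear linear_neg)
lemma fin_weyl_scale: "x \<in> fin_weyl D \<Longrightarrow> x (c *\<^sub>R y) = c *\<^sub>R x y"
  by (simp add: fin_weyl_linear linear_scale)
lemma fin_weyl_0: "x \<in> fin_weyl D \<Longrightarrow> x 0 = 0"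
  by (simp add: fin_weyl_linear linear_0)

lemma fin_weyl_root_iff: "x \<in> fin_weyl D \<Longrightarrow> x \<beta> \<in> roots D \<longleftrightarrow> \<beta> \<in> roots D"
  by (metis fin_weyl_inv fin_weyl_inv_apply(1) fin_weyl_root)

lemma fin_weyl_coweight: "x \<in> fin_weyl D \<Longrightarrow> \<mu> \<in> coweights D \<Longrightarrow> x \<mu> \<in> coweights D"
  by (rule coweightsI) (simp add: fin_weyl_inner coweights_root_int fin_weyl_root fin_weyl_inv)

subsection \<open>Parabolic subgroups\<close>

lemma span_sroots_iff:
  assumes "J \<subseteq> fin_idx D"
  shows "x \<in> span (sroot D ` J) \<longleftrightarrow> (\<forall>i\<in>fin_idx D - J. x \<bullet> fund_coweight D i = 0)"
proof
  assume "x \<in> span (sroot D ` J)"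
  then show "\<forall>i\<in>fin_idx D - J. x \<bullet> fund_coweight D i = 0"
  proof (induction rule: span_induct_alt)
    case (step c y z)
    then show ?case using assms
      by (auto simp: inner_add_left inner_commute[of "sroot D _"] fund_coweight_sroot)
  qed simp
next
  assume 0: "\<forall>i\<in>fin_idx D - J. x \<bullet> fund_coweight D i = 0"
  have "x = (\<Sum>i\<in>J. (x \<bullet> fund_coweight D i) *\<^sub>R sroot D i)"
    by (subst sroot_expansion[of x], rule sum.mono_neutral_right) (use assms 0 in auto)
  also have "\<dots> \<in> span (sroot D ` J)" by (intro span_sum span_scale span_base) auto
  finally show "x \<in> span (sroot D ` J)" .
qed

lemma par_roots_iff:
  "J \<subseteq> fin_idx D \<Longrightarrow>
    \<beta> \<in> par_roots D J \<longleftrightarrow> \<beta> \<in> roots D \<and> (\<forall>i\<in>fin_idx D - J. \<beta> \<bullet> fund_coweight D i = 0)"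
  by (simp add: par_roots_def span_sroots_iff)

lemma par_roots_root: "\<beta> \<in> par_roots D J \<Longrightarrow> \<beta> \<in> roots D" by (simp add: par_roots_def)

lemma par_roots_uminus: "\<beta> \<in> par_roots D J \<Longrightarrow> - \<beta> \<in> par_roots D J"
  by (auto simp: par_roots_def root_uminus span_neg)

lemma par_roots_uminus_iff: "- \<beta> \<in> par_roots D J \<longleftrightarrow> \<beta> \<in> par_roots D J"
  using par_roots_uminus by fastforce

lemma par_roots_scale: "\<beta> \<in> par_roots D J \<Longrightarrow> c *\<^sub>R \<beta> \<in> roots D \<Longrightarrow> c *\<^sub>R \<beta> \<in> par_roots D J"
  by (simp add: par_roots_def span_scale)

lemma par_pos_rootsD: "\<beta> \<in> par_pos_roots D J \<Longrightarrow> \<beta> \<in> par_roots D J" "\<beta> \<in> par_pos_roots D J \<Longrightarrow> \<beta> \<in> pos_roots D"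
  by (auto simp: par_pos_roots_def)

lemma finite_par_pos_roots: "finite (par_pos_roots D J)"
  using finite_roots by (auto simp: par_pos_roots_def pos_roots_def)

lemma sroot_par_pos: "J \<subseteq> fin_idx D \<Longrightarrow> j \<in> J \<Longrightarrow> sroot D j \<in> par_pos_roots D J"
  by (auto simp: par_pos_roots_def par_roots_def sroot_pos sroot_root intro: span_base)

lemma par_roots_cases:
  assumes "\<beta> \<in> par_roots D J" obtains "\<beta> \<in> par_pos_roots D J" | "- \<beta> \<in> par_pos_roots D J"
  using assms pos_or_neg par_roots_root par_roots_uminus by (auto simp: par_pos_roots_def)

text \<open>\<open>W\<^sub>J\<close> changes vectors only along the simple roots of \<open>J\<close>, so it fixes all other coefficients.\<close>

lemma par_weyl_coeff:
  assumes "x \<in> par_weyl D J" "J \<subseteq> fin_idx D" "i \<in> fin_idx D - J"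
  shows "x y \<bullet> fund_coweight D i = y \<bullet> fund_coweight D i"
  using assms
proof (induction rule: par_weyl_induct)
  case (step j x)
  then have "j \<in> fin_idx D" "j \<noteq> i" by auto
  then show ?case using step
    by (simp add: sgen_refl refl_eq inner_diff_left inner_commute[of "sroot D _"] fund_coweight_sroot)
qed simp

lemma par_weyl_fin: "J \<subseteq> fin_idx D \<Longrightarrow> x \<in> par_weyl D J \<Longrightarrow> x \<in> fin_weyl D"
  using par_weyl_mono by blast

lemma par_weyl_par_roots:
  "J \<subseteq> fin_idx D \<Longrightarrow> x \<in> par_weyl D J \<Longrightarrow> x \<beta> \<in> par_roots D J \<longleftrightarrow> \<beta> \<in> par_roots D J"
  by (simp add: par_roots_iff par_weyl_coeff fin_weyl_root_iff par_weyl_fin)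

lemma par_weyl_pos_outside:
  assumes "J \<subseteq> fin_idx D" "x \<in> par_weyl D J" "\<beta> \<in> pos_roots D" "\<beta> \<notin> par_roots D J"
  shows "x \<beta> \<in> pos_roots D"
proof -
  have r: "\<beta> \<in> roots D" using assms(3) pos_root_root by blast
  then obtain i where i: "i \<in> fin_idx D - J" "\<beta> \<bullet> fund_coweight D i \<noteq> 0"
    using assms(1,4) by (auto simp: par_roots_iff)
  then have "0 < \<beta> \<bullet> fund_coweight D i" using pos_coeff_ge_0[OF assms(3), of i] by auto
  then show ?thesis using i assms(1,2) r
    by (intro pos_rootI[of _ i]) (auto simp: par_weyl_coeff fin_weyl_root par_weyl_fin)
qed

lemma par_weyl_pos_outside_iff:
  assumes "J \<subseteq> fin_idx D" "x \<in> par_weyl D J" "\<beta> \<in> roots D" "\<beta> \<notin> par_roots D J"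
  shows "x \<beta> \<in> pos_roots D \<longleftrightarrow> \<beta> \<in> pos_roots D"
proof -
  have "- x \<beta> \<in> pos_roots D" if "- \<beta> \<in> pos_roots D"
    using par_weyl_pos_outside[OF assms(1,2) that] assms
    by (simp add: par_roots_uminus_iff fin_weyl_uminus par_weyl_fin)
  then show ?thesis using par_weyl_pos_outside[OF assms(1,2)] assms neg_iff_not_pos
    by (metis fin_weyl_root par_weyl_fin)
qed

lemma aff_refl_scale: "c \<noteq> 0 \<Longrightarrow> aff_refl (c *\<^sub>R \<beta>) 0 = aff_refl \<beta> 0"
  by (rule ext) (simp add: aff_refl_def coroot_def)

lemma refl_conj:
  assumes "x \<in> fin_weyl D"
  shows "aff_refl (x \<beta>) 0 \<circ> x = x \<circ> aff_refl \<beta> 0"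
proof (rule ext)
  fix y
  have "x y \<bullet> x \<beta> = y \<bullet> \<beta>" "x \<beta> \<bullet> x \<beta> = \<beta> \<bullet> \<beta>"
    using fin_weyl_orth[OF assms] by (auto simp: orthogonal_transformation_def)
  then show "(aff_refl (x \<beta>) 0 \<circ> x) y = (x \<circ> aff_refl \<beta> 0) y"
    by (simp add: aff_refl_def coroot_def linear_diff fin_weyl_linear[OF assms] linear_scale)
qed

text \<open>
  Reflections in conjugate roots are conjugate, and a positive root of \<open>\<Phi>\<^sub>J\<close> descends to a multiple
  of a simple root by reflections in simple roots of its support, which lie in \<open>J\<close>.
\<close>

lemma refl_in_par_weyl:
  assumes "J \<subseteq> fin_idx D" "\<beta> \<in> par_roots D J"
  shows "aff_refl \<beta> 0 \<in> par_weyl D J"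
proof -
  have pos: "\<gamma> \<in> par_roots D J \<longrightarrow> aff_refl \<gamma> 0 \<in> par_weyl D J" if "\<gamma> \<in> pos_roots D" for \<gamma>
    using that
  proof (induction rule: pos_root_induct)
    case (multiple i c)
    show ?case
    proof
      assume "c *\<^sub>R sroot D i \<in> par_roots D J"
      then have "i \<in> J" using multiple assms(1)
        by (auto simp: par_roots_iff inner_commute[of "sroot D _"] fund_coweight_sroot split: if_splits)
      then show "aff_refl (c *\<^sub>R sroot D i) 0 \<in> par_weyl D J"
        using multiple par_weyl_sgen[of i J D] by (simp add: aff_refl_scale sgen_refl)
    qed
  next
    case (reflect \<gamma> i)
    show ?case
    proof
      assume \<gamma>: "\<gamma> \<in> par_roots D J"
      then have iJ: "i \<in> J" using reflect(2,3) by (force simp: par_roots_iff[OF assms(1)])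
      let ?s = "sgen D i" and ?g = "aff_refl (sroot D i) 0 \<gamma>"
      have s: "?s \<in> par_weyl D J" using par_weyl_sgen iJ by blast
      have g: "?g = ?s \<gamma>" using reflect by (simp add: sgen_refl)
      then have IH: "aff_refl (?s \<gamma>) 0 \<in> par_weyl D J"
        using reflect \<gamma> par_weyl_par_roots[OF assms(1) s] by simp
      have "?s \<circ> aff_refl (?s \<gamma>) 0 \<circ> ?s = ?s \<circ> (?s \<circ> aff_refl \<gamma> 0)"
        using refl_conj[OF par_weyl_fin[OF assms(1) s], of \<gamma>] by (simp add: comp_assoc)
      also have "\<dots> = aff_refl \<gamma> 0"
        using sgen_sgen[OF fin_idx_sub_aff_idx[OF reflect(2)]] by (simp flip: comp_assoc)
      finally show "aff_refl \<gamma> 0 \<in> par_weyl D J" using s IH par_weyl_comp by metis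
    qed
  qed
  have "aff_refl (- \<beta>) 0 = aff_refl \<beta> 0" using aff_refl_scale[of "-1" \<beta>] by simp
  then show ?thesis using pos pos_or_neg[OF par_roots_root[OF assms(2)]] assms(2) par_roots_uminus by metis
qed

text \<open>
  Exchange condition: the positive root \<open>\<alpha>\<^sub>j\<close> becomes negative at one letter of the word; that
  letter is then the reflection conjugate to \<open>s\<^sub>j\<close> by the rest, so it cancels against \<open>s\<^sub>j\<close>.
\<close>

lemma exchange:
  assumes "set js \<subseteq> J" "J \<subseteq> fin_idx D" "j \<in> J" "wprod D js (sroot D j) \<notin> pos_roots D"
  shows "\<exists>js'. set js' \<subseteq> J \<and> length js' < length js \<and> wprod D js \<circ> sgen D j = wprod D js'"
  using assms(1,4)
proof (induction js)
  case Nil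
  then show ?case using assms sroot_pos by auto
next
  case (Cons i js)
  let ?x = "wprod D js"
  have x: "?x \<in> fin_weyl D" using Cons assms(2) by (auto simp: par_weyl_def)
  have iI: "i \<in> fin_idx D" and jI: "j \<in> fin_idx D" using Cons assms by auto
  show ?case
  proof (cases "?x (sroot D j) \<in> pos_roots D")
    case False
    moreover have "set js \<subseteq> J" using Cons(2) by simp
    ultimately obtain js' where js': "set js' \<subseteq> J" "length js' < length js" "?x \<circ> sgen D j = wprod D js'"
      using Cons.IH by blast
    have "wprod D (i # js) \<circ> sgen D j = wprod D (i # js')"  by (simp only: wprod_Cons comp_assoc js'(3))
    moreover have "set (i # js') \<subseteq> J" "length (i # js') < length (i # js)" using js' Cons(2) by auto
    ultimately show ?thesis by blast
  next
    case True
    have "aff_refl (sroot D i) 0 (?x (sroot D j)) \<notin> pos_roots D"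
      using Cons(3) iI by (simp add: sgen_refl)
    then obtain c where c: "0 < c" "?x (sroot D j) = c *\<^sub>R sroot D i"
      using simple_refl_pos[OF iI True] by blast
    then have "sgen D i \<circ> ?x = ?x \<circ> sgen D j"
      using refl_conj[OF x, of "sroot D j"] iI jI by (simp add: sgen_refl aff_refl_scale)
    then have "wprod D (i # js) \<circ> sgen D j = ?x \<circ> (sgen D j \<circ> sgen D j)"
      by (simp add: comp_assoc)
    then have "wprod D (i # js) \<circ> sgen D j = ?x"
      using sgen_sgen[OF fin_idx_sub_aff_idx[OF jI]] by simp
    moreover have "set js \<subseteq> J" "length js < length (i # js)" using Cons(2) by auto
    ultimately show ?thesis by blast
  qed
qed

text \<open>
  The last letter of a non-empty shortest word could be cancelled by the exchange condition.
\<close>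

lemma par_weyl_trivial:
  assumes "J \<subseteq> fin_idx D" "x \<in> par_weyl D J" "\<And>j. j \<in> J \<Longrightarrow> x (sroot D j) \<in> pos_roots D"
  shows "x = id"
proof -
  let ?P = "\<lambda>js. set js \<subseteq> J \<and> x = wprod D js"
  have "\<exists>js. ?P js" using assms(2) by (auto simp: par_weyl_def)
  then obtain js where js: "?P js" "\<And>js'. length js' < length js \<Longrightarrow> \<not> ?P js'"
    using ex_has_least_nat[of ?P _ length] by (metis not_le)
  show ?thesis
  proof (cases js rule: rev_cases)
    case Nil then show ?thesis using js by simp
  next
    case (snoc ks j)
    then have j: "j \<in> J" "set ks \<subseteq> J" "j \<in> fin_idx D" using js assms(1) by auto
    have x: "x = wprod D ks \<circ> sgen D j" using js snoc by (simp add: wprod_append)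
    have "wprod D ks \<in> fin_weyl D" using j assms(1) by (auto simp: par_weyl_def)
    then have "x (sroot D j) = - wprod D ks (sroot D j)"
      unfolding x using j by (simp add: sgen_refl refl_self root_nz sroot_root fin_weyl_uminus)
    then have "wprod D ks (sroot D j) \<notin> pos_roots D" using assms(3)[OF j(1)] pos_not_neg by fastforce
    then obtain js' where "set js' \<subseteq> J" "length js' < length ks" "x = wprod D js'"
      using exchange[OF j(2) assms(1) j(1)] x by auto
    then show ?thesis using js(2)[of js'] snoc by simp
  qed
qed

text \<open>Equal signs mean that \<open>x\<^sup>-\<^sup>1 y\<close> keeps the simple roots of \<open>J\<close> positive, which makes it trivial.\<close>

lemma par_weyl_eqI:
  assumes "J \<subseteq> fin_idx D" "x \<in> par_weyl D J" "y \<in> par_weyl D J"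
    and same: "\<And>\<beta>. \<beta> \<in> par_pos_roots D J \<Longrightarrow> fun_inv x \<beta> \<in> pos_roots D \<longleftrightarrow> fun_inv y \<beta> \<in> pos_roots D"
  shows "x = y"
proof -
  have xf: "x \<in> fin_weyl D" and yf: "y \<in> fin_weyl D" using assms par_weyl_fin by auto
  let ?z = "fun_inv x \<circ> y"
  have z: "?z \<in> par_weyl D J" by (intro par_weyl_comp par_weyl_inv assms)
  have "?z (sroot D j) \<in> pos_roots D" if j: "j \<in> J" for j
  proof -
    let ?b = "y (sroot D j)"
    have sj: "sroot D j \<in> pos_roots D" using j assms(1) sroot_pos by auto
    have "?b \<in> par_roots D J" using sroot_par_pos[OF assms(1) j] assms
      by (simp add: par_weyl_par_roots par_pos_roots_def)
    then show ?thesis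
    proof (cases rule: par_roots_cases)
      case 1
      then show ?thesis using same[OF 1] yf sj by simp
    next
      case 2
      have "fun_inv y (- ?b) \<notin> pos_roots D"
        using yf sj pos_not_neg by (simp add: fin_weyl_uminus fin_weyl_inv)
      then have "fun_inv x (- ?b) \<notin> pos_roots D" using same[OF 2] by simp
      moreover have "fun_inv x (- ?b) \<in> roots D"
        using 2 xf by (auto simp: par_pos_roots_def par_roots_def intro: fin_weyl_root fin_weyl_inv)
      ultimately have "- fun_inv x (- ?b) \<in> pos_roots D" using pos_or_neg by blast
      then show ?thesis using xf by (simp add: fin_weyl_uminus fin_weyl_inv)
    qed
  qed
  then have "?z = id" using par_weyl_trivial[OF assms(1) z] by blast
  then show ?thesis by (metis comp_apply eq_id_iff ext fin_weyl_inv_apply(2) xf)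
qed

subsection \<open>The extended affine group\<close>

lemma wt_transl [simp]: "u \<in> fin_weyl D \<Longrightarrow> wt (transl \<mu> \<circ> u) = \<mu>"
  by (simp add: wt_def transl_def fin_weyl_0)
lemma lin_transl [simp]: "u \<in> fin_weyl D \<Longrightarrow> lin (transl \<mu> \<circ> u) = u"
  by (simp add: lin_def transl_def fin_weyl_0)

lemma ext_weylI: "\<mu> \<in> coweights D \<Longrightarrow> u \<in> fin_weyl D \<Longrightarrow> transl \<mu> \<circ> u \<in> ext_weyl D"
  by (auto simp: ext_weyl_def)

lemma ext_weyl_lin: "w \<in> ext_weyl D \<Longrightarrow> lin w \<in> fin_weyl D"
  and ext_weyl_wt: "w \<in> ext_weyl D \<Longrightarrow> wt w \<in> coweights D"
  and ext_weyl_eq: "w \<in> ext_weyl D \<Longrightarrow> w = transl (wt w) \<circ> lin w"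
  by (auto simp: ext_weyl_def)

lemma ext_weyl_apply: "w \<in> ext_weyl D \<Longrightarrow> w x = wt w + lin w x"
  by (simp add: wt_def lin_def)

lemma transl_0: "transl 0 = id" by (auto simp: transl_def)

lemma fin_weyl_ext: "u \<in> fin_weyl D \<Longrightarrow> u \<in> ext_weyl D"
  using ext_weylI[of 0 u] by (simp add: transl_0 coweights_iff)

lemma fin_weyl_wt [simp]: "u \<in> fin_weyl D \<Longrightarrow> wt u = 0"
  and fin_weyl_lin [simp]: "u \<in> fin_weyl D \<Longrightarrow> lin u = u"
  by (simp_all add: wt_def lin_def fin_weyl_0)

lemma wt_comp: "w \<in> ext_weyl D \<Longrightarrow> wt (w \<circ> w') = wt w + lin w (wt w')"
  by (simp add: wt_def lin_def)

lemma lin_comp: 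
  assumes "w \<in> ext_weyl D" shows "lin (w \<circ> w') = lin w \<circ> lin w'"
proof -
  have "w (w' x) - w (w' 0) = lin w (w' x - w' 0)" for x
    using ext_weyl_apply[OF assms] fin_weyl_linear[OF ext_weyl_lin[OF assms]]
    by (simp add: linear_diff)
  then show ?thesis by (simp add: fun_eq_iff lin_def[of "w \<circ> w'"] lin_def[of w'])
qed

lemma coweights_add: "x \<in> coweights D \<Longrightarrow> y \<in> coweights D \<Longrightarrow> x + y \<in> coweights D"
  by (auto simp: coweights_iff inner_add_left)

lemma ext_weyl_comp:
  assumes "w \<in> ext_weyl D" "w' \<in> ext_weyl D" shows "w \<circ> w' \<in> ext_weyl D"
proof -
  have "w \<circ> w' = transl (wt (w \<circ> w')) \<circ> lin (w \<circ> w')"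
    by (auto simp: transl_def wt_def lin_def)
  moreover have "wt (w \<circ> w') \<in> coweights D" "lin (w \<circ> w') \<in> fin_weyl D"
    using assms by (auto simp: wt_comp lin_comp ext_weyl_lin ext_weyl_wt fin_weyl_coweight
        intro!: coweights_add par_weyl_comp)
  ultimately show ?thesis by (auto simp: ext_weyl_def)
qed

lemma sgen_ext_weyl: "i \<in> aff_idx D \<Longrightarrow> sgen D i \<in> ext_weyl D"
proof (cases "i = 0")
  case True
  have "highest_root D \<in> par_roots D (fin_idx D)" using highest_root by (simp add: par_roots_iff)
  then have "aff_refl (highest_root D) 0 \<in> fin_weyl D" by (rule refl_in_par_weyl[OF subset_refl])
  moreover have "sgen D 0 = transl (coroot (highest_root D)) \<circ> aff_refl (highest_root D) 0"
    by (rule ext) (simp add: sgen_0 transl_def)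
  ultimately show ?thesis using True by (simp add: ext_weylI coroot_coweight highest_root)
next
  case False
  moreover assume "i \<in> aff_idx D"
  ultimately show ?thesis by (auto simp: aff_idx_eq intro!: fin_weyl_ext par_weyl_sgen)
qed

lemma wprod_ext_weyl: "set js \<subseteq> aff_idx D \<Longrightarrow> wprod D js \<in> ext_weyl D"
  by (induction js) (auto intro: ext_weyl_comp sgen_ext_weyl simp: fin_weyl_ext[OF par_weyl_id])

lemma alcove_stab_ext: "\<sigma> \<in> alcove_stab D \<Longrightarrow> \<sigma> \<in> ext_weyl D" by (simp add: alcove_stab_def)
lemma alcove_stab_image: "\<sigma> \<in> alcove_stab D \<Longrightarrow> (w \<circ> \<sigma>) ` alcove0 D = w ` alcove0 D"
  by (simp only: alcove_stab_def image_comp[symmetric] mem_Collect_eq)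

lemma id_stab: "id \<in> alcove_stab D" by (simp add: alcove_stab_def fin_weyl_ext par_weyl_id)

text \<open>
  Composing affine roots with \<open>w\<close> turns questions about the alcove \<open>w A\<^sub>0\<close> into questions about \<open>A\<^sub>0\<close>.
\<close>

lemma ext_weyl_pull_back:
  assumes "w \<in> ext_weyl D" "\<beta> \<in> roots D"
  obtains \<gamma> m where "\<gamma> \<in> roots D" "\<beta> = lin w \<gamma>" "wt w \<bullet> \<beta> = of_int m"
    "\<And>x. w x \<bullet> \<beta> = x \<bullet> \<gamma> + of_int m"
proof -
  have l: "lin w \<in> fin_weyl D" using ext_weyl_lin assms by blast
  obtain m where m: "wt w \<bullet> \<beta> = of_int m"
    using coweights_root_int[OF ext_weyl_wt[OF assms(1)] assms(2)] by (auto elim: Ints_cases)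
  show ?thesis
  proof (rule that[of "fun_inv (lin w) \<beta>" m])
    show "w x \<bullet> \<beta> = x \<bullet> fun_inv (lin w) \<beta> + of_int m" for x
      using l by (simp add: ext_weyl_apply[OF assms(1)] inner_add_left m fin_weyl_inner)
  qed (use l m assms in \<open>auto intro: fin_weyl_root fin_weyl_inv\<close>)
qed

lemma wall_crossing:
  assumes "w \<in> ext_weyl D" "i \<in> aff_idx D" "\<beta> \<in> roots D"
    and "\<forall>x\<in>alcove0 D. 0 \<le> w x \<bullet> \<beta> + of_int k"
    and "\<not> (\<forall>x\<in>alcove0 D. 0 \<le> w (sgen D i x) \<bullet> \<beta> + of_int k)"
  shows "\<exists>c>0. \<beta> = c *\<^sub>R lin w (fst (aff_sroot D i)) \<and>
    wt w \<bullet> \<beta> + of_int k = c * of_int (snd (aff_sroot D i))"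
proof -
  obtain \<gamma> m where g: "\<gamma> \<in> roots D" "\<beta> = lin w \<gamma>" "wt w \<bullet> \<beta> = of_int m"
    "\<And>x. w x \<bullet> \<beta> = x \<bullet> \<gamma> + of_int m"
    using ext_weyl_pull_back[OF assms(1,3)] by metis
  then have "\<exists>c>0. \<gamma> = c *\<^sub>R fst (aff_sroot D i) \<and> of_int (m + k) = c * of_int (snd (aff_sroot D i))"
    using assms(4,5) by (intro separated_by_simple assms(2)) (auto simp: algebra_simps)
  then show ?thesis using g ext_weyl_lin[OF assms(1)] by (auto simp: fin_weyl_scale)
qed

lemma wall_crossing_iff:
  assumes "w \<in> ext_weyl D" "i \<in> aff_idx D" "\<beta> \<in> roots D"
  shows "(\<forall>x\<in>alcove0 D. 0 \<le> w x \<bullet> \<beta> + of_int k) \<and>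
      (\<forall>x\<in>alcove0 D. w (sgen D i x) \<bullet> \<beta> + of_int k \<le> 0) \<longleftrightarrow>
    (\<exists>c>0. \<beta> = c *\<^sub>R lin w (fst (aff_sroot D i)) \<and>
      wt w \<bullet> \<beta> + of_int k = c * of_int (snd (aff_sroot D i)))" (is "?L \<longleftrightarrow> ?R")
proof
  assume L: ?L
  have "\<not> (\<forall>x\<in>alcove0 D. 0 \<le> w (sgen D i x) \<bullet> \<beta> + of_int k)"
  proof
    assume "\<forall>x\<in>alcove0 D. 0 \<le> w (sgen D i x) \<bullet> \<beta> + of_int k"
    moreover obtain \<gamma> m where g: "\<gamma> \<in> roots D"
      "\<And>x. (w \<circ> sgen D i) x \<bullet> \<beta> = x \<bullet> \<gamma> + of_int m"
      using ext_weyl_pull_back[OF ext_weyl_comp[OF assms(1) sgen_ext_weyl[OF assms(2)]] assms(3)] by metis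
    ultimately show False using L alcove0_not_both[OF g(1), of "m + k"]
      by (simp add: add.assoc)
  qed
  then show ?R using wall_crossing[OF assms] L by blast
next
  assume ?R
  then obtain c where c: "c > 0" "\<beta> = c *\<^sub>R lin w (fst (aff_sroot D i))"
    "wt w \<bullet> \<beta> + of_int k = c * of_int (snd (aff_sroot D i))" by auto
  have l: "lin w \<in> fin_weyl D" using ext_weyl_lin assms by blast
  have "lin w x \<bullet> lin w y = x \<bullet> y" for x y
    using l by (simp add: fin_weyl_inner)
  then have "lin w x \<bullet> \<beta> = c * (x \<bullet> fst (aff_sroot D i))" for x by (simp add: c(2))
  then have eq: "w x \<bullet> \<beta> + of_int k = c * wall i x" for x
    using c(3) ext_weyl_apply[OF assms(1), of x] by (simp add: inner_add_left algebra_simps)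
  have "w (sgen D i x) \<bullet> \<beta> + of_int k = - (c * wall i x)" for x
    unfolding eq[of "sgen D i x"] wall_sgen[OF assms(2)] by (simp only: mult_minus_right)
  moreover have "0 \<le> c * wall i x" if "x \<in> alcove0 D" for x
    using c(1) wall_nonneg[OF assms(2) that] by simp
  ultimately show ?L using eq by simp
qed

text \<open>
  The hyperplane between \<open>w A\<^sub>0\<close> and \<open>w s\<^sub>i A\<^sub>0\<close> is the image under \<open>w\<close> of the \<open>i\<close>-th wall;
  proportional roots with the same hyperplane account for the factor \<open>c\<close>.
\<close>

lemma crosses_up_into:
  assumes "w \<in> ext_weyl D" "i \<in> aff_idx D" "\<beta> \<in> roots D"
  shows "crosses_up D (w \<circ> sgen D i) w \<beta> k \<longleftrightarrow>
    (\<exists>c>0. \<beta> = c *\<^sub>R lin w (fst (aff_sroot D i)) \<and>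
      wt w \<bullet> \<beta> - of_int k = c * of_int (snd (aff_sroot D i)))"
proof -
  have "crosses_up D (w \<circ> sgen D i) w \<beta> k \<longleftrightarrow>
    (\<forall>x\<in>alcove0 D. 0 \<le> w x \<bullet> \<beta> + of_int (- k)) \<and>
    (\<forall>x\<in>alcove0 D. w (sgen D i x) \<bullet> \<beta> + of_int (- k) \<le> 0)"
    by (auto simp: crosses_up_def image_subset_iff)
  moreover have "wt w \<bullet> \<beta> - of_int k = wt w \<bullet> \<beta> + of_int (- k)" by simp
  ultimately show ?thesis by (simp only: wall_crossing_iff[OF assms])
qed

lemma crosses_up_out:
  assumes "w \<in> ext_weyl D" "i \<in> aff_idx D" "\<beta> \<in> roots D"
  shows "crosses_up D w (w \<circ> sgen D i) \<beta> k \<longleftrightarrow>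
    (\<exists>c>0. - \<beta> = c *\<^sub>R lin w (fst (aff_sroot D i)) \<and>
      of_int k - wt w \<bullet> \<beta> = c * of_int (snd (aff_sroot D i)))"
proof -
  have "crosses_up D w (w \<circ> sgen D i) \<beta> k \<longleftrightarrow>
    (\<forall>x\<in>alcove0 D. 0 \<le> w x \<bullet> (- \<beta>) + of_int k) \<and>
    (\<forall>x\<in>alcove0 D. w (sgen D i x) \<bullet> (- \<beta>) + of_int k \<le> 0)"
    by (simp add: crosses_up_def image_subset_iff)
  moreover have "of_int k - wt w \<bullet> \<beta> = wt w \<bullet> (- \<beta>) + of_int k" by simp
  ultimately show ?thesis by (simp only: wall_crossing_iff[OF assms(1,2) root_uminus[OF assms(3)]])
qed

lemma lin_wall_root: "w \<in> ext_weyl D \<Longrightarrow> i \<in> aff_idx D \<Longrightarrow> lin w (fst (aff_sroot D i)) \<in> roots D"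
  using fin_weyl_root[OF ext_weyl_lin aff_sroot_root] .

lemma negative_crossing_iff:
  assumes "w \<in> ext_weyl D" "i \<in> aff_idx D"
  shows "negative_crossing D w i \<longleftrightarrow> lin w (fst (aff_sroot D i)) \<in> pos_roots D"
proof
  let ?g = "lin w (fst (aff_sroot D i))"
  have r: "?g \<in> roots D" using lin_wall_root assms by blast
  assume "negative_crossing D w i"
  then obtain \<beta> k where b: "\<beta> \<in> pos_roots D" "crosses_up D (w \<circ> sgen D i) w \<beta> k"
    unfolding negative_crossing_def by blast
  have "\<exists>c>0. \<beta> = c *\<^sub>R ?g \<and> wt w \<bullet> \<beta> - of_int k = c * of_int (snd (aff_sroot D i))"
    using b(2) by (simp only: crosses_up_into[OF assms pos_root_root[OF b(1)]])
  then obtain c where c: "c > 0" "\<beta> = c *\<^sub>R ?g" by (elim exE conjE)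
  have "(1/c) *\<^sub>R \<beta> = ?g" using c by simp
  then show "?g \<in> pos_roots D" using scaled_pos[of \<beta> "1/c"] r b(1) c(1) by simp
next
  let ?g = "lin w (fst (aff_sroot D i))"
  assume g: "?g \<in> pos_roots D"
  then have r: "?g \<in> roots D" using pos_root_root by blast
  obtain m where m: "wt w \<bullet> ?g = of_int m"
    using coweights_root_int[OF ext_weyl_wt[OF assms(1)] r] by (auto elim: Ints_cases)
  have "crosses_up D (w \<circ> sgen D i) w ?g (m - snd (aff_sroot D i))"
    unfolding crosses_up_into[OF assms r] by (intro exI[of _ 1]) (simp add: m)
  then show "negative_crossing D w i" using g by (auto simp: negative_crossing_def)
qed

lemma positive_crossing_iff:
  assumes "w \<in> ext_weyl D" "i \<in> aff_idx D"
  shows "positive_crossing D w i \<longleftrightarrow> lin w (fst (aff_sroot D i)) \<notin> pos_roots D"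
proof
  let ?g = "lin w (fst (aff_sroot D i))"
  have r: "?g \<in> roots D" using lin_wall_root assms by blast
  assume "positive_crossing D w i"
  then obtain \<beta> k where b: "\<beta> \<in> pos_roots D" "crosses_up D w (w \<circ> sgen D i) \<beta> k"
    unfolding positive_crossing_def by blast
  have "\<exists>c>0. - \<beta> = c *\<^sub>R ?g \<and> of_int k - wt w \<bullet> \<beta> = c * of_int (snd (aff_sroot D i))"
    using b(2) by (simp only: crosses_up_out[OF assms pos_root_root[OF b(1)]])
  then obtain c where c: "c > 0" "- \<beta> = c *\<^sub>R ?g" by (elim exE conjE)
  have "(1/c) *\<^sub>R (- \<beta>) = ?g" using c by simp
  then have "- ?g = (1/c) *\<^sub>R \<beta>" by (metis minus_minus scaleR_minus_right)
  then have "- ?g \<in> pos_roots D" using scaled_pos[of \<beta> "1/c"] root_uminus[OF r] b(1) c(1) by simp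
  then show "?g \<notin> pos_roots D" using pos_not_neg by blast
next
  let ?g = "lin w (fst (aff_sroot D i))"
  assume "?g \<notin> pos_roots D"
  moreover have r: "?g \<in> roots D" using lin_wall_root assms by blast
  ultimately have g: "- ?g \<in> pos_roots D" using pos_or_neg by blast
  obtain m where m: "wt w \<bullet> ?g = of_int m"
    using coweights_root_int[OF ext_weyl_wt[OF assms(1)] r] by (auto elim: Ints_cases)
  have "crosses_up D w (w \<circ> sgen D i) (- ?g) (snd (aff_sroot D i) - m)"
    unfolding crosses_up_out[OF assms root_uminus[OF r]] by (intro exI[of _ 1]) (simp add: m)
  then show "positive_crossing D w i" using g by (auto simp: positive_crossing_def)
qed

section \<open>Length and inversions\<close>

lemma half_sroot: "j \<in> fin_idx D \<Longrightarrow> (1/2) *\<^sub>R sroot D j \<notin> roots D"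
  using sroot_multiple[of j "1/2"] by auto

lemma inv_roots_eq:
  assumes "x \<in> fin_weyl D"
  shows "inv_roots D x = {\<beta> \<in> ind_pos_roots D. fun_inv x \<beta> \<notin> pos_roots D}"
proof -
  have i: "fun_inv x \<in> fin_weyl D" using assms fin_weyl_inv by blast
  have "(1/2) *\<^sub>R - fun_inv x \<beta> = - fun_inv x ((1/2) *\<^sub>R \<beta>)" for \<beta>
    by (simp add: fin_weyl_scale[OF i])
  moreover have "- y \<in> roots D \<longleftrightarrow> y \<in> roots D" for y using root_uminus[of y] root_uminus[of "-y"] by auto
  ultimately have "(1/2) *\<^sub>R - fun_inv x \<beta> \<in> roots D \<longleftrightarrow> (1/2) *\<^sub>R \<beta> \<in> roots D" for \<beta>
    by (simp only: fin_weyl_root_iff[OF i])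
  moreover have "- fun_inv x \<beta> \<in> pos_roots D \<longleftrightarrow> fun_inv x \<beta> \<notin> pos_roots D" if "\<beta> \<in> pos_roots D" for \<beta>
    using that i neg_iff_not_pos fin_weyl_root pos_root_root by blast
  ultimately show ?thesis by (auto simp: inv_roots_def ind_pos_roots_def)
qed

lemma finite_inv_roots: "finite (inv_roots D x)"
  by (rule finite_subset[OF _ finite_roots]) (auto simp: inv_roots_def ind_pos_roots_def pos_roots_def)

lemma simple_refl_ind_pos:
  assumes "j \<in> fin_idx D" "\<beta> \<in> ind_pos_roots D" "\<beta> \<noteq> sroot D j"
  shows "sgen D j \<beta> \<in> ind_pos_roots D"
proof -
  have s: "sgen D j \<in> fin_weyl D" using assms par_weyl_sgen by blast
  have b: "\<beta> \<in> pos_roots D" "(1/2) *\<^sub>R \<beta> \<notin> roots D" using assms by (auto simp: ind_pos_roots_def)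
  have "\<beta> \<noteq> c *\<^sub>R sroot D j" if "c > 0" for c
    using sroot_multiple[OF assms(1) that] b assms sroot_root pos_root_root by auto
  then have "sgen D j \<beta> \<in> pos_roots D"
    using simple_refl_pos[OF assms(1) b(1)] assms(1) by (auto simp: sgen_refl)
  moreover have "(1/2) *\<^sub>R sgen D j \<beta> \<notin> roots D"
    using b(2) fin_weyl_root_iff[OF s, of "(1/2) *\<^sub>R \<beta>"] by (simp add: fin_weyl_scale[OF s])
  ultimately show ?thesis by (simp add: ind_pos_roots_def)
qed

text \<open>
  As \<open>s\<^sub>j\<close> permutes the indivisible positive roots other than \<open>\<alpha>\<^sub>j\<close>, the inversions of \<open>s\<^sub>j x\<close> are the
  reflected inversions of \<open>x\<close> together with \<open>\<alpha>\<^sub>j\<close>.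
\<close>

lemma card_inv_roots_step:
  assumes "j \<in> fin_idx D" "x \<in> fin_weyl D" "fun_inv x (sroot D j) \<in> pos_roots D"
  shows "card (inv_roots D (sgen D j \<circ> x)) = Suc (card (inv_roots D x))"
proof -
  let ?s = "sgen D j"
  have s: "?s \<in> fin_weyl D" using assms par_weyl_sgen by blast
  have ss: "?s (?s y) = y" for y using sgen_invol assms(1) fin_idx_sub_aff_idx by blast
  have i: "fun_inv x \<in> fin_weyl D" using assms fin_weyl_inv by blast
  have "fun_inv ?s = ?s" by (rule inv_equality) (simp_all add: ss)
  then have inv: "fun_inv (?s \<circ> x) \<beta> = fun_inv x (?s \<beta>)" for \<beta>
    using fin_weyl_inv_comp[OF s assms(2)] by simp
  have sj: "?s (sroot D j) = - sroot D j" using assms(1) by (simp add: sgen_refl refl_self root_nz sroot_root)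
  have "inv_roots D (?s \<circ> x) = insert (sroot D j) (?s ` inv_roots D x)"
  proof (intro equalityI subsetI)
    fix \<beta> assume b: "\<beta> \<in> inv_roots D (?s \<circ> x)"
    then have b': "\<beta> \<in> ind_pos_roots D" "fun_inv x (?s \<beta>) \<notin> pos_roots D"
      by (auto simp: inv_roots_eq[OF par_weyl_comp[OF s assms(2)]] inv)
    show "\<beta> \<in> insert (sroot D j) (?s ` inv_roots D x)"
    proof (cases "\<beta> = sroot D j")
      case False
      then have "?s \<beta> \<in> inv_roots D x"
        using b' simple_refl_ind_pos[OF assms(1) b'(1)] by (simp add: inv_roots_eq[OF assms(2)])
      then have "?s (?s \<beta>) \<in> ?s ` inv_roots D x" by (rule imageI)
      then show ?thesis by (simp add: ss)
    qed simp
  next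
    fix \<beta> assume "\<beta> \<in> insert (sroot D j) (?s ` inv_roots D x)"
    then consider "\<beta> = sroot D j" | \<gamma> where "\<beta> = ?s \<gamma>" "\<gamma> \<in> inv_roots D x" by auto
    then show "\<beta> \<in> inv_roots D (?s \<circ> x)"
    proof cases
      case 1
      have "sroot D j \<in> ind_pos_roots D"
        using assms(1) sroot_pos half_sroot by (simp add: ind_pos_roots_def)
      moreover have "fun_inv x (?s (sroot D j)) \<notin> pos_roots D"
        using assms(3) pos_not_neg by (simp add: sj fin_weyl_uminus[OF i])
      ultimately show ?thesis using 1 by (simp add: inv_roots_eq[OF par_weyl_comp[OF s assms(2)]] inv)
    next
      case 2
      then have g: "\<gamma> \<in> ind_pos_roots D" "fun_inv x \<gamma> \<notin> pos_roots D"
        by (auto simp: inv_roots_eq[OF assms(2)])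
      then have "\<gamma> \<noteq> sroot D j" using assms(3) by auto
      then have "?s \<gamma> \<in> ind_pos_roots D" using simple_refl_ind_pos[OF assms(1)] g by blast
      then show ?thesis using 2 g by (simp add: inv_roots_eq[OF par_weyl_comp[OF s assms(2)]] inv ss)
    qed
  qed
  moreover have "sroot D j \<notin> ?s ` inv_roots D x"
  proof
    assume "sroot D j \<in> ?s ` inv_roots D x"
    then obtain \<gamma> where g: "\<gamma> \<in> inv_roots D x" "sroot D j = ?s \<gamma>" by auto
    then have "\<gamma> = - sroot D j" using ss[of \<gamma>] sj by simp
    then show False using g(1) pos_not_neg sroot_pos[OF assms(1)]
      by (auto simp: inv_roots_def ind_pos_roots_def)
  qed
  moreover have "inj_on ?s (inv_roots D x)" by (metis inj_onI ss)
  ultimately show ?thesis by (simp add: finite_inv_roots card_image)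
qed

lemma card_inv_roots_step_neg:
  assumes "j \<in> fin_idx D" "x \<in> fin_weyl D" "fun_inv x (sroot D j) \<notin> pos_roots D"
  shows "card (inv_roots D x) = Suc (card (inv_roots D (sgen D j \<circ> x)))"
proof -
  let ?s = "sgen D j"
  have s: "?s \<in> fin_weyl D" using assms par_weyl_sgen by blast
  have ss: "?s \<circ> ?s = id" using sgen_sgen assms(1) fin_idx_sub_aff_idx by blast
  have i: "fun_inv x \<in> fin_weyl D" using assms fin_weyl_inv by blast
  have "fun_inv ?s = ?s" using ss by (metis inv_unique_comp)
  then have "fun_inv (?s \<circ> x) (sroot D j) = fun_inv x (?s (sroot D j))"
    using fin_weyl_inv_comp[OF s assms(2)] by simp
  also have "\<dots> = - fun_inv x (sroot D j)"
    using assms(1) by (simp add: sgen_refl refl_self root_nz sroot_root fin_weyl_uminus[OF i])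
  finally have "fun_inv (?s \<circ> x) (sroot D j) \<in> pos_roots D"
    using assms(1,3) pos_or_neg fin_weyl_root[OF i sroot_root] by metis
  moreover have "?s \<circ> (?s \<circ> x) = x" using ss by (simp flip: comp_assoc)
  ultimately show ?thesis
    using card_inv_roots_step[OF assms(1) par_weyl_comp[OF s assms(2)]] by simp
qed

lemma fin_weyl_word: 
  "x \<in> fin_weyl D \<Longrightarrow> \<exists>js. set js \<subseteq> fin_idx D \<and> length js = card (inv_roots D x) \<and> x = wprod D js"
proof (induction "card (inv_roots D x)" arbitrary: x rule: less_induct)
  case less
  have i: "fun_inv x \<in> fin_weyl D" using less.prems fin_weyl_inv by blast
  show ?case
  proof (cases "\<forall>j\<in>fin_idx D. fun_inv x (sroot D j) \<in> pos_roots D")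
    case True
    then have "fun_inv x = id" using par_weyl_trivial[OF subset_refl i] by blast
    then have x: "x = id" using fin_weyl_inv_inv[OF less.prems] by simp
    have "inv_roots D id = {}"
      unfolding inv_roots_eq[OF par_weyl_id] by (auto simp: ind_pos_roots_def)
    then show ?thesis using x by (intro exI[of _ "[]"]) simp
  next
    case False
    then obtain j where j: "j \<in> fin_idx D" "fun_inv x (sroot D j) \<notin> pos_roots D" by auto
    have c: "card (inv_roots D x) = Suc (card (inv_roots D (sgen D j \<circ> x)))"
      using card_inv_roots_step_neg[OF j(1) less.prems j(2)] .
    then obtain js where js: "set js \<subseteq> fin_idx D" "length js = card (inv_roots D (sgen D j \<circ> x))"
        "sgen D j \<circ> x = wprod D js"
      using less.hyps[of "sgen D j \<circ> x"] par_weyl_comp[OF par_weyl_sgen[OF j(1)] less.prems] by auto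
    have "sgen D j \<circ> (sgen D j \<circ> x) = x"
      using sgen_sgen[OF fin_idx_sub_aff_idx[OF j(1)]] by (simp flip: comp_assoc)
    then have "x = wprod D (j # js)" by (simp only: js(3) wprod_Cons)
    moreover have "set (j # js) \<subseteq> fin_idx D" "length (j # js) = card (inv_roots D x)" using js c j(1) by auto
    ultimately show ?thesis by blast
  qed
qed

text \<open>
  Affine roots that separate the fundamental alcove from its image under \<open>w\<close>, one for each
  hyperplane whose gradient is indivisible. A letter of an expression of \<open>w\<close> adds at most one.
\<close>

definition separators :: "('a \<Rightarrow> 'a) \<Rightarrow> ('a \<times> int) set" where
  "separators w = {(\<beta>, k). \<beta> \<in> roots D \<and> (1/2) *\<^sub>R \<beta> \<notin> roots D \<and>
     (\<forall>x\<in>alcove0 D. 0 \<le> x \<bullet> \<beta> + of_int k) \<and> (\<forall>x\<in>w ` alcove0 D. x \<bullet> \<beta> + of_int k \<le> 0)}"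

lemma separators_step:
  assumes "w \<in> ext_weyl D" "i \<in> aff_idx D"
  shows "\<exists>a. separators (w \<circ> sgen D i) \<subseteq> insert a (separators w)"
proof -
  let ?N = "separators (w \<circ> sgen D i) - separators w"
  let ?f = "lin w (fst (aff_sroot D i))"
  have wall: "\<exists>c>0. \<beta> = c *\<^sub>R ?f \<and> wt w \<bullet> \<beta> + of_int k = c * of_int (snd (aff_sroot D i))"
    if "(\<beta>, k) \<in> ?N" for \<beta> k
  proof -
    have r: "\<beta> \<in> roots D" using that by (auto simp: separators_def)
    obtain \<gamma> m where g: "\<gamma> \<in> roots D" "\<And>x. w x \<bullet> \<beta> = x \<bullet> \<gamma> + of_int m"
      using ext_weyl_pull_back[OF assms(1) r] by metis
    have "\<not> (\<forall>x\<in>alcove0 D. w x \<bullet> \<beta> + of_int k \<le> 0)" using that by (auto simp: separators_def)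
    then have "\<forall>x\<in>alcove0 D. 0 \<le> w x \<bullet> \<beta> + of_int k"
      using alcove0_one_side[OF g(1), of "m + k"] by (auto simp: g(2) add.assoc)
    moreover have "\<forall>x\<in>alcove0 D. w (sgen D i x) \<bullet> \<beta> + of_int k \<le> 0"
      using that by (auto simp: separators_def)
    ultimately show ?thesis using wall_crossing_iff[OF assms r] by blast
  qed
  have "a = b" if ab: "a \<in> ?N" "b \<in> ?N" for a b
  proof -
    obtain \<beta> k \<gamma> l where [simp]: "a = (\<beta>, k)" "b = (\<gamma>, l)" by (cases a, cases b)
    obtain c d where c: "c > 0" "\<beta> = c *\<^sub>R ?f" "wt w \<bullet> \<beta> + of_int k = c * of_int (snd (aff_sroot D i))"
      and d: "d > 0" "\<gamma> = d *\<^sub>R ?f" "wt w \<bullet> \<gamma> + of_int l = d * of_int (snd (aff_sroot D i))"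
      using wall[of \<beta> k] wall[of \<gamma> l] ab by auto
    have "\<gamma> = (d / c) *\<^sub>R \<beta>" using c d by simp
    moreover have "\<beta> \<in> roots D" "(1/2) *\<^sub>R \<beta> \<notin> roots D" "\<gamma> \<in> roots D" "(1/2) *\<^sub>R \<gamma> \<notin> roots D"
      using ab by (auto simp: separators_def)
    ultimately have "d / c = 1" using ind_multiple_unique[of \<beta> "d / c"] c(1) d(1) by auto
    then have "c = d" by simp
    then have "\<beta> = \<gamma>" using c(2) d(2) by simp
    then have "real_of_int k = real_of_int l" using c(3) d(3) \<open>c = d\<close> by simp
    then show ?thesis using \<open>\<beta> = \<gamma>\<close> by simp
  qed
  then have "\<exists>a. ?N \<subseteq> {a}" by blast
  then show ?thesis by blast
qed

lemma separators_word:
  "set js \<subseteq> aff_idx D \<Longrightarrow> finite (separators (wprod D js)) \<and> card (separators (wprod D js)) \<le> length js"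
proof (induction js rule: rev_induct)
  case Nil
  have "(\<beta>, k) \<notin> separators id" for \<beta> k
  proof
    assume "(\<beta>, k) \<in> separators id"
    then have "\<beta> \<in> roots D" "\<forall>x\<in>alcove0 D. 0 \<le> x \<bullet> \<beta> + of_int k" "\<forall>x\<in>alcove0 D. x \<bullet> \<beta> + of_int k \<le> 0"
      unfolding separators_def by simp_all
    then show False by (rule alcove0_not_both)
  qed
  then have "separators (wprod D []) = {}" unfolding wprod_Nil by (intro equals0I) (auto simp: split_paired_all)
  then show ?case by (simp only: finite.emptyI card.empty le0 simp_thms)
next
  case (snoc i js)
  then have "wprod D js \<in> ext_weyl D" "i \<in> aff_idx D" by (auto intro: wprod_ext_weyl)
  then obtain a where a: "separators (wprod D js \<circ> sgen D i) \<subseteq> insert a (separators (wprod D js))"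
    using separators_step by blast
  have e: "wprod D (js @ [i]) = wprod D js \<circ> sgen D i" by (simp add: wprod_append)
  have IH: "finite (separators (wprod D js))" "card (separators (wprod D js)) \<le> length js"
    using snoc by auto
  have "card (separators (wprod D js \<circ> sgen D i)) \<le> card (insert a (separators (wprod D js)))"
    using a IH(1) by (intro card_mono) auto
  also have "\<dots> \<le> Suc (length js)" using IH by (simp add: card_insert_if)
  finally have "card (separators (wprod D js \<circ> sgen D i)) \<le> length (js @ [i])" by simp
  moreover have "finite (separators (wprod D js \<circ> sgen D i))"
    using finite_subset[OF a] IH(1) by simp
  ultimately show ?case unfolding e by blast
qed

lemma len_le: "expression D w js \<sigma> \<Longrightarrow> len D w \<le> length js"
  unfolding len_def by (rule Least_le) blast

lemma len_attained:
  assumes "expression D w js \<sigma>"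
  shows "\<exists>js \<sigma>. expression D w js \<sigma> \<and> length js = len D w"
proof -
  have "\<exists>js \<sigma>. expression D w js \<sigma> \<and> len D w = length js"
    unfolding len_def by (rule LeastI_ex) (use assms in blast)
  then show ?thesis by metis
qed

text \<open>
  Descending along simple reflections gives an expression with as many letters as there are
  inversions. No expression is shorter, even with affine letters and an element of \<open>\<Sigma>\<close>, because
  inversions are separators.
\<close>

lemma fin_weyl_len:
  assumes "x \<in> fin_weyl D" shows "len D x = card (inv_roots D x)"
proof (rule antisym)
  obtain js where js: "set js \<subseteq> fin_idx D" "length js = card (inv_roots D x)" "x = wprod D js"
    using fin_weyl_word[OF assms] by blast
  then have e: "expression D x js id" by (auto simp: expression_def id_stab aff_idx_eq)
  then show "len D x \<le> card (inv_roots D x)" using len_le js(2) by metis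
  obtain ks \<sigma> where ks: "expression D x ks \<sigma>" "length ks = len D x" using len_attained[OF e] by blast
  then have w: "set ks \<subseteq> aff_idx D" "\<sigma> \<in> alcove_stab D" "x = wprod D ks \<circ> \<sigma>"
    by (auto simp: expression_def)
  have "separators x = separators (wprod D ks)"
    unfolding separators_def w(3) alcove_stab_image[OF w(2)] ..
  then have s: "finite (separators x)" "card (separators x) \<le> len D x"
    using separators_word[OF w(1)] ks(2) by auto
  have "(\<lambda>\<beta>. (\<beta>, 0)) ` inv_roots D x \<subseteq> separators x"
  proof (rule image_subsetI)
    fix \<beta> assume "\<beta> \<in> inv_roots D x"
    then have b: "\<beta> \<in> pos_roots D" "(1/2) *\<^sub>R \<beta> \<notin> roots D" "- fun_inv x \<beta> \<in> pos_roots D"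
      by (auto simp: inv_roots_def ind_pos_roots_def)
    have "0 \<le> y \<bullet> - fun_inv x \<beta>" if "y \<in> alcove0 D" for y using that b(3) unfolding alcove0_def by blast
    then show "(\<beta>, 0) \<in> separators x"
      using b pos_root_root fin_weyl_inner[OF assms] by (auto simp: separators_def alcove0_def)
  qed
  then have "card ((\<lambda>\<beta>. (\<beta>, 0::int)) ` inv_roots D x) \<le> card (separators x)"
    using s(1) card_mono by blast
  then show "card (inv_roots D x) \<le> len D x" using s(2) by (simp add: card_image inj_on_def)
qed

section \<open>Minimal coset representatives and longest elements\<close>

text \<open>
  Stated for linear maps, so that it covers the inverses of elements of \<open>W\<^sub>0\<close> and their negatives.
\<close>

lemma linear_pos_root:
  assumes "linear f" "J \<subseteq> fin_idx D" "\<And>j. j \<in> J \<Longrightarrow> f (sroot D j) \<in> pos_roots D"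
    "\<beta> \<in> par_pos_roots D J" "f \<beta> \<in> roots D"
  shows "f \<beta> \<in> pos_roots D"
proof -
  have b: "\<beta> \<in> pos_roots D" "\<forall>i\<in>fin_idx D - J. \<beta> \<bullet> fund_coweight D i = 0"
    using assms(2,4) by (auto simp: par_pos_roots_def par_roots_iff)
  obtain j where j: "j \<in> fin_idx D" "0 < \<beta> \<bullet> fund_coweight D j" using pos_has_coeff[OF b(1)] .
  then have jJ: "j \<in> J" using b by force
  obtain l where l: "l \<in> fin_idx D" "0 < f (sroot D j) \<bullet> fund_coweight D l"
    using pos_has_coeff[OF assms(3)[OF jJ]] .
  let ?t = "\<lambda>i. (\<beta> \<bullet> fund_coweight D i) * (f (sroot D i) \<bullet> fund_coweight D l)"
  have "f \<beta> = (\<Sum>i\<in>fin_idx D. (\<beta> \<bullet> fund_coweight D i) *\<^sub>R f (sroot D i))"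
    by (subst sroot_expansion[of \<beta>]) (simp add: linear_sum[OF assms(1)] linear_scale[OF assms(1)])
  then have e: "f \<beta> \<bullet> fund_coweight D l = (\<Sum>i\<in>fin_idx D. ?t i)" by (simp add: inner_sum_left)
  have "0 \<le> ?t i" if i: "i \<in> fin_idx D" for i
  proof (cases "i \<in> J")
    case True
    then show ?thesis using pos_coeff_ge_0[OF b(1) i] pos_coeff_ge_0[OF assms(3)[OF True] l(1)] by simp
  qed (use i b in simp)
  then have "0 < (\<Sum>i\<in>fin_idx D. ?t i)" using j l by (intro sum_pos2[OF _ j(1)]) auto
  then show ?thesis using pos_rootI[OF assms(5) l(1)] e by simp
qed

context
  fixes J :: "nat set" assumes J: "J \<subseteq> fin_idx D"
begin

lemma min_reps_fin: "u \<in> min_reps D J \<Longrightarrow> u \<in> fin_weyl D" by (simp add: min_reps_def)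

text \<open>
  If \<open>u\<^sup>-\<^sup>1\<close> made a simple root of \<open>J\<close> negative, the corresponding reflection would shorten \<open>u\<close> within
  its coset.
\<close>

lemma min_reps_pos:
  assumes "u \<in> min_reps D J" "\<beta> \<in> par_pos_roots D J"
  shows "fun_inv u \<beta> \<in> pos_roots D"
proof -
  have u: "u \<in> fin_weyl D" using assms min_reps_fin by blast
  have i: "fun_inv u \<in> fin_weyl D" using u fin_weyl_inv by blast
  have "fun_inv u (sroot D j) \<in> pos_roots D" if "j \<in> J" for j
  proof (rule ccontr)
    assume n: "\<not> ?thesis"
    have jI: "j \<in> fin_idx D" using J that by auto
    have "len D u \<le> len D (sgen D j \<circ> u)" using assms(1) par_weyl_sgen[OF that] unfolding min_reps_def by blast
    then show False using card_inv_roots_step_neg[OF jI u n]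
      by (simp add: fin_weyl_len u par_weyl_comp[OF par_weyl_sgen[OF jI] u])
  qed
  then show ?thesis
    using linear_pos_root[OF fin_weyl_linear[OF i] J _ assms(2)] assms(2) i
      par_pos_rootsD(2) pos_root_root fin_weyl_root by blast
qed

lemma coset_decomposition:
  assumes "x \<in> fin_weyl D"
  obtains y u where "y \<in> par_weyl D J" "u \<in> min_reps D J" "x = y \<circ> u"
proof -
  obtain y where y: "y \<in> par_weyl D J" "\<forall>z. z \<in> par_weyl D J \<longrightarrow> len D (y \<circ> x) \<le> len D (z \<circ> x)"
    using ex_has_least_nat[of "\<lambda>y. y \<in> par_weyl D J" id "\<lambda>y. len D (y \<circ> x)"] par_weyl_id by blast
  have yf: "y \<in> fin_weyl D" using par_weyl_fin[OF J y(1)] .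
  have "y \<circ> x \<in> min_reps D J"
    using y yf assms par_weyl_comp by (fastforce simp: min_reps_def simp flip: comp_assoc)
  moreover have "x = fun_inv y \<circ> (y \<circ> x)" using yf by (simp add: fun_eq_iff)
  ultimately show ?thesis using that par_weyl_inv[OF J y(1)] by blast
qed

text \<open>
  The element of \<open>W\<^sub>J\<close> relating two minimal representatives of one coset keeps the simple roots of \<open>J\<close>
  positive, since both inverses do.
\<close>

lemma coset_decomposition_unique:
  assumes "y \<in> par_weyl D J" "u \<in> min_reps D J" "y' \<in> par_weyl D J" "u' \<in> min_reps D J"
    "y \<circ> u = y' \<circ> u'"
  shows "y = y'" "u = u'"
proof -
  have f: "y \<in> fin_weyl D" "y' \<in> fin_weyl D" "u \<in> fin_weyl D" "u' \<in> fin_weyl D"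
    using assms par_weyl_fin[OF J] min_reps_fin by auto
  let ?z = "fun_inv y \<circ> y'"
  have z: "?z \<in> par_weyl D J" using par_weyl_comp par_weyl_inv[OF J] assms by blast
  have e: "u = ?z \<circ> u'"
  proof (rule ext)
    fix x
    have "y (u x) = y' (u' x)" using assms(5) by (metis comp_apply)
    then show "u x = (?z \<circ> u') x" using f(1) by (metis comp_apply fin_weyl_inv_apply(1))
  qed
  have "?z (sroot D j) \<in> pos_roots D" if j: "j \<in> J" for j
  proof -
    let ?b = "?z (sroot D j)"
    have zf: "?z \<in> fin_weyl D" using z par_weyl_fin[OF J] by blast
    have uf: "fun_inv u \<in> fin_weyl D" using f fin_weyl_inv by blast
    have c: "fun_inv u = fun_inv u' \<circ> fun_inv ?z" using e fin_weyl_inv_comp[OF zf f(4)] by simp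
    have "fun_inv u ?b = fun_inv u' (fun_inv ?z ?b)" unfolding c by (rule comp_apply)
    also have "fun_inv ?z ?b = sroot D j" by (rule fin_weyl_inv_apply(1)[OF zf])
    finally have "fun_inv u ?b = fun_inv u' (sroot D j)" .
    then have p: "fun_inv u ?b \<in> pos_roots D" using min_reps_pos[OF assms(4) sroot_par_pos[OF J j]] by simp
    have "?b \<in> par_roots D J"
      using par_weyl_par_roots[OF J z] sroot_par_pos[OF J j] par_pos_rootsD by blast
    then show ?thesis
    proof (cases rule: par_roots_cases)
      case 1 then show ?thesis by (rule par_pos_rootsD)
    next
      case 2
      have "- fun_inv u ?b \<in> pos_roots D"
        using min_reps_pos[OF assms(2) 2] fin_weyl_uminus[OF uf, of ?b] by simp
      then show ?thesis using p pos_not_neg by blast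
    qed
  qed
  then have "?z = id" using par_weyl_trivial[OF J z] by blast
  then show "u = u'" using e by simp
  show "y = y'" using \<open>?z = id\<close> f(1) by (metis comp_apply eq_id_iff ext fin_weyl_inv_apply(2))
qed

lemma lin_par_min_eqI:
  assumes "y \<in> par_weyl D J" "u \<in> min_reps D J" "lin w = y \<circ> u"
  shows "lin_par D J w = y" "lin_min D J w = u"
  unfolding lin_par_def lin_min_def
  using assms coset_decomposition_unique[OF assms(1,2)] by (auto intro!: the_equality)

text \<open>
  An element of greatest length in \<open>W\<^sub>J\<close> cannot be lengthened by a simple reflection, so its inverse
  makes every positive root of \<open>\<Phi>\<^sub>J\<close> negative. These signs determine it, which gives the uniqueness
  that the definite description in \<open>longest\<close> needs.
\<close>

lemma longest_neg:
  shows "longest D J \<in> par_weyl D J"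
    and "\<beta> \<in> par_pos_roots D J \<Longrightarrow> - fun_inv (longest D J) \<beta> \<in> par_pos_roots D J"
proof -
  let ?M = "\<lambda>y. y \<in> par_weyl D J \<and> (\<forall>x\<in>par_weyl D J. len D x \<le> len D y)"
  have neg: "- fun_inv y \<beta> \<in> par_pos_roots D J" if M: "?M y" and b: "\<beta> \<in> par_pos_roots D J" for y \<beta>
  proof -
    have y: "y \<in> par_weyl D J" "y \<in> fin_weyl D" using M par_weyl_fin[OF J] by auto
    have i: "fun_inv y \<in> par_weyl D J" "fun_inv y \<in> fin_weyl D" using y par_weyl_inv[OF J] fin_weyl_inv by auto
    have "- fun_inv y (sroot D j) \<in> pos_roots D" if j: "j \<in> J" for j
    proof (rule ccontr)
      assume n: "\<not> ?thesis"
      have jI: "j \<in> fin_idx D" using J j by auto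
      have p: "fun_inv y (sroot D j) \<in> pos_roots D"
        using n pos_or_neg[OF fin_weyl_root[OF i(2) sroot_root[OF jI]]] by blast
      have "len D (sgen D j \<circ> y) \<le> len D y" using M par_weyl_comp[OF par_weyl_sgen[OF j] y(1)] by blast
      then show False using card_inv_roots_step[OF jI y(2) p]
        by (simp add: fin_weyl_len y par_weyl_comp[OF par_weyl_sgen[OF jI] y(2)])
    qed
    moreover have "linear (\<lambda>x. - fun_inv y x)"
      using linear_compose_neg[OF fin_weyl_linear[OF i(2)]] .
    moreover have r: "- fun_inv y \<beta> \<in> par_roots D J"
      using b par_weyl_par_roots[OF J i(1)] par_roots_uminus par_pos_rootsD by blast
    ultimately have "- fun_inv y \<beta> \<in> pos_roots D"
      using linear_pos_root[of "\<lambda>x. - fun_inv y x", OF _ J _ b] par_roots_root by blast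
    then show ?thesis using r by (simp add: par_pos_roots_def)
  qed
  have unique: "y = y'" if M: "?M y" "?M y'" for y y'
  proof (rule par_weyl_eqI[OF J])
    fix \<beta> assume "\<beta> \<in> par_pos_roots D J"
    then have "- fun_inv y \<beta> \<in> pos_roots D" "- fun_inv y' \<beta> \<in> pos_roots D"
      using neg M par_pos_rootsD by blast+
    then show "fun_inv y \<beta> \<in> pos_roots D \<longleftrightarrow> fun_inv y' \<beta> \<in> pos_roots D" using pos_not_neg by blast
  qed (use M in auto)
  have "len D x \<le> card (roots D)" if "x \<in> par_weyl D J" for x
    using fin_weyl_len[OF par_weyl_fin[OF J that]] finite_roots
    by (auto simp: inv_roots_def ind_pos_roots_def pos_roots_def intro!: card_mono)
  then have "\<exists>y. ?M y"
    using ex_has_greatest_nat[of "\<lambda>y. y \<in> par_weyl D J" id "len D" "Suc (card (roots D))"] par_weyl_id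
    by (metis less_Suc_eq_le)
  then have "\<exists>!y. ?M y" using unique by blast
  then have M: "?M (longest D J)" unfolding longest_def by (rule theI')
  then show "longest D J \<in> par_weyl D J" by blast
  show "\<beta> \<in> par_pos_roots D J \<Longrightarrow> - fun_inv (longest D J) \<beta> \<in> par_pos_roots D J" using neg[OF M] .
qed

section \<open>Stabilisers of the parabolic alcove\<close>

text \<open>
  The pairs \<open>(\<mu>, y)\<close> such that the translation by \<open>\<mu>\<close> after \<open>y\<close> preserves \<open>\<A>\<^sub>J\<close>. The values of \<open>\<mu>\<close> on
  the positive roots of \<open>\<Phi>\<^sub>J\<close> and the signs of \<open>y\<^sup>-\<^sup>1\<close> on them determine each other, so \<open>y\<close> depends on
  \<open>\<mu>\<close> alone and this is another description of the elements \<open>\<tau>\<^sub>\<mu>\<close>.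
\<close>

definition aligned :: "'a \<Rightarrow> ('a \<Rightarrow> 'a) \<Rightarrow> bool" where
  "aligned \<mu> y \<longleftrightarrow> \<mu> \<in> coweights D \<and> y \<in> par_weyl D J \<and>
     (\<forall>\<beta>\<in>par_pos_roots D J. \<mu> \<bullet> \<beta> = (if fun_inv y \<beta> \<in> pos_roots D then 0 else 1))"

lemma alignedD:
  assumes "aligned \<mu> y"
  shows "\<mu> \<in> coweights D" "y \<in> par_weyl D J" "y \<in> fin_weyl D"
    "\<beta> \<in> par_pos_roots D J \<Longrightarrow> \<mu> \<bullet> \<beta> = (if fun_inv y \<beta> \<in> pos_roots D then 0 else 1)"
  using assms par_weyl_fin[OF J] by (auto simp: aligned_def)

lemma aligned_unique: "aligned \<mu> y \<Longrightarrow> aligned \<mu> y' \<Longrightarrow> y = y'"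
  by (rule par_weyl_eqI[OF J]) (auto simp: aligned_def split: if_splits)

lemma aligned_coweight: "aligned \<mu> y \<Longrightarrow> \<mu> \<in> par_coweights D J"
  by (auto simp: aligned_def par_coweights_def par_alcove_def)

end

lemma par_roots_mono: "K \<subseteq> J \<Longrightarrow> par_roots D K \<subseteq> par_roots D J"
  unfolding par_roots_def using span_mono[of "sroot D ` K" "sroot D ` J"] by auto

text \<open>
  The longest element for the simple roots on which \<open>\<mu>\<close> vanishes reverses the sign of exactly those
  positive roots of \<open>\<Phi>\<^sub>J\<close> on which \<open>\<mu>\<close> vanishes; the longest element of \<open>W\<^sub>J\<close> then reverses all signs,
  so that the roots with value 1 end up negative.
\<close>

lemma tau_aligned:
  assumes J: "J \<subseteq> fin_idx D" and "\<mu> \<in> par_coweights D J"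
  shows "\<exists>y. aligned J \<mu> y \<and> tau D J \<mu> = transl \<mu> \<circ> y"
proof (intro exI conjI)
  let ?K = "J - {j\<in>J. \<mu> \<bullet> sroot D j \<noteq> 0}"
  let ?y = "longest D ?K \<circ> longest D J"
  have K: "?K \<subseteq> fin_idx D" "?K \<subseteq> J" using J by auto
  have m: "\<mu> \<in> coweights D" "\<And>\<beta>. \<beta> \<in> par_pos_roots D J \<Longrightarrow> 0 \<le> \<mu> \<bullet> \<beta> \<and> \<mu> \<bullet> \<beta> \<le> 1"
    using assms(2) by (auto simp: par_coweights_def par_alcove_def)
  have l: "longest D ?K \<in> par_weyl D ?K" "longest D ?K \<in> par_weyl D J" "longest D J \<in> par_weyl D J"
    using longest_neg(1)[OF K(1)] longest_neg(1)[OF J] par_weyl_mono[OF K(2)] by auto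
  have f: "longest D ?K \<in> fin_weyl D" "longest D J \<in> fin_weyl D" using l par_weyl_fin[OF J] by auto
  have sj: "0 \<le> \<mu> \<bullet> sroot D j" if "j \<in> J" for j using m(2) sroot_par_pos[OF J that] by blast
  have "\<mu> \<bullet> \<beta> = (if fun_inv ?y \<beta> \<in> pos_roots D then 0 else 1)" if b: "\<beta> \<in> par_pos_roots D J" for \<beta>
  proof -
    have br: "\<beta> \<in> roots D" using b par_pos_rootsD par_roots_root by blast
    have b0: "\<forall>i\<in>fin_idx D - J. \<beta> \<bullet> fund_coweight D i = 0"
      using b J by (auto simp: par_pos_roots_def par_roots_iff)
    have bc: "0 \<le> \<beta> \<bullet> fund_coweight D i" if "i \<in> fin_idx D" for i
      using pos_coeff_ge_0 that b par_pos_rootsD by blast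
    have inv: "fun_inv ?y \<beta> = fun_inv (longest D J) (fun_inv (longest D ?K) \<beta>)"
      using fin_weyl_inv_comp[OF f] by simp
    have t0: "0 \<le> (\<beta> \<bullet> fund_coweight D i) * (\<mu> \<bullet> sroot D i)" if "i \<in> fin_idx D" for i
      using bc[OF that] sj b0 that by (cases "i \<in> J") auto
    show ?thesis
    proof (cases "\<mu> \<bullet> \<beta> = 0")
      case True
      then have "\<forall>i\<in>fin_idx D. (\<beta> \<bullet> fund_coweight D i) * (\<mu> \<bullet> sroot D i) = 0"
        unfolding inner_expansion[of \<mu> \<beta>] using t0 by (subst (asm) sum_nonneg_eq_0_iff) auto
      then have "\<beta> \<in> par_roots D ?K"
        using br b0 by (force simp: par_roots_iff[OF K(1)])
      then have "\<beta> \<in> par_pos_roots D ?K" using b by (auto simp: par_pos_roots_def)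
      then have n: "- fun_inv (longest D ?K) \<beta> \<in> par_pos_roots D J"
        using longest_neg(2)[OF K(1)] par_roots_mono[OF K(2)] by (auto simp: par_pos_roots_def)
      have "- fun_inv (longest D J) (- fun_inv (longest D ?K) \<beta>) \<in> pos_roots D"
        using longest_neg(2)[OF J n] par_pos_rootsD by blast
      then show ?thesis using True f by (simp add: inv fin_weyl_uminus fin_weyl_inv)
    next
      case False
      have "\<mu> \<bullet> \<beta> \<in> \<int>" using coweights_root_int[OF m(1) br] .
      then have 1: "\<mu> \<bullet> \<beta> = 1" using False m(2)[OF b] int_between_0_1 by blast
      have "\<beta> \<notin> par_roots D ?K"
      proof
        assume "\<beta> \<in> par_roots D ?K"
        then have "(\<beta> \<bullet> fund_coweight D i) * (\<mu> \<bullet> sroot D i) = 0" if "i \<in> fin_idx D" for i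
          using that b0 by (cases "i \<in> J") (auto simp: par_roots_iff[OF K(1)])
        then have "\<mu> \<bullet> \<beta> = 0" unfolding inner_expansion[of \<mu> \<beta>] by (intro sum.neutral) auto
        then show False using False by blast
      qed
      then have "fun_inv (longest D ?K) \<beta> \<in> pos_roots D"
        using par_weyl_pos_outside[OF K(1) par_weyl_inv[OF K(1) l(1)]] b par_pos_rootsD by blast
      moreover have "fun_inv (longest D ?K) \<beta> \<in> par_roots D J"
        using par_weyl_par_roots[OF J par_weyl_inv[OF J l(2)]] b par_pos_rootsD by blast
      ultimately have "- fun_inv ?y \<beta> \<in> pos_roots D"
        unfolding inv using longest_neg(2)[OF J] par_pos_rootsD by (metis IntI par_pos_roots_def)
      then show ?thesis using 1 pos_not_neg by auto
    qed
  qed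
  then show "aligned J \<mu> ?y" unfolding aligned_def[OF J]
    using m(1) par_weyl_comp[OF l(2,3)] by blast
  show "tau D J \<mu> = transl \<mu> \<circ> ?y" by (simp add: tau_def)
qed

context
  fixes J :: "nat set" assumes J: "J \<subseteq> fin_idx D"
begin

lemma tau_eq: "aligned J \<mu> y \<Longrightarrow> tau D J \<mu> = transl \<mu> \<circ> y"
  using tau_aligned[OF J aligned_coweight[OF J]] aligned_unique[OF J] by metis

lemma aligned_alcove_iff:
  assumes "aligned J \<mu> y"
  shows "\<mu> + y x \<in> par_alcove D J \<longleftrightarrow> x \<in> par_alcove D J"
proof
  note a = alignedD[OF J assms]
  assume x: "x \<in> par_alcove D J"
  show "\<mu> + y x \<in> par_alcove D J" unfolding par_alcove_def
  proof (intro CollectI ballI)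
    fix \<beta> assume b: "\<beta> \<in> par_pos_roots D J"
    have "fun_inv y \<beta> \<in> par_roots D J"
      using par_weyl_par_roots[OF J par_weyl_inv[OF J a(2)]] b par_pos_rootsD by blast
    then show "0 \<le> (\<mu> + y x) \<bullet> \<beta> \<and> (\<mu> + y x) \<bullet> \<beta> \<le> 1"
    proof (cases rule: par_roots_cases)
      case 1
      then have "0 \<le> x \<bullet> fun_inv y \<beta>" "x \<bullet> fun_inv y \<beta> \<le> 1" "\<mu> \<bullet> \<beta> = 0"
        using x a(4)[OF b] par_pos_rootsD(2)[OF 1] by (auto simp: par_alcove_def)
      then show ?thesis by (simp add: inner_add_left fin_weyl_inner[OF a(3)])
    next
      case 2
      then have "0 \<le> x \<bullet> (- fun_inv y \<beta>) \<and> x \<bullet> (- fun_inv y \<beta>) \<le> 1"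
        using x unfolding par_alcove_def by blast
      moreover have "\<mu> \<bullet> \<beta> = 1" using a(4)[OF b] par_pos_rootsD(2)[OF 2] pos_not_neg by auto
      ultimately show ?thesis by (simp add: inner_add_left fin_weyl_inner[OF a(3)])
    qed
  qed
next
  note a = alignedD[OF J assms]
  assume x: "\<mu> + y x \<in> par_alcove D J"
  show "x \<in> par_alcove D J" unfolding par_alcove_def
  proof (intro CollectI ballI)
    fix \<beta> assume b: "\<beta> \<in> par_pos_roots D J"
    have in_eq: "y x \<bullet> y \<beta> = x \<bullet> \<beta>" using a(3) by (simp add: fin_weyl_inner)
    have "y \<beta> \<in> par_roots D J"
      using par_weyl_par_roots[OF J a(2)] b par_pos_rootsD by blast
    then show "0 \<le> x \<bullet> \<beta> \<and> x \<bullet> \<beta> \<le> 1"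
    proof (cases rule: par_roots_cases)
      case 1
      have "\<mu> \<bullet> y \<beta> = 0" using a(4)[OF 1] a(3) b par_pos_rootsD(2) by simp
      moreover have "0 \<le> (\<mu> + y x) \<bullet> y \<beta> \<and> (\<mu> + y x) \<bullet> y \<beta> \<le> 1"
        using x 1 unfolding par_alcove_def by blast
      ultimately show ?thesis by (simp add: inner_add_left in_eq)
    next
      case 2
      have "fun_inv y (- y \<beta>) = - \<beta>" using a(3) by (simp add: fin_weyl_uminus fin_weyl_inv)
      then have "\<mu> \<bullet> (- y \<beta>) = 1" using a(4)[OF 2] b par_pos_rootsD(2) pos_not_neg by auto
      moreover have "0 \<le> (\<mu> + y x) \<bullet> (- y \<beta>) \<and> (\<mu> + y x) \<bullet> (- y \<beta>) \<le> 1"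
        using x 2 unfolding par_alcove_def by blast
      ultimately show ?thesis by (simp add: inner_add_left in_eq)
    qed
  qed
qed

lemma aligned_ext: "aligned J \<mu> y \<Longrightarrow> transl \<mu> \<circ> y \<in> ext_weyl D"
  using alignedD[OF J] ext_weylI by blast

lemma aligned_comp_par_ext:
  assumes "aligned J \<mu> y" "w \<in> ext_weyl D"
  shows "transl \<mu> \<circ> y \<circ> w \<in> par_ext_weyl D J \<longleftrightarrow> w \<in> par_ext_weyl D J"
  using assms ext_weyl_comp[OF aligned_ext[OF assms(1)] assms(2)] aligned_alcove_iff[OF assms(1)]
  by (auto simp: par_ext_weyl_def image_subset_iff transl_def)

lemma min_reps_par_ext:
  assumes "u \<in> min_reps D J" shows "u \<in> par_ext_weyl D J"
proof -
  have u: "u \<in> fin_weyl D" using min_reps_fin[OF J assms] .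
  have "u x \<in> par_alcove D J" if "x \<in> alcove0 D" for x
    using min_reps_pos[OF J assms] that fin_weyl_inner[OF u]
    by (simp add: par_alcove_def alcove0_def)
  then show ?thesis using u fin_weyl_ext by (auto simp: par_ext_weyl_def)
qed

lemma par_ext_weyl_ext: "w \<in> par_ext_weyl D J \<Longrightarrow> w \<in> ext_weyl D"
  by (simp add: par_ext_weyl_def)

text \<open>
  Both \<open>w A\<^sub>0\<close> and \<open>u A\<^sub>0\<close> lie in \<open>\<A>\<^sub>J\<close>, and evaluating a positive root of \<open>\<Phi>\<^sub>J\<close> at an interior point of either
  gives a value strictly between 0 and 1; this pins down the integers \<open>\<langle>wt w, \<beta>\<rangle>\<close>.
\<close>

lemma par_ext_aligned:
  assumes "w \<in> par_ext_weyl D J" "y \<in> par_weyl D J" "u \<in> min_reps D J" "lin w = y \<circ> u"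
  shows "aligned J (wt w) y"
proof -
  have w: "w \<in> ext_weyl D" using assms par_ext_weyl_ext by blast
  have f: "y \<in> fin_weyl D" "u \<in> fin_weyl D" using assms par_weyl_fin[OF J] min_reps_fin[OF J] by auto
  obtain p where p: "interior_point p" using alcove_interior by blast
  then have wp: "w p \<in> par_alcove D J"
    using assms(1) alcove_interior_mem by (auto simp: par_ext_weyl_def)
  have "wt w \<bullet> \<beta> = (if fun_inv y \<beta> \<in> pos_roots D then 0 else 1)" if b: "\<beta> \<in> par_pos_roots D J" for \<beta>
  proof -
    have "wt w \<bullet> \<beta> \<in> \<int>" using coweights_root_int[OF ext_weyl_wt[OF w]] b par_pos_rootsD par_roots_root by blast
    then obtain m where m: "wt w \<bullet> \<beta> = of_int m" by (auto elim: Ints_cases)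
    have wp\<beta>: "0 \<le> of_int m + p \<bullet> fun_inv u (fun_inv y \<beta>)" "of_int m + p \<bullet> fun_inv u (fun_inv y \<beta>) \<le> 1"
      using wp b f by (auto simp: par_alcove_def ext_weyl_apply[OF w] inner_add_left assms(4) fin_weyl_inner m)
    have "fun_inv y \<beta> \<in> par_roots D J"
      using par_weyl_par_roots[OF J par_weyl_inv[OF J assms(2)]] b par_pos_rootsD by blast
    then show ?thesis
    proof (cases rule: par_roots_cases)
      case 1
      then have "fun_inv u (fun_inv y \<beta>) \<in> pos_roots D" using min_reps_pos[OF J assms(3)] by blast
      then have "0 < p \<bullet> fun_inv u (fun_inv y \<beta>)" "p \<bullet> fun_inv u (fun_inv y \<beta>) < 1"
        using p by (auto simp: interior_point_def)
      then have "real_of_int m < 1" "-1 < real_of_int m" using wp\<beta> by linarith+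
      then have "m = 0" by linarith
      then show ?thesis using m par_pos_rootsD(2)[OF 1] by simp
    next
      case 2
      then have "fun_inv u (- fun_inv y \<beta>) \<in> pos_roots D" using min_reps_pos[OF J assms(3)] by blast
      then have "0 < p \<bullet> fun_inv u (- fun_inv y \<beta>)" "p \<bullet> fun_inv u (- fun_inv y \<beta>) < 1"
        using p unfolding interior_point_def by blast+
      then have "p \<bullet> fun_inv u (fun_inv y \<beta>) < 0" "- 1 < p \<bullet> fun_inv u (fun_inv y \<beta>)"
        using fin_weyl_uminus[OF fin_weyl_inv[OF f(2)]] by auto
      then have "real_of_int m < 2" "0 < real_of_int m" using wp\<beta> by linarith+
      then have "m = 1" by linarith
      then show ?thesis using m par_pos_rootsD(2)[OF 2] pos_not_neg by auto
    qed
  qed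
  then show ?thesis using ext_weyl_wt[OF w] assms(2) by (simp add: aligned_def[OF J])
qed

lemma par_ext_decomposition:
  assumes "w \<in> par_ext_weyl D J"
  obtains y u where "aligned J (wt w) y" "u \<in> min_reps D J" "w = transl (wt w) \<circ> y \<circ> u"
    "lin w = y \<circ> u" "lin_par D J w = y" "lin_min D J w = u"
proof -
  have w: "w \<in> ext_weyl D" using assms par_ext_weyl_ext by blast
  obtain y u where yu: "y \<in> par_weyl D J" "u \<in> min_reps D J" "lin w = y \<circ> u"
    using coset_decomposition[OF J ext_weyl_lin[OF w]] .
  moreover have "w = transl (wt w) \<circ> y \<circ> u" using ext_weyl_eq[OF w] yu(3) by (simp add: comp_assoc)
  ultimately show ?thesis
    using that par_ext_aligned[OF assms yu] lin_par_min_eqI[OF J yu] by blast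
qed

text \<open>
  The product again preserves \<open>\<A>\<^sub>J\<close>, so \<open>par_ext_aligned\<close> applies to it with the trivial minimal
  representative.
\<close>

lemma aligned_comp:
  assumes "aligned J \<mu> y" "aligned J \<nu> z"
  shows "aligned J (\<mu> + y \<nu>) (y \<circ> z)"
proof -
  have id: "id \<in> min_reps D J"
  proof -
    have "inv_roots D id = {}" unfolding inv_roots_eq[OF par_weyl_id] by (auto simp: ind_pos_roots_def)
    then show ?thesis using fin_weyl_len[OF par_weyl_id] by (simp add: min_reps_def par_weyl_id)
  qed
  let ?w = "transl \<mu> \<circ> y \<circ> (transl \<nu> \<circ> z)"
  note a = alignedD[OF J assms(1)] and b = alignedD[OF J assms(2)]
  have "transl \<nu> \<circ> z \<circ> id \<in> par_ext_weyl D J"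
    using aligned_comp_par_ext[OF assms(2) fin_weyl_ext[OF par_weyl_id]] min_reps_par_ext[OF id] by blast
  then have w: "?w \<in> par_ext_weyl D J"
    using aligned_comp_par_ext[OF assms(1) aligned_ext[OF assms(2)]] by simp
  have "wt ?w = \<mu> + y \<nu>" "lin ?w = y \<circ> z"
    using a b aligned_ext[OF assms(1)] by (simp_all add: wt_comp lin_comp)
  then show ?thesis
    using par_ext_aligned[OF w par_weyl_comp[OF a(2) b(2)] id] by simp
qed

end

end

section \<open>The coefficient rings\<close>

lemma sum_closed_subset:
  assumes "(0::'c::comm_monoid_add) \<in> A" "\<And>x y. x \<in> A \<Longrightarrow> y \<in> A \<Longrightarrow> x + y \<in> A" "\<And>i. i \<in> S \<Longrightarrow> f i \<in> A"
  shows "sum f S \<in> A"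
  using assms(3) by (induction S rule: infinite_finite_induct) (auto simp: assms(1,2))

lemma laurent_ring_cring:
  fixes A :: "'c::comm_ring_1 set"
  assumes A0: "0 \<in> A" and A1: "1 \<in> A" and Aadd: "\<And>x y. x \<in> A \<Longrightarrow> y \<in> A \<Longrightarrow> x + y \<in> A"
    and Amult: "\<And>x y. x \<in> A \<Longrightarrow> y \<in> A \<Longrightarrow> x * y \<in> A" and Aneg: "\<And>x. x \<in> A \<Longrightarrow> - x \<in> A"
  shows "cring (laurent_ring S A)"
proof -
  let ?R = "laurent_ring S A"
  define C where "C = {p :: monomial \<Rightarrow>\<^sub>0 'c. (\<forall>e\<in>Poly_Mapping.keys p. Poly_Mapping.keys e \<subseteq> S) \<and>
                    (\<forall>e. Poly_Mapping.lookup p e \<in> A)}"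
  have C: "carrier ?R = C" "x \<otimes>\<^bsub>?R\<^esub> y = x * y" "x \<oplus>\<^bsub>?R\<^esub> y = x + y" "\<one>\<^bsub>?R\<^esub> = 1" "\<zero>\<^bsub>?R\<^esub> = 0" for x y
    by (auto simp: laurent_ring_def C_def)
  have C0: "0 \<in> C" using A0 by (simp add: C_def)
  have C1: "1 \<in> C" using A0 A1 by (simp add: C_def lookup_one when_def)
  have Cadd: "x + y \<in> C" if "x \<in> C" "y \<in> C" for x y
    using that Poly_Mapping.keys_add[of x y] Aadd by (fastforce simp: C_def lookup_add)
  have Cneg: "- x \<in> C" if "x \<in> C" for x
    using that Aneg by (auto simp: C_def)
  have Cmult: "x * y \<in> C" if "x \<in> C" "y \<in> C" for x y
  proof -
    have "Poly_Mapping.keys e \<subseteq> S" if e: "e \<in> Poly_Mapping.keys (x * y)" for e :: monomial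
    proof -
      obtain a b where "e = a + b" "a \<in> Poly_Mapping.keys x" "b \<in> Poly_Mapping.keys y"
        using e keys_mult[of x y] by auto
      moreover have "Poly_Mapping.keys a \<subseteq> S" "Poly_Mapping.keys b \<subseteq> S"
        using calculation \<open>x \<in> C\<close> \<open>y \<in> C\<close> by (simp_all add: C_def)
      ultimately show ?thesis using Poly_Mapping.keys_add[of a b] by blast
    qed
    moreover have "Poly_Mapping.lookup (x * y) e \<in> A" for e
      unfolding lookup_mult Sum_any.expand_set using that
      by (auto simp: C_def when_def intro!: sum_closed_subset Amult A0 Aadd)
    ultimately show ?thesis by (simp add: C_def)
  qed
  show ?thesis
  proof (rule cringI)
    show "abelian_group ?R"
    proof (rule abelian_groupI)
      show "\<exists>y\<in>carrier ?R. y \<oplus>\<^bsub>?R\<^esub> x = \<zero>\<^bsub>?R\<^esub>" if "x \<in> carrier ?R" for x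
        using that Cneg[of x] by (intro bexI[of _ "- x"]) (simp_all add: C)
    qed (simp_all add: C C0 Cadd add.assoc add.commute)
    show "Group.comm_monoid ?R"
      by (rule comm_monoidI) (auto simp: C C1 Cmult mult.assoc mult.commute)
  qed (auto simp: C algebra_simps)
qed

lemma qring_cring: "cring (qring D)"
  unfolding qring_def by (rule laurent_ring_cring) auto

lemma zring_cring: "cring (zring D)"
proof -
  interpret Q: cring "qring D" by (rule qring_cring)
  have o: "x \<oplus>\<^bsub>qring D\<^esub> y = x + y" "x \<otimes>\<^bsub>qring D\<^esub> y = x * y" "\<one>\<^bsub>qring D\<^esub> = 1" "\<zero>\<^bsub>qring D\<^esub> = 0" for x y
    by (auto simp: qring_def laurent_ring_def)
  have "- x \<in> carrier (qring D)" if x: "x \<in> carrier (qring D)" for x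
  proof -
    have "\<ominus>\<^bsub>qring D\<^esub> x + x = 0" using Q.l_neg[OF x] o by simp
    then have "\<ominus>\<^bsub>qring D\<^esub> x = - x" by (simp add: eq_neg_iff_add_eq_0)
    then show ?thesis using Q.a_inv_closed[OF x] by simp
  qed
  then show ?thesis unfolding zring_def
    using Q.zero_closed Q.one_closed Q.a_closed Q.m_closed by (intro laurent_ring_cring) (simp_all add: o)
qed

lemma qpar_Units: "i \<in> aff_idx D \<Longrightarrow> qpar D i \<in> Units (qring D)"
proof -
  assume i: "i \<in> aff_idx D"
  let ?m = "\<lambda>k::int. Poly_Mapping.single (Poly_Mapping.single (qvar D i) k) 1 :: qpoly"
  have "qvar D i \<in> qvar D ` aff_idx D" using i by (rule imageI)
  then have c: "?m k \<in> carrier (qring D)" for k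
    by (simp add: qring_def laurent_ring_def)
  have "?m 1 * ?m (-1) = 1" "?m (-1) * ?m 1 = 1"
    by (simp_all add: mult_single flip: single_add)
  then have "?m 1 \<otimes>\<^bsub>qring D\<^esub> ?m (-1) = \<one>\<^bsub>qring D\<^esub>" "?m (-1) \<otimes>\<^bsub>qring D\<^esub> ?m 1 = \<one>\<^bsub>qring D\<^esub>"
    by (simp_all only: qring_def laurent_ring_def monoid.simps)
  then show ?thesis unfolding Units_def qpar_def using c by blast
qed

lemma qdiff_closed: "i \<in> aff_idx D \<Longrightarrow> qdiff D i \<in> carrier (qring D)"
proof -
  interpret Q: cring "qring D" by (rule qring_cring)
  assume "i \<in> aff_idx D"
  then show ?thesis unfolding qdiff_def using qpar_Units[of i D] by (auto intro: Q.minus_closed)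
qed

lemma zmon_closed: "zmon D \<mu> \<in> carrier (zring D)"
proof -
  interpret Q: cring "qring D" by (rule qring_cring)
  have "1 \<in> carrier (qring D)" "0 \<in> carrier (qring D)"
    using Q.one_closed Q.zero_closed by (simp_all add: qring_def laurent_ring_def)
  moreover have "Poly_Mapping.keys (\<Sum>i\<in>S. Poly_Mapping.single i (f i) :: monomial) \<subseteq> S"
    if "finite S" for S and f :: "nat \<Rightarrow> int"
    using that
  proof induction
    case (insert x F)
    show ?case
      using insert Poly_Mapping.keys_add[of "Poly_Mapping.single x (f x)" "\<Sum>i\<in>F. Poly_Mapping.single i (f i)"]
      by (auto split: if_splits)
  qed simp
  ultimately show ?thesis unfolding zmon_def zring_def
    by (auto simp: laurent_ring_def lookup_single when_def split: if_splits intro: set_mp)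
qed

context irreducible_root_datum
begin

lemma zmon_add:
  assumes "\<mu> \<in> coweights D" "\<nu> \<in> coweights D"
  shows "zmon D (\<mu> + \<nu>) = zmon D \<mu> * zmon D \<nu>"
proof -
  have "\<lfloor>(\<mu> + \<nu>) \<bullet> sroot D i\<rfloor> = \<lfloor>\<mu> \<bullet> sroot D i\<rfloor> + \<lfloor>\<nu> \<bullet> sroot D i\<rfloor>" if "i \<in> fin_idx D" for i
    using assms that by (auto simp: coweights_iff inner_add_left elim!: Ints_cases dest!: bspec)
  then have "(\<Sum>i\<in>fin_idx D. Poly_Mapping.single i \<lfloor>(\<mu> + \<nu>) \<bullet> sroot D i\<rfloor>)
    = (\<Sum>i\<in>fin_idx D. Poly_Mapping.single i \<lfloor>\<mu> \<bullet> sroot D i\<rfloor> + Poly_Mapping.single i \<lfloor>\<nu> \<bullet> sroot D i\<rfloor>)"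
    by (intro sum.cong) (simp_all add: single_add)
  then show ?thesis by (simp add: zmon_def mult_single sum.distrib)
qed

lemma zmon_0: "zmon D 0 = 1"
  by (simp add: zmon_def)

context
  fixes J :: "nat set" assumes J: "J \<subseteq> fin_idx D"
begin

lemma zideal_ideal: "ideal (zideal D J) (zring D)"
proof -
  interpret Z: cring "zring D" by (rule zring_cring)
  show ?thesis unfolding zideal_def
    by (rule Z.genideal_ideal) (auto intro!: Z.minus_closed zmon_closed)
qed

lemma zringJ_cring: "cring (zringJ D J)"
  unfolding zringJ_def using ideal.quotient_is_cring[OF zideal_ideal zring_cring] .

lemma quotient_hom: "(+>\<^bsub>zring D\<^esub>) (zideal D J) \<in> ring_hom (zring D) (zringJ D J)"
  unfolding zringJ_def by (rule ideal.rcos_ring_hom[OF zideal_ideal])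

lemma const_closed: "r \<in> carrier (qring D) \<Longrightarrow> Poly_Mapping.single 0 r \<in> carrier (zring D)"
proof -
  interpret Q: cring "qring D" by (rule qring_cring)
  have "0 \<in> carrier (qring D)" using Q.zero_closed by (simp add: qring_def laurent_ring_def)
  moreover assume "r \<in> carrier (qring D)"
  ultimately show ?thesis by (auto simp: zring_def laurent_ring_def lookup_single when_def)
qed

lemma embJ_closed: "r \<in> carrier (qring D) \<Longrightarrow> embJ D J r \<in> carrier (zringJ D J)"
  unfolding embJ_def using ring_hom_closed[OF quotient_hom] const_closed by blast

lemma embJ_mult:
  assumes "r \<in> carrier (qring D)" "s \<in> carrier (qring D)"
  shows "embJ D J (r \<otimes>\<^bsub>qring D\<^esub> s) = embJ D J r \<otimes>\<^bsub>zringJ D J\<^esub> embJ D J s"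
proof -
  have "Poly_Mapping.single 0 (r \<otimes>\<^bsub>qring D\<^esub> s)
      = Poly_Mapping.single 0 r \<otimes>\<^bsub>zring D\<^esub> (Poly_Mapping.single 0 s :: zpoly)"
    by (simp add: qring_def zring_def laurent_ring_def mult_single)
  then show ?thesis unfolding embJ_def using ring_hom_mult[OF quotient_hom] const_closed assms by metis
qed

lemma embJ_one: "embJ D J \<one>\<^bsub>qring D\<^esub> = \<one>\<^bsub>zringJ D J\<^esub>"
proof -
  have "Poly_Mapping.single 0 \<one>\<^bsub>qring D\<^esub> = \<one>\<^bsub>zring D\<^esub>" by (simp add: qring_def zring_def laurent_ring_def)
  then show ?thesis unfolding embJ_def using ring_hom_one[OF quotient_hom] by simp
qed

lemma zmonJ_closed: "zmonJ D J \<mu> \<in> carrier (zringJ D J)"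
  unfolding zmonJ_def using ring_hom_closed[OF quotient_hom] zmon_closed by blast

lemma zmonJ_add:
  assumes "\<mu> \<in> coweights D" "\<nu> \<in> coweights D"
  shows "zmonJ D J (\<mu> + \<nu>) = zmonJ D J \<mu> \<otimes>\<^bsub>zringJ D J\<^esub> zmonJ D J \<nu>"
proof -
  have "zmon D (\<mu> + \<nu>) = zmon D \<mu> \<otimes>\<^bsub>zring D\<^esub> zmon D \<nu>"
    using zmon_add[OF assms] by (simp add: zring_def laurent_ring_def)
  then show ?thesis unfolding zmonJ_def using ring_hom_mult[OF quotient_hom] zmon_closed by metis
qed

lemma zmonJ_0: "zmonJ D J 0 = \<one>\<^bsub>zringJ D J\<^esub>"
proof -
  have "zmon D 0 = \<one>\<^bsub>zring D\<^esub>" by (simp add: zmon_0 zring_def laurent_ring_def)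
  then show ?thesis unfolding zmonJ_def using ring_hom_one[OF quotient_hom] by simp
qed

lemma zmonJ_coroot_lattice:
  assumes "\<gamma> \<in> par_coroot_lattice D J" shows "zmonJ D J \<gamma> = \<one>\<^bsub>zringJ D J\<^esub>"
proof -
  interpret Z: cring "zring D" by (rule zring_cring)
  have "zmon D \<gamma> \<ominus>\<^bsub>zring D\<^esub> \<one>\<^bsub>zring D\<^esub> \<in> zideal D J"
    unfolding zideal_def by (rule Z.genideal_self[THEN subsetD]) (use assms in \<open>auto intro!: Z.minus_closed zmon_closed\<close>)
  then have "zideal D J +>\<^bsub>zring D\<^esub> zmon D \<gamma> = zideal D J +>\<^bsub>zring D\<^esub> \<one>\<^bsub>zring D\<^esub>"
    using Z.quotient_eq_iff_same_a_r_cos[OF zideal_ideal zmon_closed Z.one_closed] by simp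
  then show ?thesis unfolding zmonJ_def using ring_hom_one[OF quotient_hom] by simp
qed

lemma zmonJ_Units:
  assumes "\<mu> \<in> coweights D" shows "zmonJ D J \<mu> \<in> Units (zringJ D J)"
proof -
  have n: "- \<mu> \<in> coweights D" using assms by (simp add: coweights_iff)
  have "zmonJ D J (- \<mu>) \<otimes>\<^bsub>zringJ D J\<^esub> zmonJ D J \<mu> = \<one>\<^bsub>zringJ D J\<^esub>"
    "zmonJ D J \<mu> \<otimes>\<^bsub>zringJ D J\<^esub> zmonJ D J (- \<mu>) = \<one>\<^bsub>zringJ D J\<^esub>"
    using zmonJ_add[OF n assms] zmonJ_add[OF assms n] by (simp_all add: zmonJ_0)
  then show ?thesis unfolding Units_def using zmonJ_closed by blast
qed

text \<open>\<open>W\<^sub>J\<close> moves a coweight by an element of \<open>Q\<^sub>J\<close>.\<close>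

lemma zmonJ_par_weyl:
  assumes "y \<in> par_weyl D J" "\<mu> \<in> coweights D"
  shows "zmonJ D J (y \<mu>) = zmonJ D J \<mu>"
  using assms(1)
proof (induction rule: par_weyl_induct)
  case (step j x)
  interpret Z: cring "zringJ D J" by (rule zringJ_cring)
  have j: "j \<in> fin_idx D" using J step by auto
  have x: "x \<mu> \<in> coweights D" using fin_weyl_coweight[OF par_weyl_fin[OF J step(2)] assms(2)] .
  obtain n where n: "x \<mu> \<bullet> sroot D j = of_int n" using x j by (auto simp: coweights_iff elim: Ints_cases)
  let ?q = "of_int (- n) *\<^sub>R coroot (sroot D j)"
  have "sroot D j \<in> par_roots D J" using sroot_par_pos[OF J step(1)] par_pos_rootsD by blast
  moreover have "finite (par_roots D J)" using finite_roots by (simp add: par_roots_def)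
  ultimately have "?q = (\<Sum>\<beta>\<in>par_roots D J. if \<beta> = sroot D j then of_int (- n) *\<^sub>R coroot \<beta> else 0)"
    by simp
  also have "\<dots> = (\<Sum>\<beta>\<in>par_roots D J. of_int (if \<beta> = sroot D j then - n else 0) *\<^sub>R coroot \<beta>)"
    by (rule sum.cong) auto
  finally have "?q = \<dots>" .
  then have q: "?q \<in> par_coroot_lattice D J" unfolding par_coroot_lattice_def
    by (intro CollectI exI[of _ "\<lambda>\<beta>. if \<beta> = sroot D j then - n else 0"])
  have "coroot (sroot D j) \<bullet> \<beta> \<in> \<int>" if "\<beta> \<in> roots D" for \<beta>
    using coroot_int[OF sroot_root[OF j] that] by (simp add: inner_commute)
  then have qc: "?q \<in> coweights D" by (intro coweightsI) (simp del: of_int_minus)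
  have "sgen D j (x \<mu>) = x \<mu> + ?q"
    using n j by (simp add: sgen_refl aff_refl_def)
  then show ?case
    using zmonJ_add[OF x qc] zmonJ_coroot_lattice[OF q] step(3) zmonJ_closed by simp
qed simp

end

end

section \<open>Bases of modules\<close>

lemma expansionI:
  assumes M: "module R M" and b: "b ` B \<subseteq> carrier M" and A: "finite A" "A \<subseteq> B"
    and c: "c \<in> B \<rightarrow>\<^sub>E carrier R" "\<And>i. i \<in> B - A \<Longrightarrow> c i = \<zero>\<^bsub>R\<^esub>"
    and x: "x = (\<Oplus>\<^bsub>M\<^esub>i\<in>A. c i \<odot>\<^bsub>M\<^esub> b i)"
  shows "expansion R M B b x c"
proof -
  interpret module R M by (rule M)
  have s: "{i\<in>B. c i \<noteq> \<zero>\<^bsub>R\<^esub>} \<subseteq> A" using c(2) by auto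
  have bc: "b i \<in> carrier M" "c i \<in> carrier R" if "i \<in> B" for i using b c(1) that by auto
  have "(\<Oplus>\<^bsub>M\<^esub>i\<in>A. c i \<odot>\<^bsub>M\<^esub> b i) = (\<Oplus>\<^bsub>M\<^esub>i\<in>{i\<in>B. c i \<noteq> \<zero>\<^bsub>R\<^esub>}. c i \<odot>\<^bsub>M\<^esub> b i)"
    by (rule M.add.finprod_mono_neutral_cong_right[OF A(1) s]) (use A(2) bc in \<open>auto simp: smult_l_null\<close>)
  then show ?thesis unfolding expansion_def using c(1) s A(1) x finite_subset by blast
qed

lemma module_basis_rescale:
  assumes M: "module R M" and basis: "module_basis R M B b" and f: "bij_betw f F B"
    and z: "\<And>u. u \<in> F \<Longrightarrow> z u \<in> Units R"
    and b': "\<And>u. u \<in> F \<Longrightarrow> b' u = z u \<odot>\<^bsub>M\<^esub> b (f u)"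
  shows "module_basis R M F b'"
proof -
  interpret module R M by (rule M)
  let ?g = "inv_into F f"
  have g: "\<And>u. u \<in> F \<Longrightarrow> f u \<in> B" "\<And>u. u \<in> F \<Longrightarrow> ?g (f u) = u"
    "\<And>i. i \<in> B \<Longrightarrow> ?g i \<in> F" "\<And>i. i \<in> B \<Longrightarrow> f (?g i) = i"
    using f by (auto simp: bij_betw_def inv_into_into f_inv_into_f)
  have zc: "\<And>u. u \<in> F \<Longrightarrow> z u \<in> carrier R" using z by (auto simp: Units_def)
  have bM: "b ` B \<subseteq> carrier M" using basis by (simp add: module_basis_def)
  then have bc: "b i \<in> carrier M" if "i \<in> B" for i using that by auto
  have b'M: "b' ` F \<subseteq> carrier M" using b' zc bc g(1) by (auto intro: smult_closed)
  have inj: "inj_on f F" using f by (simp add: bij_betw_def)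
  have to_b: "expansion R M B b x (\<lambda>i\<in>B. c (?g i) \<otimes>\<^bsub>R\<^esub> z (?g i))" if e: "expansion R M F b' x c" for x c
  proof (rule expansionI[OF M bM])
    let ?A = "{u\<in>F. c u \<noteq> \<zero>\<^bsub>R\<^esub>}"
    have c: "c \<in> F \<rightarrow>\<^sub>E carrier R" "finite ?A" "x = (\<Oplus>\<^bsub>M\<^esub>u\<in>?A. c u \<odot>\<^bsub>M\<^esub> b' u)"
      using e by (auto simp: expansion_def)
    have cc: "c u \<in> carrier R" if "u \<in> F" for u using c(1) that by auto
    show "finite (f ` ?A)" "f ` ?A \<subseteq> B" using c(2) g(1) by auto
    show "(\<lambda>i\<in>B. c (?g i) \<otimes>\<^bsub>R\<^esub> z (?g i)) \<in> B \<rightarrow>\<^sub>E carrier R" using cc zc g by auto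
    show "(\<lambda>i\<in>B. c (?g i) \<otimes>\<^bsub>R\<^esub> z (?g i)) i = \<zero>\<^bsub>R\<^esub>" if "i \<in> B - f ` ?A" for i
    proof -
      have "?g i \<in> F" "i \<in> B" "c (?g i) = \<zero>\<^bsub>R\<^esub>" using that g(3)[of i] g(4)[of i] by force+
      then show ?thesis using zc by simp
    qed
    have "(\<Oplus>\<^bsub>M\<^esub>i\<in>f ` ?A. (\<lambda>i\<in>B. c (?g i) \<otimes>\<^bsub>R\<^esub> z (?g i)) i \<odot>\<^bsub>M\<^esub> b i)
        = (\<Oplus>\<^bsub>M\<^esub>u\<in>?A. (\<lambda>i\<in>B. c (?g i) \<otimes>\<^bsub>R\<^esub> z (?g i)) (f u) \<odot>\<^bsub>M\<^esub> b (f u))"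
      by (rule M.finsum_reindex) (use inj g cc zc bc in \<open>auto simp: inj_on_def intro!: smult_closed\<close>)
    also have "\<dots> = (\<Oplus>\<^bsub>M\<^esub>u\<in>?A. c u \<odot>\<^bsub>M\<^esub> b' u)"
      by (rule M.add.finprod_cong') (use g cc zc bc b' in \<open>auto simp: smult_assoc1 intro!: smult_closed\<close>)
    finally show "x = (\<Oplus>\<^bsub>M\<^esub>i\<in>f ` ?A. (\<lambda>i\<in>B. c (?g i) \<otimes>\<^bsub>R\<^esub> z (?g i)) i \<odot>\<^bsub>M\<^esub> b i)" using c(3) by simp
  qed
  have from_b: "expansion R M F b' x (\<lambda>u\<in>F. d (f u) \<otimes>\<^bsub>R\<^esub> inv\<^bsub>R\<^esub> (z u))" if e: "expansion R M B b x d" for x d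
  proof (rule expansionI[OF M b'M])
    let ?A = "{i\<in>B. d i \<noteq> \<zero>\<^bsub>R\<^esub>}"
    have d: "d \<in> B \<rightarrow>\<^sub>E carrier R" "finite ?A" "x = (\<Oplus>\<^bsub>M\<^esub>i\<in>?A. d i \<odot>\<^bsub>M\<^esub> b i)"
      using e by (auto simp: expansion_def)
    have dc: "d i \<in> carrier R" if "i \<in> B" for i using d(1) that by auto
    have iz: "inv\<^bsub>R\<^esub> (z u) \<in> carrier R" "inv\<^bsub>R\<^esub> (z u) \<otimes>\<^bsub>R\<^esub> z u = \<one>\<^bsub>R\<^esub>" if "u \<in> F" for u using z[OF that] by simp_all
    show "finite (?g ` ?A)" "?g ` ?A \<subseteq> F" using d(2) g(3) by auto
    show "(\<lambda>u\<in>F. d (f u) \<otimes>\<^bsub>R\<^esub> inv\<^bsub>R\<^esub> (z u)) \<in> F \<rightarrow>\<^sub>E carrier R" using dc iz g by auto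
    show "(\<lambda>u\<in>F. d (f u) \<otimes>\<^bsub>R\<^esub> inv\<^bsub>R\<^esub> (z u)) u = \<zero>\<^bsub>R\<^esub>" if "u \<in> F - ?g ` ?A" for u
    proof -
      have "u \<in> F" "d (f u) = \<zero>\<^bsub>R\<^esub>" using that g(1)[of u] g(2)[of u] by force+
      then show ?thesis using iz by simp
    qed
    have step: "(\<lambda>u\<in>F. d (f u) \<otimes>\<^bsub>R\<^esub> inv\<^bsub>R\<^esub> (z u)) (?g i) \<odot>\<^bsub>M\<^esub> b' (?g i) = d i \<odot>\<^bsub>M\<^esub> b i" if i: "i \<in> B" for i
    proof -
      note gi = g(3)[OF i] g(4)[OF i]
      have "(d i \<otimes>\<^bsub>R\<^esub> inv\<^bsub>R\<^esub> (z (?g i))) \<otimes>\<^bsub>R\<^esub> z (?g i) = d i"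
        using dc[OF i] iz[OF gi(1)] zc[OF gi(1)] by (simp add: m_assoc)
      then show ?thesis using gi dc[OF i] iz[OF gi(1)] zc[OF gi(1)] bc[OF i]
        by (simp add: b'[OF gi(1)] smult_assoc1[symmetric])
    qed
    have "(\<Oplus>\<^bsub>M\<^esub>u\<in>?g ` ?A. (\<lambda>u\<in>F. d (f u) \<otimes>\<^bsub>R\<^esub> inv\<^bsub>R\<^esub> (z u)) u \<odot>\<^bsub>M\<^esub> b' u)
        = (\<Oplus>\<^bsub>M\<^esub>i\<in>?A. (\<lambda>u\<in>F. d (f u) \<otimes>\<^bsub>R\<^esub> inv\<^bsub>R\<^esub> (z u)) (?g i) \<odot>\<^bsub>M\<^esub> b' (?g i))"
    proof (rule M.finsum_reindex)
      show "inj_on ?g ?A" by (rule inj_on_inverseI[of _ f]) (simp add: g(4))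
      show "(\<lambda>u. (\<lambda>u\<in>F. d (f u) \<otimes>\<^bsub>R\<^esub> inv\<^bsub>R\<^esub> (z u)) u \<odot>\<^bsub>M\<^esub> b' u) \<in> ?g ` ?A \<rightarrow> carrier M"
      proof
        fix u assume "u \<in> ?g ` ?A"
        then obtain i where "i \<in> B" "u = ?g i" by blast
        then show "(\<lambda>u\<in>F. d (f u) \<otimes>\<^bsub>R\<^esub> inv\<^bsub>R\<^esub> (z u)) u \<odot>\<^bsub>M\<^esub> b' u \<in> carrier M"
          using step[of i] dc[of i] bc[of i] smult_closed by simp
      qed
    qed
    also have "\<dots> = (\<Oplus>\<^bsub>M\<^esub>i\<in>?A. d i \<odot>\<^bsub>M\<^esub> b i)"
      by (rule M.add.finprod_cong') (use step dc bc in \<open>auto intro!: smult_closed\<close>)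
    finally show "x = (\<Oplus>\<^bsub>M\<^esub>u\<in>?g ` ?A. (\<lambda>u\<in>F. d (f u) \<otimes>\<^bsub>R\<^esub> inv\<^bsub>R\<^esub> (z u)) u \<odot>\<^bsub>M\<^esub> b' u)" using d(3) by simp
  qed
  have "\<exists>!c. expansion R M F b' x c" if x: "x \<in> carrier M" for x
  proof -
    have ex1: "\<exists>!d. expansion R M B b x d" using basis x by (simp add: module_basis_def)
    then obtain d where "expansion R M B b x d" by blast
    then have ex: "\<exists>c. expansion R M F b' x c" using from_b by blast
    moreover have "c = c'" if e: "expansion R M F b' x c" "expansion R M F b' x c'" for c c'
    proof (rule extensionalityI)
      show "c \<in> extensional F" "c' \<in> extensional F" using e by (auto simp: expansion_def PiE_def)
      fix u assume u: "u \<in> F"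
      have "(\<lambda>i\<in>B. c (?g i) \<otimes>\<^bsub>R\<^esub> z (?g i)) = (\<lambda>i\<in>B. c' (?g i) \<otimes>\<^bsub>R\<^esub> z (?g i))"
        using to_b e ex1 by blast
      from fun_cong[OF this, of "f u"] have "c u \<otimes>\<^bsub>R\<^esub> z u = c' u \<otimes>\<^bsub>R\<^esub> z u" using u g by simp
      moreover have "c u \<in> carrier R" "c' u \<in> carrier R" using e u by (auto simp: expansion_def)
      ultimately show "c u = c' u" using z[OF u] zc[OF u] by (metis Units_l_cancel m_comm)
    qed
    ultimately show ?thesis by blast
  qed
  then show ?thesis using b'M by (simp add: module_basis_def)
qed

text \<open>
  Several summands may belong to one basis vector, as the paths whose ends have the same
  representative do; their coefficients add up to one coordinate.
\<close>

lemma expansion_grouped: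
  assumes M: "module R M" and b: "b ` F \<subseteq> carrier M" and P: "finite P"
    and r: "\<And>p. p \<in> P \<Longrightarrow> r p \<in> F" and g: "\<And>p. p \<in> P \<Longrightarrow> g p \<in> carrier R"
    and x: "x = (\<Oplus>\<^bsub>M\<^esub>p\<in>P. g p \<odot>\<^bsub>M\<^esub> b (r p))"
  shows "expansion R M F b x (\<lambda>u\<in>F. \<Oplus>\<^bsub>R\<^esub>p\<in>{p\<in>P. r p = u}. g p)"
proof (rule expansionI[OF M b])
  interpret module R M by (rule M)
  have bc: "b i \<in> carrier M" if "i \<in> F" for i using b that by auto
  show "finite (r ` P)" "r ` P \<subseteq> F" using P r by auto
  show "(\<lambda>u\<in>F. \<Oplus>\<^bsub>R\<^esub>p\<in>{p\<in>P. r p = u}. g p) \<in> F \<rightarrow>\<^sub>E carrier R"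
    using g by (auto intro!: R.finsum_closed)
  show "(\<lambda>u\<in>F. \<Oplus>\<^bsub>R\<^esub>p\<in>{p\<in>P. r p = u}. g p) u = \<zero>\<^bsub>R\<^esub>" if "u \<in> F - r ` P" for u
  proof -
    have e: "{p\<in>P. r p = u} = {}" using that by auto
    have "(\<Oplus>\<^bsub>R\<^esub>p\<in>{p\<in>P. r p = u}. g p) = \<zero>\<^bsub>R\<^esub>" unfolding e by simp
    then show ?thesis using that by simp
  qed
  have "(\<Oplus>\<^bsub>M\<^esub>u\<in>A. (\<Oplus>\<^bsub>R\<^esub>p\<in>{p\<in>P'. r p = u}. g p) \<odot>\<^bsub>M\<^esub> b u) = (\<Oplus>\<^bsub>M\<^esub>p\<in>P'. g p \<odot>\<^bsub>M\<^esub> b (r p))"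
    if "finite P'" "P' \<subseteq> P" "finite A" "r ` P' \<subseteq> A" "A \<subseteq> F" for P' A
    using that
  proof (induction P')
    case empty
    have "(\<Oplus>\<^bsub>M\<^esub>u\<in>A. (\<Oplus>\<^bsub>R\<^esub>p\<in>{p\<in>{}. r p = u}. g p) \<odot>\<^bsub>M\<^esub> b u) = (\<Oplus>\<^bsub>M\<^esub>u\<in>A. \<zero>\<^bsub>M\<^esub>)"
      by (rule M.add.finprod_cong') (use empty bc in \<open>auto simp: smult_l_null\<close>)
    then show ?case by simp
  next
    case (insert q P')
    let ?c = "\<lambda>P u. \<Oplus>\<^bsub>R\<^esub>p\<in>{p\<in>P. r p = u}. g p"
    have gq: "g q \<in> carrier R" "r q \<in> A" "r q \<in> F" using insert g by auto
    have cc: "?c P' u \<in> carrier R" for u using insert g by (auto intro!: R.finsum_closed)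
    have "?c (insert q P') u \<odot>\<^bsub>M\<^esub> b u
        = (if r q = u then g q \<odot>\<^bsub>M\<^esub> b u else \<zero>\<^bsub>M\<^esub>) \<oplus>\<^bsub>M\<^esub> ?c P' u \<odot>\<^bsub>M\<^esub> b u" if u: "u \<in> A" for u
    proof (cases "r q = u")
      case True
      then have "{p \<in> insert q P'. r p = u} = insert q {p \<in> P'. r p = u}" by auto
      then have "?c (insert q P') u = g q \<oplus>\<^bsub>R\<^esub> ?c P' u"
        using insert g by simp (subst R.finsum_insert; force)
      then show ?thesis using True gq cc u bc insert by (simp add: smult_l_distr subsetD)
    next
      case False
      then have "{p \<in> insert q P'. r p = u} = {p \<in> P'. r p = u}" by auto
      then show ?thesis using False cc u bc insert by (simp add: smult_closed subsetD)
    qed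
    then have "(\<Oplus>\<^bsub>M\<^esub>u\<in>A. ?c (insert q P') u \<odot>\<^bsub>M\<^esub> b u)
      = (\<Oplus>\<^bsub>M\<^esub>u\<in>A. (if r q = u then g q \<odot>\<^bsub>M\<^esub> b u else \<zero>\<^bsub>M\<^esub>) \<oplus>\<^bsub>M\<^esub> ?c P' u \<odot>\<^bsub>M\<^esub> b u)"
      using insert gq cc bc by (intro M.add.finprod_cong') (auto intro!: smult_closed)
    also have "\<dots> = (\<Oplus>\<^bsub>M\<^esub>u\<in>A. (if r q = u then g q \<odot>\<^bsub>M\<^esub> b u else \<zero>\<^bsub>M\<^esub>)) \<oplus>\<^bsub>M\<^esub> (\<Oplus>\<^bsub>M\<^esub>u\<in>A. ?c P' u \<odot>\<^bsub>M\<^esub> b u)"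
      using insert gq cc bc by (intro M.finsum_addf) (auto intro!: smult_closed)
    also have "(\<Oplus>\<^bsub>M\<^esub>u\<in>A. (if r q = u then g q \<odot>\<^bsub>M\<^esub> b u else \<zero>\<^bsub>M\<^esub>)) = g q \<odot>\<^bsub>M\<^esub> b (r q)"
      using insert gq bc by (intro M.add.finprod_singleton) (auto intro!: smult_closed)
    also have "(\<Oplus>\<^bsub>M\<^esub>u\<in>A. ?c P' u \<odot>\<^bsub>M\<^esub> b u) = (\<Oplus>\<^bsub>M\<^esub>p\<in>P'. g p \<odot>\<^bsub>M\<^esub> b (r p))"
      using insert by simp
    also have "g q \<odot>\<^bsub>M\<^esub> b (r q) \<oplus>\<^bsub>M\<^esub> \<dots> = (\<Oplus>\<^bsub>M\<^esub>p\<in>insert q P'. g p \<odot>\<^bsub>M\<^esub> b (r p))"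
      using insert gq bc g by (subst M.finsum_insert) (auto intro!: smult_closed)
    finally show ?case .
  qed
  from this[OF P subset_refl, of "r ` P"] have
    "(\<Oplus>\<^bsub>M\<^esub>u\<in>r ` P. (\<Oplus>\<^bsub>R\<^esub>p\<in>{p\<in>P. r p = u}. g p) \<odot>\<^bsub>M\<^esub> b u) = x" using P r x by auto
  moreover have "(\<Oplus>\<^bsub>M\<^esub>u\<in>r ` P. (\<lambda>u\<in>F. \<Oplus>\<^bsub>R\<^esub>p\<in>{p\<in>P. r p = u}. g p) u \<odot>\<^bsub>M\<^esub> b u)
    = (\<Oplus>\<^bsub>M\<^esub>u\<in>r ` P. (\<Oplus>\<^bsub>R\<^esub>p\<in>{p\<in>P. r p = u}. g p) \<odot>\<^bsub>M\<^esub> b u)"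
    by (rule M.add.finprod_cong') (use r g bc in \<open>auto intro!: smult_closed R.finsum_closed\<close>)
  ultimately show "x = (\<Oplus>\<^bsub>M\<^esub>u\<in>r ` P. (\<lambda>u\<in>F. \<Oplus>\<^bsub>R\<^esub>p\<in>{p\<in>P. r p = u}. g p) u \<odot>\<^bsub>M\<^esub> b u)" by simp
qed

section \<open>The action of the generators\<close>

locale hecke_setting =
  irreducible_root_datum D + parameter_system D J v + hecke_algebra D H T +
  induced_module D J H M act v T m + varpi_map D J v H T M m varpi
  for D :: "'a::euclidean_space based_roots" and J :: "nat set" and v :: "'a \<Rightarrow> qpoly"
    and H :: "(qpoly, 'h) module" and T :: "('a \<Rightarrow> 'a) \<Rightarrow> 'h"
    and M :: "(zpoly set, 'm) module" and act :: "'m \<Rightarrow> 'h \<Rightarrow> 'm"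
    and m :: "('a \<Rightarrow> 'a) \<Rightarrow> 'm" and varpi :: "'h \<Rightarrow> 'm" +
  assumes J: "J \<subseteq> fin_idx D"
begin

interpretation Q: cring "qring D" by (rule qring_cring)
interpretation Z: cring "zringJ D J" by (rule zringJ_cring[OF J])
interpretation M: module "zringJ D J" M by (rule M_module)

definition bvec :: "('a \<Rightarrow> 'a) \<Rightarrow> 'm" where
  "bvec w = varpi (X_elt D H T w)"

lemma v_closed: "\<beta> \<in> par_roots D J \<Longrightarrow> v \<beta> \<in> carrier (qring D)"
  using v_unit by blast

lemma T_closed: "w \<in> ext_weyl D \<Longrightarrow> T w \<in> carrier H"
  using T_basis by (auto simp: module_basis_def)

lemma m_closed: "u \<in> min_reps D J \<Longrightarrow> m u \<in> carrier M"
  using m_basis by (auto simp: module_basis_def)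

lemma finprod_Units:
  assumes "\<And>i. i \<in> A \<Longrightarrow> f i \<in> Units (qring D)"
  shows "(\<Otimes>\<^bsub>qring D\<^esub>i\<in>A. f i) \<in> Units (qring D)"
  using assms
proof (induction A rule: infinite_finite_induct)
  case (insert i A)
  then have "(\<Otimes>\<^bsub>qring D\<^esub>i\<in>insert i A. f i) = f i \<otimes>\<^bsub>qring D\<^esub> (\<Otimes>\<^bsub>qring D\<^esub>i\<in>A. f i)"
    by (intro Q.finprod_insert) auto
  then show ?case using insert by simp
qed simp_all

text \<open>
  Both sides are the product of \<open>v\<^sub>\<beta>\<close> over the positive roots of \<open>\<Phi>\<^sub>J\<close> on which \<open>\<mu>\<close> takes the value 1:
  these are the inversions of \<open>y\<close>, and integrality excludes them from having a double or a half in
  \<open>\<Phi>\<^sub>J\<close>. Hence the factor by which \<open>varpi (X\<^sub>w)\<close> differs from a monomial multiple of a basis vector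
  is trivial whenever \<open>w A\<^sub>0\<close> lies in \<open>\<A>\<^sub>J\<close>.
\<close>

lemma v_wt_eq_v_inv:
  assumes "aligned J \<mu> y"
  shows "v_wt D J v \<mu> = v_inv D J v y" "v_inv D J v y \<in> Units (qring D)"
proof -
  note a = alignedD[OF J assms]
  let ?S = "{\<beta> \<in> par_pos_roots D J. \<mu> \<bullet> \<beta> = 1}"
  have vc: "v \<beta> \<in> carrier (qring D)" if "\<beta> \<in> par_pos_roots D J" for \<beta>
    using v_closed par_pos_rootsD that by blast
  have val: "\<mu> \<bullet> \<beta> = 0 \<or> \<mu> \<bullet> \<beta> = 1" if "\<beta> \<in> par_pos_roots D J" for \<beta> using a(4)[OF that] by auto
  have "v_wt D J v \<mu> = (\<Otimes>\<^bsub>qring D\<^esub>\<beta>\<in>?S. v \<beta>)"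
    unfolding v_wt_def
  proof (rule Q.finprod_mono_neutral_cong_right)
    show "v \<beta> [^]\<^bsub>qring D\<^esub> \<lfloor>\<mu> \<bullet> \<beta>\<rfloor> = \<one>\<^bsub>qring D\<^esub>" if "\<beta> \<in> par_pos_roots D J - ?S" for \<beta>
      using that val[of \<beta>] by auto
    show "v \<beta> [^]\<^bsub>qring D\<^esub> \<lfloor>\<mu> \<bullet> \<beta>\<rfloor> = v \<beta>" if "\<beta> \<in> ?S" for \<beta>
      using that vc[of \<beta>] by (simp add: int_pow_def2)
    show "(\<lambda>\<beta>. v \<beta> [^]\<^bsub>qring D\<^esub> \<lfloor>\<mu> \<bullet> \<beta>\<rfloor>) \<in> par_pos_roots D J \<rightarrow> carrier (qring D)"
    proof
      fix \<beta> assume b: "\<beta> \<in> par_pos_roots D J"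
      from val[OF b] show "v \<beta> [^]\<^bsub>qring D\<^esub> \<lfloor>\<mu> \<bullet> \<beta>\<rfloor> \<in> carrier (qring D)"
      proof
        assume "\<mu> \<bullet> \<beta> = 0"
        then show ?thesis by simp
      next
        assume "\<mu> \<bullet> \<beta> = 1"
        then show ?thesis using vc[OF b] by (simp add: int_pow_def2)
      qed
    qed
  qed (auto simp: finite_par_pos_roots)
  moreover have S: "inv_roots D y = ?S"
  proof (intro equalityI subsetI)
    fix \<beta> assume "\<beta> \<in> inv_roots D y"
    then have b: "\<beta> \<in> pos_roots D" "fun_inv y \<beta> \<notin> pos_roots D"
      by (auto simp: inv_roots_eq[OF a(3)] ind_pos_roots_def)
    then have "\<beta> \<in> par_roots D J"
      using par_weyl_pos_outside[OF J par_weyl_inv[OF J a(2)]] by blast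
    then have "\<beta> \<in> par_pos_roots D J" using b by (simp add: par_pos_roots_def)
    then show "\<beta> \<in> ?S" using a(4) b by auto
  next
    fix \<beta> assume "\<beta> \<in> ?S"
    then have b: "\<beta> \<in> par_pos_roots D J" "\<mu> \<bullet> \<beta> = 1" by auto
    have "(1/2) *\<^sub>R \<beta> \<notin> roots D"
    proof
      assume r: "(1/2) *\<^sub>R \<beta> \<in> roots D"
      then have "\<mu> \<bullet> ((1/2) *\<^sub>R \<beta>) \<in> \<int>" using coweights_root_int[OF a(1)] by blast
      then have "1 \<le> (1/2::real)" using b(2) Ints_ge_1[of "1/2"] by simp
      then show False by simp
    qed
    moreover have "fun_inv y \<beta> \<notin> pos_roots D" using a(4)[OF b(1)] b(2) by auto
    ultimately show "\<beta> \<in> inv_roots D y"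
      using par_pos_rootsD(2)[OF b(1)] by (simp add: inv_roots_eq[OF a(3)] ind_pos_roots_def)
  qed
  moreover have "v_inv D J v y = (\<Otimes>\<^bsub>qring D\<^esub>\<beta>\<in>?S. v \<beta>)"
    unfolding v_inv_def
  proof (rule Q.finprod_cong')
    show "inv_roots D y = ?S" by (rule S)
    show "(\<lambda>\<beta>. v \<beta>) \<in> ?S \<rightarrow> carrier (qring D)" using vc by auto
    fix \<beta> assume "\<beta> \<in> ?S"
    then have b: "\<beta> \<in> par_pos_roots D J" "\<mu> \<bullet> \<beta> = 1" by auto
    have "2 *\<^sub>R \<beta> \<notin> par_roots D J"
    proof
      assume r: "2 *\<^sub>R \<beta> \<in> par_roots D J"
      then have "2 *\<^sub>R \<beta> \<in> par_pos_roots D J"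
        using scaled_pos[OF par_pos_rootsD(2)[OF b(1)], of 2] par_roots_root[OF r] by (simp add: par_pos_roots_def)
      then show False using val[of "2 *\<^sub>R \<beta>"] b(2) by simp
    qed
    then show "v_aff D J v (\<beta>, 0) \<otimes>\<^bsub>qring D\<^esub> v_aff D J v (aff_root_double (\<beta>, 0)) = v \<beta>"
      using b(1) par_pos_rootsD(1)[OF b(1)] vc by (simp add: v_aff_def aff_root_double_def)
  qed
  moreover have "(\<Otimes>\<^bsub>qring D\<^esub>\<beta>\<in>?S. v \<beta>) \<in> Units (qring D)"
  proof (rule finprod_Units)
    fix \<beta> assume "\<beta> \<in> ?S"
    then have "\<beta> \<in> par_pos_roots D J" by simp
    then show "v \<beta> \<in> Units (qring D)" by (rule v_unit[OF par_pos_rootsD(1)])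
  qed
  ultimately show "v_wt D J v \<mu> = v_inv D J v y" "v_inv D J v y \<in> Units (qring D)"
    by simp_all
qed

lemma bvec_eq:
  assumes "w \<in> par_ext_weyl D J"
  shows "bvec w = zmonJ D J (wt w) \<odot>\<^bsub>M\<^esub> m (lin_min D J w)"
proof -
  obtain y where y: "aligned J (wt w) y" "lin_par D J w = y" using par_ext_decomposition[OF J assms] by metis
  have "v_wt D J v (wt w) \<otimes>\<^bsub>qring D\<^esub> inv\<^bsub>qring D\<^esub> (v_inv D J v (lin_par D J w)) = \<one>\<^bsub>qring D\<^esub>"
    using v_wt_eq_v_inv[OF y(1)] y(2) by simp
  then show ?thesis
    unfolding bvec_def varpi_X[OF par_ext_weyl_ext[OF J assms]]
    using embJ_one[OF J] zmonJ_closed[OF J] by simp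
qed

lemma lin_min_mem: "w \<in> par_ext_weyl D J \<Longrightarrow> lin_min D J w \<in> min_reps D J"
  using par_ext_decomposition[OF J] by metis

lemma bvec_closed: "w \<in> par_ext_weyl D J \<Longrightarrow> bvec w \<in> carrier M"
  by (simp add: bvec_eq zmonJ_closed[OF J] m_closed lin_min_mem)

lemma bvec_min_rep:
  assumes "u \<in> min_reps D J" shows "bvec u = m u"
proof -
  have f: "u \<in> fin_weyl D" using min_reps_fin[OF J assms] .
  have "lin_min D J u = u" by (rule lin_par_min_eqI(2)[OF J par_weyl_id assms]) (simp add: f)
  then show ?thesis
    using bvec_eq[OF min_reps_par_ext[OF J assms]] f m_closed[OF assms] by (simp add: zmonJ_0[OF J])
qed

lemma aligned_mem: "aligned J \<mu> y \<Longrightarrow> w \<in> par_ext_weyl D J \<Longrightarrow> transl \<mu> \<circ> y \<circ> w \<in> par_ext_weyl D J"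
  using aligned_comp_par_ext[OF J] par_ext_weyl_ext[OF J] by blast

lemma lin_min_aligned:
  assumes "aligned J \<mu> y" "w \<in> par_ext_weyl D J"
  shows "lin_min D J (transl \<mu> \<circ> y \<circ> w) = lin_min D J w"
proof -
  note a = alignedD[OF J assms(1)]
  obtain y' u where d: "aligned J (wt w) y'" "u \<in> min_reps D J" "lin w = y' \<circ> u" "lin_min D J w = u"
    using par_ext_decomposition[OF J assms(2)] by metis
  have "lin (transl \<mu> \<circ> y \<circ> w) = (y \<circ> y') \<circ> u"
    using lin_comp[OF aligned_ext[OF J assms(1)]] a d(3) by (simp add: comp_assoc)
  then show ?thesis
    using lin_par_min_eqI(2)[OF J par_weyl_comp[OF a(2) alignedD(2)[OF J d(1)]] d(2)] d(4) by simp
qed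

text \<open>
  The weight of the product is \<open>\<mu> + y (wt w)\<close>, and \<open>y\<close> acts trivially on the monomials of the quotient
  ring.
\<close>

lemma bvec_aligned:
  assumes "aligned J \<mu> y" "w \<in> par_ext_weyl D J"
  shows "bvec (transl \<mu> \<circ> y \<circ> w) = zmonJ D J \<mu> \<odot>\<^bsub>M\<^esub> bvec w"
proof -
  note a = alignedD[OF J assms(1)]
  have wc: "wt w \<in> coweights D" using ext_weyl_wt par_ext_weyl_ext[OF J assms(2)] by blast
  have "wt (transl \<mu> \<circ> y \<circ> w) = \<mu> + y (wt w)"
    using wt_comp[OF aligned_ext[OF J assms(1)]] a by simp
  then have "zmonJ D J (wt (transl \<mu> \<circ> y \<circ> w)) = zmonJ D J \<mu> \<otimes>\<^bsub>zringJ D J\<^esub> zmonJ D J (wt w)"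
    using zmonJ_add[OF J a(1) fin_weyl_coweight[OF a(3) wc]] zmonJ_par_weyl[OF J a(2) wc] by simp
  then show ?thesis
    using bvec_eq[OF aligned_mem[OF assms]] bvec_eq[OF assms(2)] lin_min_aligned[OF assms]
    by (simp add: M.smult_assoc1 zmonJ_closed[OF J] m_closed lin_min_mem assms(2))
qed

text \<open>
  The action of a generator on \<open>b\<^sub>w\<close> is obtained from its action on \<open>\<m>\<^sub>u\<close>, where \<open>w = \<tau>\<^sub>\<mu> u\<close>, since
  \<open>b\<^sub>w = \<zeta>\<^sup>\<mu> \<m>\<^sub>u\<close> and the action is linear over the monomials.
\<close>

lemma act_bvec_aligned:
  assumes "aligned J \<mu> y" "u \<in> min_reps D J" "h \<in> carrier H"
  shows "act (bvec (transl \<mu> \<circ> y \<circ> u)) h = zmonJ D J \<mu> \<odot>\<^bsub>M\<^esub> act (m u) h"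
  using assms bvec_aligned[OF assms(1) min_reps_par_ext[OF J assms(2)]] bvec_min_rep[OF assms(2)]
  by (simp add: act_smult_l zmonJ_closed[OF J] m_closed)

lemma stab_mem:
  assumes "w \<in> par_ext_weyl D J" "\<sigma> \<in> alcove_stab D" shows "w \<circ> \<sigma> \<in> par_ext_weyl D J"
proof -
  have "(w \<circ> \<sigma>) ` alcove0 D \<subseteq> par_alcove D J"
    unfolding alcove_stab_image[OF assms(2)] using assms(1) by (simp add: par_ext_weyl_def)
  then show ?thesis
    using ext_weyl_comp[OF par_ext_weyl_ext[OF J assms(1)] alcove_stab_ext[OF assms(2)]]
    by (simp add: par_ext_weyl_def)
qed

lemma act_stab:
  assumes "w \<in> par_ext_weyl D J" "\<sigma> \<in> alcove_stab D"
  shows "act (bvec w) (T \<sigma>) = bvec (w \<circ> \<sigma>)"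
proof -
  obtain y u where d: "aligned J (wt w) y" "u \<in> min_reps D J" "w = transl (wt w) \<circ> y \<circ> u"
    using par_ext_decomposition[OF J assms(1)] by metis
  have us: "u \<circ> \<sigma> \<in> par_ext_weyl D J" using stab_mem[OF min_reps_par_ext[OF J d(2)] assms(2)] .
  have "act (bvec w) (T \<sigma>) = zmonJ D J (wt w) \<odot>\<^bsub>M\<^esub> act (m u) (T \<sigma>)"
    using act_bvec_aligned[OF d(1,2) T_closed[OF alcove_stab_ext[OF assms(2)]]] d(3) by simp
  also have "\<dots> = zmonJ D J (wt w) \<odot>\<^bsub>M\<^esub> bvec (u \<circ> \<sigma>)"
    using act_T_stab[OF d(2) assms(2)] bvec_eq[OF us] by simp
  also have "\<dots> = bvec (transl (wt w) \<circ> y \<circ> (u \<circ> \<sigma>))" using bvec_aligned[OF d(1) us] by simp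
  also have "transl (wt w) \<circ> y \<circ> (u \<circ> \<sigma>) = w \<circ> \<sigma>" using d(3) by (metis comp_assoc)
  finally show ?thesis .
qed

text \<open>
  A wall between two alcoves of \<open>\<A>\<^sub>J\<close> is not parallel to a wall of \<open>\<A>\<^sub>J\<close>: the values of a positive
  root of \<open>\<Phi>\<^sub>J\<close> on \<open>\<A>\<^sub>J\<close> lie between 0 and 1, and no hyperplane at an integer level passes strictly between.
\<close>

lemma crossing_inside:
  assumes "w \<in> par_ext_weyl D J" "i \<in> aff_idx D" "w \<circ> sgen D i \<in> par_ext_weyl D J"
  shows "lin w (fst (aff_sroot D i)) \<notin> par_roots D J"
proof
  let ?f = "fst (aff_sroot D i)" and ?n = "snd (aff_sroot D i)"
  let ?g = "lin w ?f"
  assume g: "?g \<in> par_roots D J"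
  have w: "w \<in> ext_weyl D" using par_ext_weyl_ext[OF J assms(1)] .
  have l: "lin w \<in> fin_weyl D" using ext_weyl_lin[OF w] .
  obtain k where k: "wt w \<bullet> ?g = of_int k"
    using coweights_root_int[OF ext_weyl_wt[OF w] par_roots_root[OF g]] by (auto elim: Ints_cases)
  have wl: "w x \<bullet> ?g + of_int (?n - k) = wall i x" for x
    using l ext_weyl_apply[OF w, of x] by (simp add: inner_add_left k fin_weyl_inner)
  obtain p where p: "interior_point p" using alcove_interior by blast
  have pA: "p \<in> alcove0 D" using alcove_interior_mem[OF p] .
  have "wall i p \<noteq> 0" using affine_root_nonzero[OF aff_sroot_root[OF assms(2)] p] .
  then have wp: "0 < wall i p" using wall_nonneg[OF assms(2) pA] by simp
  have wall_p: "0 < w p \<bullet> ?g + of_int (?n - k)" using wl[of p] wp by linarith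
  have wall_sp: "w (sgen D i p) \<bullet> ?g + of_int (?n - k) < 0" 
    using wl[of "sgen D i p"] wp wall_sgen[OF assms(2), of p] by linarith
  have A: "w p \<in> par_alcove D J" "w (sgen D i p) \<in> par_alcove D J"
    using assms(1,3) pA by (auto simp: par_ext_weyl_def)
  from g show False
  proof (cases rule: par_roots_cases)
    case 1
    then have "w p \<bullet> ?g \<le> 1" "0 \<le> w (sgen D i p) \<bullet> ?g" using A by (auto simp: par_alcove_def)
    then have "0 < real_of_int (?n - k + 1)" "real_of_int (?n - k) < 0" using wall_p wall_sp by simp_all
    then show False by (simp only: of_int_0_less_iff of_int_less_0_iff)
  next
    case c: 2
    then have "0 \<le> w p \<bullet> (- ?g)" "w (sgen D i p) \<bullet> (- ?g) \<le> 1" using A unfolding par_alcove_def by blast+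
    then have "0 < real_of_int (?n - k)" "real_of_int (?n - k - 1) < 0" using wall_p wall_sp by simp_all
    then show False by (simp only: of_int_0_less_iff of_int_less_0_iff)
  qed
qed

text \<open>
  The signs of the crossings from \<open>w\<close> and from \<open>u\<close> agree: their gradients differ by an element of \<open>W\<^sub>J\<close>
  and lie outside \<open>\<Phi>\<^sub>J\<close>.
\<close>

lemma act_crossing:
  assumes "w \<in> par_ext_weyl D J" "i \<in> aff_idx D" "w \<circ> sgen D i \<in> par_ext_weyl D J"
  shows "act (bvec w) (T (sgen D i)) = bvec (w \<circ> sgen D i) \<oplus>\<^bsub>M\<^esub>
    (if negative_crossing D w i then embJ D J (qdiff D i) \<odot>\<^bsub>M\<^esub> bvec w else \<zero>\<^bsub>M\<^esub>)"
proof -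
  let ?s = "sgen D i"
  have w: "w \<in> ext_weyl D" using par_ext_weyl_ext[OF J assms(1)] .
  have s: "?s \<in> ext_weyl D" using sgen_ext_weyl[OF assms(2)] .
  obtain y u where d: "aligned J (wt w) y" "u \<in> min_reps D J" "w = transl (wt w) \<circ> y \<circ> u" "lin w = y \<circ> u"
    using par_ext_decomposition[OF J assms(1)] by metis
  note a = alignedD[OF J d(1)]
  have u: "u \<in> fin_weyl D" "u \<in> ext_weyl D" using min_reps_fin[OF J d(2)] fin_weyl_ext by auto
  have ws: "transl (wt w) \<circ> y \<circ> (u \<circ> ?s) = w \<circ> ?s" using d(3) by (metis comp_assoc)
  have us: "u \<circ> ?s \<in> par_ext_weyl D J"
    using aligned_comp_par_ext[OF J d(1) ext_weyl_comp[OF u(2) s]] assms(3) ws by simp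
  let ?f = "fst (aff_sroot D i)"
  have "u ?f \<notin> par_roots D J"
    using crossing_inside[OF min_reps_par_ext[OF J d(2)] assms(2) us] u by simp
  then have same: "lin w ?f \<in> pos_roots D \<longleftrightarrow> lin u ?f \<in> pos_roots D"
    using par_weyl_pos_outside_iff[OF J a(2)] fin_weyl_root[OF u(1) aff_sroot_root[OF assms(2)]] d(4) u
    by simp
  have bu: "bvec (u \<circ> ?s) \<in> carrier M" using bvec_closed[OF us] .
  have mu: "m u \<in> carrier M" using m_closed[OF d(2)] .
  have ac: "act (m u) (T ?s) = bvec (u \<circ> ?s) \<oplus>\<^bsub>M\<^esub>
     (if negative_crossing D w i then embJ D J (qdiff D i) \<odot>\<^bsub>M\<^esub> m u else \<zero>\<^bsub>M\<^esub>)"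
  proof (cases "negative_crossing D w i")
    case True
    then have "negative_crossing D u i"
      using same negative_crossing_iff[OF w assms(2)] negative_crossing_iff[OF u(2) assms(2)] by simp
    then show ?thesis using act_T_neg[OF d(2) assms(2) us] bvec_eq[OF us] True by simp
  next
    case False
    then have "positive_crossing D u i"
      using same negative_crossing_iff[OF w assms(2)] positive_crossing_iff[OF u(2) assms(2)] by simp
    then show ?thesis using act_T_pos[OF d(2) assms(2) us] bvec_eq[OF us] bu False by simp
  qed
  have q: "embJ D J (qdiff D i) \<in> carrier (zringJ D J)" using embJ_closed[OF J qdiff_closed[OF assms(2)]] .
  have z: "zmonJ D J (wt w) \<in> carrier (zringJ D J)" using zmonJ_closed[OF J] .
  have "act (bvec w) (T ?s) = zmonJ D J (wt w) \<odot>\<^bsub>M\<^esub> act (m u) (T ?s)"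
    using act_bvec_aligned[OF d(1,2) T_closed[OF s]] d(3) by simp
  also have "\<dots> = zmonJ D J (wt w) \<odot>\<^bsub>M\<^esub> bvec (u \<circ> ?s) \<oplus>\<^bsub>M\<^esub>
     (if negative_crossing D w i then embJ D J (qdiff D i) \<odot>\<^bsub>M\<^esub> (zmonJ D J (wt w) \<odot>\<^bsub>M\<^esub> m u) else \<zero>\<^bsub>M\<^esub>)"
    unfolding ac using bu mu q z
    by (simp add: M.smult_r_distr M.smult_assoc1[symmetric] Z.m_comm)
  also have "zmonJ D J (wt w) \<odot>\<^bsub>M\<^esub> bvec (u \<circ> ?s) = bvec (w \<circ> ?s)"
    using bvec_aligned[OF d(1) us] ws by simp
  also have "zmonJ D J (wt w) \<odot>\<^bsub>M\<^esub> m u = bvec w"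
    using bvec_aligned[OF d(1) min_reps_par_ext[OF J d(2)]] d(3) bvec_min_rep[OF d(2)] by simp
  finally show ?thesis .
qed

text \<open>
  The contribution of a bounce at \<open>w\<close> to the exponent of \<open>v\<^sub>\<beta>\<close> in the weight of a path.
\<close>

definition bounces :: "('a \<Rightarrow> 'a) \<Rightarrow> nat \<Rightarrow> 'a \<Rightarrow> nat" where
  "bounces w i \<beta> = of_bool (crosses_up D (w \<circ> sgen D i) w \<beta> 0) + of_bool (crosses_up D w (w \<circ> sgen D i) \<beta> 1)"

text \<open>
  At a bounce, the wall between \<open>w A\<^sub>0\<close> and \<open>w s\<^sub>i A\<^sub>0\<close> is the hyperplane of exactly one root of \<open>\<Phi>\<^sub>J\<close>, or
  of exactly a root and its double. In the second case the wall passes through the value 0, and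
  integrality of \<open>wt w\<close> on roots rules out all other multiples.
\<close>

lemma bounce_walls:
  assumes w: "w \<in> par_ext_weyl D J" and i: "i \<in> aff_idx D" and out: "w \<circ> sgen D i \<notin> par_ext_weyl D J"
  shows "\<exists>\<gamma>\<in>par_pos_roots D J.
    (\<gamma> = lin w (fst (aff_sroot D i)) \<or> \<gamma> = - lin w (fst (aff_sroot D i))) \<and>
    (\<forall>\<beta>\<in>par_pos_roots D J. bounces w i \<beta> = of_bool (\<beta> = \<gamma> \<or> \<beta> = 2 *\<^sub>R \<gamma>))"
proof -
  let ?s = "sgen D i" and ?f = "fst (aff_sroot D i)" and ?n = "snd (aff_sroot D i)"
  let ?g = "lin w ?f"
  have we: "w \<in> ext_weyl D" using par_ext_weyl_ext[OF J w] .
  have l: "lin w \<in> fin_weyl D" using ext_weyl_lin[OF we] .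
  have gr: "?g \<in> roots D" using lin_wall_root[OF we i] .
  have A: "0 \<le> w x \<bullet> \<beta> \<and> w x \<bullet> \<beta> \<le> 1" if "x \<in> alcove0 D" "\<beta> \<in> par_pos_roots D J" for x \<beta>
    using w that by (auto simp: par_ext_weyl_def par_alcove_def image_subset_iff)
  have wt01: "wt w \<bullet> \<beta> = 0 \<or> wt w \<bullet> \<beta> = 1" if b: "\<beta> \<in> par_pos_roots D J" for \<beta>
    using A[OF zero_in_alcove b] int_between_0_1[of "wt w \<bullet> \<beta>"]
      coweights_root_int[OF ext_weyl_wt[OF we] par_roots_root[OF par_pos_rootsD(1)[OF b]]]
    by (simp add: wt_def)
  have wti: "wt w \<bullet> \<beta> \<in> \<int>" if "\<beta> \<in> roots D" for \<beta> using coweights_root_int[OF ext_weyl_wt[OF we] that] .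
  let ?in = "\<lambda>c \<beta>. \<beta> = c *\<^sub>R ?g \<and> wt w \<bullet> \<beta> = c * of_int ?n"
  let ?out = "\<lambda>c \<beta>. - \<beta> = c *\<^sub>R ?g \<and> 1 - wt w \<bullet> \<beta> = c * of_int ?n"
  have in_iff: "crosses_up D (w \<circ> ?s) w \<beta> 0 \<longleftrightarrow> (\<exists>c>0. ?in c \<beta>)" if "\<beta> \<in> par_pos_roots D J" for \<beta>
    using crosses_up_into[OF we i par_roots_root[OF par_pos_rootsD(1)[OF that]], of 0] by simp
  have out_iff: "crosses_up D w (w \<circ> ?s) \<beta> 1 \<longleftrightarrow> (\<exists>c>0. ?out c \<beta>)" if "\<beta> \<in> par_pos_roots D J" for \<beta>
    using crosses_up_out[OF we i par_roots_root[OF par_pos_rootsD(1)[OF that]], of 1] by simp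
  have "\<not> (\<forall>x\<in>alcove0 D. w (?s x) \<in> par_alcove D J)"
    using out ext_weyl_comp[OF we sgen_ext_weyl[OF i]] by (auto simp: par_ext_weyl_def image_subset_iff)
  then obtain \<eta> where \<eta>: "\<eta> \<in> par_pos_roots D J"
    "\<not> (\<forall>x\<in>alcove0 D. 0 \<le> w (?s x) \<bullet> \<eta>) \<or> \<not> (\<forall>x\<in>alcove0 D. w (?s x) \<bullet> \<eta> \<le> 1)"
    by (auto simp: par_alcove_def)
  have \<eta>r: "\<eta> \<in> roots D" using \<eta> par_pos_rootsD par_roots_root by blast
  have \<eta>w: "(\<exists>c>0. ?in c \<eta>) \<or> (\<exists>c>0. ?out c \<eta>)"
    using \<eta>(2)
  proof
    assume "\<not> (\<forall>x\<in>alcove0 D. 0 \<le> w (?s x) \<bullet> \<eta>)"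
    then show ?thesis using wall_crossing[OF we i \<eta>r, of 0] A[OF _ \<eta>(1)] by simp
  next
    assume "\<not> (\<forall>x\<in>alcove0 D. w (?s x) \<bullet> \<eta> \<le> 1)"
    then show ?thesis using wall_crossing[OF we i root_uminus[OF \<eta>r], of 1] A[OF _ \<eta>(1)] by simp
  qed
  have gJ: "?g \<in> par_roots D J"
  proof -
    from \<eta>w obtain c where "c > 0" "\<eta> = c *\<^sub>R ?g \<or> - \<eta> = c *\<^sub>R ?g" by blast
    moreover have "(1/c) *\<^sub>R (c *\<^sub>R ?g) = ?g" using \<open>c > 0\<close> by simp
    ultimately have "?g = (1/c) *\<^sub>R \<eta> \<or> ?g = (1/c) *\<^sub>R (- \<eta>)" by metis
    then show ?thesis using gr par_roots_scale[of \<eta> J "1/c"] par_roots_scale[of "-\<eta>" J "1/c"]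
        par_pos_rootsD(1)[OF \<eta>(1)] par_roots_uminus by metis
  qed
  \<comment> \<open>Possible ratios of a root to the gradient of the wall.\<close>
  have ratio: "c = 1 \<or> c = 2" if "i \<noteq> 0" "c > 0" "c *\<^sub>R ?g \<in> roots D" for c
  proof -
    have "lin w (c *\<^sub>R ?f) \<in> roots D" using that by (simp add: fin_weyl_scale[OF l])
    then have "c *\<^sub>R ?f \<in> roots D" using fin_weyl_root_iff[OF l] by blast
    then show ?thesis using sroot_multiple[of i c] that i by (simp add: aff_sroot_def aff_idx_eq)
  qed
  have ratio0: "c = 1/2 \<or> c = 1" if "i = 0" "c > 0" "c *\<^sub>R ?g \<in> roots D" for c
  proof -
    have "lin w (c *\<^sub>R ?f) \<in> roots D" using that by (simp add: fin_weyl_scale[OF l])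
    then have "c *\<^sub>R ?f \<in> roots D" using fin_weyl_root_iff[OF l] by blast
    then have "c *\<^sub>R highest_root D \<in> roots D"
      using that root_uminus[of "c *\<^sub>R ?f"] by (simp add: aff_sroot_def)
    then show ?thesis using highest_multiple that by blast
  qed
  have half: "(1/2::real) \<notin> \<int>" using Ints_ge_1[of "1/2"] by auto
  have n: "?n = (if i = 0 then 1 else 0)" by (simp add: aff_sroot_def)
  have neg: "- \<beta> = c *\<^sub>R ?g \<longleftrightarrow> \<beta> = c *\<^sub>R (- ?g)" for \<beta> c by (metis minus_minus scaleR_minus_right)
  from gJ show ?thesis
  proof (cases rule: par_roots_cases)
    case 1
    have no_out: "\<not> (\<exists>c>0. ?out c \<beta>)" if "\<beta> \<in> par_pos_roots D J" for \<beta>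
    proof
      assume "\<exists>c>0. ?out c \<beta>"
      then obtain c where "c > 0" "- \<beta> = c *\<^sub>R ?g" by blast
      moreover have "- \<beta> \<in> roots D" using that par_pos_rootsD par_roots_root root_uminus by blast
      ultimately have "- \<beta> \<in> pos_roots D" using scaled_pos[of ?g c] 1 par_pos_rootsD(2) by metis
      then show False using that par_pos_rootsD pos_not_neg by blast
    qed
    obtain c where c: "c > 0" "\<eta> = c *\<^sub>R ?g" "wt w \<bullet> \<eta> = c * of_int ?n" using \<eta>w no_out[OF \<eta>(1)] by blast
    have wtg: "wt w \<bullet> ?g = of_int ?n" using c by simp
    have "(\<exists>c>0. ?in c \<beta>) \<longleftrightarrow> \<beta> = ?g \<or> \<beta> = 2 *\<^sub>R ?g" if b: "\<beta> \<in> par_pos_roots D J" for \<beta>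
    proof
      have br: "\<beta> \<in> roots D" using b par_pos_rootsD par_roots_root by blast
      assume "\<exists>c>0. ?in c \<beta>"
      then obtain d where d: "d > 0" "\<beta> = d *\<^sub>R ?g" "wt w \<bullet> \<beta> = d * of_int ?n" by blast
      show "\<beta> = ?g \<or> \<beta> = 2 *\<^sub>R ?g"
      proof (cases "i = 0")
        case True
        then have "d \<in> \<int>" using wti[OF br] d(3) n by simp
        then have "d \<noteq> 1/2" using half by metis
        then show ?thesis using ratio0[OF True d(1)] br d(2) by auto
      next
        case False
        then show ?thesis using ratio[OF False d(1)] br d(2) by auto
      qed
    next
      assume "\<beta> = ?g \<or> \<beta> = 2 *\<^sub>R ?g"
      then obtain d where "d > 0" "\<beta> = d *\<^sub>R ?g" by (metis scaleR_one zero_less_numeral zero_less_one)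
      then show "\<exists>c>0. ?in c \<beta>" using wtg by (intro exI[of _ d]) simp
    qed
    then have "bounces w i \<beta> = of_bool (\<beta> = ?g \<or> \<beta> = 2 *\<^sub>R ?g)" if "\<beta> \<in> par_pos_roots D J" for \<beta>
      using that no_out[OF that] unfolding bounces_def in_iff[OF that] out_iff[OF that] by simp
    then show ?thesis using 1 by (intro bexI[of _ ?g]) simp_all
  next
    case 2
    let ?g' = "- ?g"
    have no_in: "\<not> (\<exists>c>0. ?in c \<beta>)" if b: "\<beta> \<in> par_pos_roots D J" for \<beta>
    proof
      assume "\<exists>c>0. ?in c \<beta>"
      then obtain c where c: "c > 0" "\<beta> = c *\<^sub>R ?g" by blast
      have "(1/c) *\<^sub>R \<beta> = ?g" using c by simp
      then have "?g \<in> pos_roots D" using scaled_pos[of \<beta> "1/c"] c(1) gr b par_pos_rootsD(2) by simp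
      then show False using 2 par_pos_rootsD(2) pos_not_neg by blast
    qed
    obtain c where c: "c > 0" "\<eta> = c *\<^sub>R ?g'" "1 - wt w \<bullet> \<eta> = c * of_int ?n"
      using \<eta>w no_in[OF \<eta>(1)] neg by blast
    have rm: "d *\<^sub>R ?g \<in> roots D" if "\<beta> = d *\<^sub>R ?g'" "\<beta> \<in> roots D" for d \<beta>
      using that root_uminus[of \<beta>] by simp
    have one: "\<beta> = ?g'" if b: "\<beta> \<in> par_pos_roots D J" and d: "d > 0" "\<beta> = d *\<^sub>R ?g'" "1 - wt w \<bullet> \<beta> = d * of_int ?n" for \<beta> d
    proof -
      have br: "\<beta> \<in> roots D" using b par_pos_rootsD par_roots_root by blast
      have "d = 1"
      proof (cases "i = 0")
        case True
        then have "d = 1 - wt w \<bullet> \<beta>" using d(3) n by simp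
        then have "d \<in> \<int>" using wti[OF br] by simp
        then have "d \<noteq> 1/2" using half by metis
        then show ?thesis using ratio0[OF True d(1) rm[OF d(2) br]] by blast
      next
        case False
        then have w1: "wt w \<bullet> \<beta> = 1" using d(3) n by simp
        have "d \<noteq> 2"
        proof
          assume "d = 2"
          then have "wt w \<bullet> ?g' = 1/2" using w1 d(2) by simp
          then show False using wti[OF root_uminus[OF gr]] half by metis
        qed
        then show ?thesis using ratio[OF False d(1) rm[OF d(2) br]] by blast
      qed
      then show ?thesis using d(2) by simp
    qed
    have \<eta>g: "\<eta> = ?g'" using one[OF \<eta>(1) c] .
    have c1: "c = 1" using c(2) \<eta>g root_nz[OF gr] by (metis neg_equal_0_iff_equal scaleR_cancel_right scaleR_one)
    have "2 *\<^sub>R ?g' \<notin> par_pos_roots D J"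
    proof
      assume d: "2 *\<^sub>R ?g' \<in> par_pos_roots D J"
      then have dr: "2 *\<^sub>R ?g' \<in> roots D" using par_pos_rootsD par_roots_root by blast
      show False
      proof (cases "i = 0")
        case True
        then show False using ratio0[OF True, of 2] rm[OF refl dr] by simp
      next
        case False
        then have "wt w \<bullet> ?g' = 1" using c(3) \<eta>g n by simp
        then have "wt w \<bullet> (2 *\<^sub>R ?g') = 2" by simp
        then show False using wt01[OF d] by simp
      qed
    qed
    moreover have "(\<exists>c>0. ?out c \<beta>) \<longleftrightarrow> \<beta> = ?g'" if b: "\<beta> \<in> par_pos_roots D J" for \<beta>
    proof
      assume "\<exists>c>0. ?out c \<beta>"
      then show "\<beta> = ?g'" using one[OF b] neg by blast
    next
      assume "\<beta> = ?g'"
      then show "\<exists>c>0. ?out c \<beta>" using c \<eta>g c1 neg by (intro exI[of _ 1]) auto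
    qed
    ultimately have "bounces w i \<beta> = of_bool (\<beta> = ?g' \<or> \<beta> = 2 *\<^sub>R ?g')" if "\<beta> \<in> par_pos_roots D J" for \<beta>
      using that no_in[OF that] unfolding bounces_def in_iff[OF that] out_iff[OF that] by auto
    then show ?thesis using 2 by (intro bexI[of _ ?g']) simp_all
  qed
qed

text \<open>
  The roots hit at \<open>w\<close> are \<open>W\<^sub>J\<close>-conjugate, up to sign, to the gradient \<open>u \<alpha>\<^sub>i\<close> and its double, and the
  parameters are constant on such classes because \<open>W\<^sub>J\<close> contains the reflections that change signs.
\<close>

lemma act_bounce:
  assumes "w \<in> par_ext_weyl D J" "i \<in> aff_idx D" "w \<circ> sgen D i \<notin> par_ext_weyl D J"
  shows "act (bvec w) (T (sgen D i)) =
    embJ D J (\<Otimes>\<^bsub>qring D\<^esub>\<beta>\<in>par_pos_roots D J. v \<beta> [^]\<^bsub>qring D\<^esub> bounces w i \<beta>) \<odot>\<^bsub>M\<^esub> bvec w"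
proof -
  let ?s = "sgen D i" and ?f = "fst (aff_sroot D i)"
  have s: "?s \<in> ext_weyl D" using sgen_ext_weyl[OF assms(2)] .
  obtain y u where d: "aligned J (wt w) y" "u \<in> min_reps D J" "w = transl (wt w) \<circ> y \<circ> u" "lin w = y \<circ> u"
    using par_ext_decomposition[OF J assms(1)] by metis
  note a = alignedD[OF J d(1)]
  have u: "u \<in> fin_weyl D" "u \<in> ext_weyl D" using min_reps_fin[OF J d(2)] fin_weyl_ext by auto
  have ws: "transl (wt w) \<circ> y \<circ> (u \<circ> ?s) = w \<circ> ?s" using d(3) by (metis comp_assoc)
  have us: "u \<circ> ?s \<notin> par_ext_weyl D J"
    using aligned_comp_par_ext[OF J d(1) ext_weyl_comp[OF u(2) s]] assms(3) ws by simp
  obtain \<gamma> where g: "\<gamma> \<in> par_pos_roots D J" "\<gamma> = lin w ?f \<or> \<gamma> = - lin w ?f"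
    "\<forall>\<beta>\<in>par_pos_roots D J. bounces w i \<beta> = of_bool (\<beta> = \<gamma> \<or> \<beta> = 2 *\<^sub>R \<gamma>)"
    using bounce_walls[OF assms] by blast
  have gJ: "\<gamma> \<in> par_roots D J" using par_pos_rootsD(1)[OF g(1)] .
  have vneg: "v (- \<beta>) = v \<beta>" if "\<beta> \<in> par_roots D J" for \<beta>
    using v_orbit[OF that refl_in_par_weyl[OF J that]] refl_self[OF root_nz[OF par_roots_root[OF that]]] by simp
  have wall_v: "v (c *\<^sub>R \<gamma>) = v (c *\<^sub>R u ?f) \<and> c *\<^sub>R u ?f \<in> par_roots D J" if "c *\<^sub>R \<gamma> \<in> par_roots D J" for c
  proof -
    have e: "c *\<^sub>R lin w ?f = y (c *\<^sub>R u ?f)" using d(4) by (simp add: fin_weyl_scale[OF a(3)])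
    have "y (c *\<^sub>R u ?f) = c *\<^sub>R \<gamma> \<or> y (c *\<^sub>R u ?f) = - (c *\<^sub>R \<gamma>)"
      using g(2) unfolding e[symmetric] by (metis minus_minus scaleR_minus_right)
    then have r: "y (c *\<^sub>R u ?f) \<in> par_roots D J \<and> v (y (c *\<^sub>R u ?f)) = v (c *\<^sub>R \<gamma>)"
      using that vneg[OF that] par_roots_uminus[OF that] by (elim disjE) simp_all
    then have "c *\<^sub>R u ?f \<in> par_roots D J" using par_weyl_par_roots[OF J a(2)] by blast
    then show ?thesis using r v_orbit[OF _ a(2)] by simp
  qed
  have vu: "v (u ?f) = v \<gamma>" "u ?f \<in> par_roots D J" using wall_v[of 1] gJ by auto
  have "2 *\<^sub>R u ?f \<in> par_roots D J \<longleftrightarrow> 2 *\<^sub>R \<gamma> \<in> par_roots D J"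
  proof
    assume r: "2 *\<^sub>R u ?f \<in> par_roots D J"
    then have "y (2 *\<^sub>R u ?f) \<in> par_roots D J" using par_weyl_par_roots[OF J a(2)] by blast
    then have "2 *\<^sub>R lin w ?f \<in> par_roots D J" using d(4) by (simp add: fin_weyl_scale[OF a(3)])
    then show "2 *\<^sub>R \<gamma> \<in> par_roots D J"
      using g(2) par_roots_uminus[of "2 *\<^sub>R lin w ?f" J] by (elim disjE) simp_all
  qed (use wall_v in blast)
  then have aff: "v_aff D J v (aff_root_act u (aff_sroot D i)) \<otimes>\<^bsub>qring D\<^esub>
      v_aff D J v (aff_root_double (aff_root_act u (aff_sroot D i)))
    = v \<gamma> \<otimes>\<^bsub>qring D\<^esub> (if 2 *\<^sub>R \<gamma> \<in> par_roots D J then v (2 *\<^sub>R \<gamma>) else \<one>\<^bsub>qring D\<^esub>)"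
    using vu wall_v[of 2] by (simp add: v_aff_def aff_root_act_def aff_root_double_def)
  have vc: "v \<beta> \<in> carrier (qring D)" if "\<beta> \<in> par_pos_roots D J" for \<beta>
    using v_closed par_pos_rootsD that by blast
  let ?S = "{\<gamma>, 2 *\<^sub>R \<gamma>} \<inter> par_pos_roots D J"
  have "(\<Otimes>\<^bsub>qring D\<^esub>\<beta>\<in>par_pos_roots D J. v \<beta> [^]\<^bsub>qring D\<^esub> bounces w i \<beta>) = (\<Otimes>\<^bsub>qring D\<^esub>\<beta>\<in>?S. v \<beta>)"
    by (rule Q.finprod_mono_neutral_cong_right) (use vc g(3) in \<open>auto simp: finite_par_pos_roots\<close>)
  also have "\<dots> = v \<gamma> \<otimes>\<^bsub>qring D\<^esub> (if 2 *\<^sub>R \<gamma> \<in> par_roots D J then v (2 *\<^sub>R \<gamma>) else \<one>\<^bsub>qring D\<^esub>)"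
  proof (cases "2 *\<^sub>R \<gamma> \<in> par_roots D J")
    case True
    then have "2 *\<^sub>R \<gamma> \<in> par_pos_roots D J"
      using scaled_pos[OF par_pos_rootsD(2)[OF g(1)], of 2] par_roots_root[OF True] by (simp add: par_pos_roots_def)
    moreover have "\<gamma> \<noteq> 2 *\<^sub>R \<gamma>" using root_nz[OF par_roots_root[OF gJ]] by (simp add: scaleR_2)
    moreover have S: "?S = {\<gamma>, 2 *\<^sub>R \<gamma>}" using g(1) calculation(1) by auto
    ultimately show ?thesis unfolding S using True vc[OF g(1)] vc[of "2 *\<^sub>R \<gamma>"] by simp
  next
    case False
    then have S: "?S = {\<gamma>}" using g(1) by (auto simp: par_pos_roots_def)
    show ?thesis unfolding S using False vc[OF g(1)] by simp
  qed
  finally have prod: "v_aff D J v (aff_root_act u (aff_sroot D i)) \<otimes>\<^bsub>qring D\<^esub>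
      v_aff D J v (aff_root_double (aff_root_act u (aff_sroot D i))) =
    (\<Otimes>\<^bsub>qring D\<^esub>\<beta>\<in>par_pos_roots D J. v \<beta> [^]\<^bsub>qring D\<^esub> bounces w i \<beta>)" (is "_ = ?V") using aff by simp
  have q: "embJ D J ?V \<in> carrier (zringJ D J)"
    using vc by (intro embJ_closed[OF J] Q.finprod_closed) auto
  have z: "zmonJ D J (wt w) \<in> carrier (zringJ D J)" using zmonJ_closed[OF J] .
  have mu: "m u \<in> carrier M" using m_closed[OF d(2)] .
  have "act (bvec w) (T ?s) = zmonJ D J (wt w) \<odot>\<^bsub>M\<^esub> act (m u) (T ?s)"
    using act_bvec_aligned[OF d(1,2) T_closed[OF s]] d(3) by simp
  also have "\<dots> = zmonJ D J (wt w) \<odot>\<^bsub>M\<^esub> (embJ D J ?V \<odot>\<^bsub>M\<^esub> m u)"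
    using act_T_bounce[OF d(2) assms(2) us] prod by simp
  also have "\<dots> = embJ D J ?V \<odot>\<^bsub>M\<^esub> (zmonJ D J (wt w) \<odot>\<^bsub>M\<^esub> m u)"
    using q z mu by (simp add: M.smult_assoc1[symmetric] Z.m_comm)
  also have "zmonJ D J (wt w) \<odot>\<^bsub>M\<^esub> m u = bvec w"
    using bvec_aligned[OF d(1) min_reps_par_ext[OF J d(2)]] d(3) bvec_min_rep[OF d(2)] by simp
  finally show ?thesis .
qed

end

section \<open>Sums over folded paths\<close>

lemma card_less_Suc:
  "card {k. k < Suc n \<and> P k} = of_bool (P 0) + card {k. k < n \<and> P (Suc k)}"
proof -
  have "{k. k < Suc n \<and> P k} = (if P 0 then {0} else {}) \<union> Suc ` {k. k < n \<and> P (Suc k)}"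
  proof (intro equalityI subsetI)
    fix k assume "k \<in> {k. k < Suc n \<and> P k}"
    then show "k \<in> (if P 0 then {0} else {}) \<union> Suc ` {k. k < n \<and> P (Suc k)}" by (cases k) auto
  qed (auto split: if_splits)
  moreover have "card ((if P 0 then {0} else {}) \<union> Suc ` {k. k < n \<and> P (Suc k)})
      = card (if P 0 then {0::nat} else {}) + card (Suc ` {k. k < n \<and> P (Suc k)})"
    by (rule card_Un_disjoint) auto
  ultimately show ?thesis by (simp add: card_image)
qed

lemma fold_count_Cons:
  "fold_count D J (i # js) (s # p) j =
     of_bool (i = j \<and> p ! 0 = s \<and> s \<circ> sgen D i \<in> par_ext_weyl D J) + fold_count D J js p j"
  unfolding fold_count_def by (simp add: card_less_Suc)

lemma bounce_count_Cons:
  "bounce_count D J (i # js) (s # p) \<beta> =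
     (if p ! 0 = s \<and> s \<circ> sgen D i \<notin> par_ext_weyl D J
      then of_bool (crosses_up D (s \<circ> sgen D i) s \<beta> 0) + of_bool (crosses_up D s (s \<circ> sgen D i) \<beta> 1)
      else 0) + bounce_count D J js p \<beta>"
  unfolding bounce_count_def bounce_at_def conj_assoc by (simp add: card_less_Suc)

text \<open>
  The possible second entries of a folded path that starts at \<open>s\<close> and whose first letter is \<open>i\<close>.
\<close>

definition next_alcoves :: "'a::euclidean_space based_roots \<Rightarrow> nat set \<Rightarrow> ('a \<Rightarrow> 'a) \<Rightarrow> nat \<Rightarrow> ('a \<Rightarrow> 'a) set" where
  "next_alcoves D J s i = {s' \<in> {s, s \<circ> sgen D i}. s' \<in> par_ext_weyl D J \<and>
     (s' = s \<longrightarrow> s \<circ> sgen D i \<in> par_ext_weyl D J \<longrightarrow> negative_crossing D s i)}"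

lemma folded_paths_Nil_subset: "folded_paths D J [] \<sigma> s \<subseteq> {[s, s \<circ> \<sigma>]}"
proof
  fix p assume "p \<in> folded_paths D J [] \<sigma> s"
  then have p: "length p = 2" "p ! 0 = s" "p ! 1 = s \<circ> \<sigma>" by (auto simp: folded_paths_def)
  then obtain a b where "p = [a, b]" by (auto simp: length_Suc_conv numeral_2_eq_2)
  then show "p \<in> {[s, s \<circ> \<sigma>]}" using p by simp
qed

lemma folded_paths_Nil:
  assumes "s \<in> par_ext_weyl D J" "s \<circ> \<sigma> \<in> par_ext_weyl D J"
  shows "folded_paths D J [] \<sigma> s = {[s, s \<circ> \<sigma>]}"
  by (rule antisym[OF folded_paths_Nil_subset]) (use assms in \<open>auto simp: folded_paths_def\<close>)

lemma folded_paths_Cons_iff: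
  assumes "s \<in> par_ext_weyl D J"
  shows "s # p \<in> folded_paths D J (i # js) \<sigma> s \<longleftrightarrow>
    p ! 0 \<in> next_alcoves D J s i \<and> p \<in> folded_paths D J js \<sigma> (p ! 0)"
proof (cases "length p = length js + 2 \<and> set p \<subseteq> par_ext_weyl D J")
  case True
  then have "p ! 0 \<in> par_ext_weyl D J" by (metis add_2_eq_Suc' nth_mem subsetD zero_less_Suc)
  then show ?thesis using assms True
    unfolding folded_paths_def next_alcoves_def by (auto simp: All_less_Suc2)
qed (use assms in \<open>auto simp: folded_paths_def\<close>)

lemma folded_paths_Cons:
  assumes "s \<in> par_ext_weyl D J"
  shows "folded_paths D J (i # js) \<sigma> s = (\<Union>s'\<in>next_alcoves D J s i. (#) s ` folded_paths D J js \<sigma> s')"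
proof (intro equalityI subsetI)
  fix q assume q: "q \<in> folded_paths D J (i # js) \<sigma> s"
  then have "length q = Suc (length js + 2)" "q ! 0 = s" by (auto simp: folded_paths_def)
  then obtain p where "q = s # p" by (cases q) auto
  then show "q \<in> (\<Union>s'\<in>next_alcoves D J s i. (#) s ` folded_paths D J js \<sigma> s')"
    using q folded_paths_Cons_iff[OF assms] by blast
next
  fix q assume "q \<in> (\<Union>s'\<in>next_alcoves D J s i. (#) s ` folded_paths D J js \<sigma> s')"
  then obtain s' p where p: "s' \<in> next_alcoves D J s i" "p \<in> folded_paths D J js \<sigma> s'" "q = s # p" by auto
  then have "p ! 0 = s'" by (simp add: folded_paths_def)
  then show "q \<in> folded_paths D J (i # js) \<sigma> s" using p folded_paths_Cons_iff[OF assms] by metis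
qed

lemma finite_next_alcoves: "finite (next_alcoves D J s i)"
  by (simp add: next_alcoves_def)

lemma finite_folded_paths:
  "s \<in> par_ext_weyl D J \<Longrightarrow> finite (folded_paths D J js \<sigma> s)"
proof (induction js arbitrary: s)
  case Nil
  show ?case by (rule finite_subset[OF folded_paths_Nil_subset]) simp
next
  case (Cons i js)
  then show ?case unfolding folded_paths_Cons[OF Cons.prems]
    by (intro finite_UN_I finite_next_alcoves finite_imageI) (auto simp: next_alcoves_def)
qed

lemma folded_path_last: "p \<in> folded_paths D J js \<sigma> s \<Longrightarrow> last p \<in> par_ext_weyl D J"
  by (auto simp: folded_paths_def) (metis Zero_not_Suc last_in_set list.size(3) subsetD)

context irreducible_root_datum
begin

lemma sgen_moves:
  assumes "w \<in> ext_weyl D" "i \<in> aff_idx D" shows "w \<circ> sgen D i \<noteq> w"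
proof
  assume "w \<circ> sgen D i = w"
  obtain p where p: "interior_point p" using alcove_interior by blast
  have "w (sgen D i p) = w p" using \<open>w \<circ> sgen D i = w\<close> by (metis comp_apply)
  then have "lin w (sgen D i p) = lin w p" by (simp add: lin_def)
  then have "sgen D i p = p" by (metis ext_weyl_lin[OF assms(1)] fin_weyl_inv_apply(1))
  then have "wall i p = 0" using wall_sgen[OF assms(2), of p] by simp
  then show False using affine_root_nonzero[OF aff_sroot_root[OF assms(2)] p] by blast
qed

lemma sgen_not_stab:
  assumes "i \<in> aff_idx D" shows "sgen D i \<notin> alcove_stab D"
proof
  assume s: "sgen D i \<in> alcove_stab D"
  obtain p where p: "interior_point p" using alcove_interior by blast
  have pA: "p \<in> alcove0 D" using alcove_interior_mem[OF p] .
  then have "sgen D i p \<in> alcove0 D" using s by (auto simp: alcove_stab_def)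
  then have "0 \<le> - wall i p" using wall_nonneg[OF assms] wall_sgen[OF assms, of p] by metis
  then have "wall i p = 0" using wall_nonneg[OF assms pA] by simp
  then show False using affine_root_nonzero[OF aff_sroot_root[OF assms] p] by blast
qed

lemma len_sgen: 
  assumes "i \<in> aff_idx D" shows "len D (sgen D i) = 1"
proof -
  have e: "expression D (sgen D i) [i] id" using assms id_stab by (simp add: expression_def)
  then obtain js \<sigma> where js: "expression D (sgen D i) js \<sigma>" "length js = len D (sgen D i)"
    using len_attained by blast
  have "js \<noteq> []" using js(1) sgen_not_stab[OF assms] by (auto simp: expression_def)
  then show ?thesis using js(2) len_le[OF e] by (cases js) auto
qed

text \<open>
  The affine simple reflections do not preserve \<open>A\<^sub>0\<close>, hence have length 1, and the tail of a reduced
  word is reduced; so \<open>T\<^sub>w\<close> factors along the word.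
\<close>

lemma reduced_Cons:
  assumes "reduced_expression D w (i # js) \<sigma>"
  defines "w' \<equiv> wprod D js \<circ> \<sigma>"
  shows "i \<in> aff_idx D" "w' \<in> ext_weyl D" "w = sgen D i \<circ> w'" "reduced_expression D w' js \<sigma>"
    "len D w = len D (sgen D i) + len D w'"
proof -
  have e: "set (i # js) \<subseteq> aff_idx D" "\<sigma> \<in> alcove_stab D" "w = wprod D (i # js) \<circ> \<sigma>"
    "len D w = Suc (length js)"
    using assms(1) by (auto simp: reduced_expression_def expression_def)
  show i: "i \<in> aff_idx D" using e by simp
  show w: "w = sgen D i \<circ> w'" using e(3) by (simp only: w'_def wprod_Cons comp_assoc)
  show "w' \<in> ext_weyl D" unfolding w'_def
    using e by (intro ext_weyl_comp wprod_ext_weyl alcove_stab_ext) auto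
  have e': "expression D w' js \<sigma>" using e by (simp add: expression_def w'_def)
  have "length js \<le> len D w'"
  proof -
    obtain ks \<tau> where ks: "expression D w' ks \<tau>" "length ks = len D w'" using len_attained[OF e'] by blast
    then have "expression D w (i # ks) \<tau>" using i by (auto simp: expression_def w comp_assoc)
    then show ?thesis using len_le[of w "i # ks" \<tau>] e(4) ks(2) by simp
  qed
  then have l: "len D w' = length js" using len_le[OF e'] by simp
  then show "reduced_expression D w' js \<sigma>" using e' by (simp add: reduced_expression_def)
  show "len D w = len D (sgen D i) + len D w'" using e(4) l len_sgen[OF i] by simp
qed

end

context hecke_setting
begin

interpretation Q: cring "qring D" by (rule qring_cring)
interpretation Z: cring "zringJ D J" by (rule zringJ_cring[OF J])
interpretation M: module "zringJ D J" M by (rule M_module)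

text \<open>
  The factor that the first step, from \<open>s\<close> to \<open>s'\<close>, contributes to the weight of a path.
\<close>

definition step_weight :: "('a \<Rightarrow> 'a) \<Rightarrow> nat \<Rightarrow> ('a \<Rightarrow> 'a) \<Rightarrow> qpoly" where
  "step_weight s i s' =
     (\<Otimes>\<^bsub>qring D\<^esub>\<beta>\<in>par_pos_roots D J. v \<beta> [^]\<^bsub>qring D\<^esub>
        (if s' = s \<and> s \<circ> sgen D i \<notin> par_ext_weyl D J then bounces s i \<beta> else 0))
     \<otimes>\<^bsub>qring D\<^esub> (\<Otimes>\<^bsub>qring D\<^esub>j\<in>aff_idx D. qdiff D j [^]\<^bsub>qring D\<^esub>
        (of_bool (i = j \<and> s' = s \<and> s \<circ> sgen D i \<in> par_ext_weyl D J) :: nat))"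

lemma vpow_closed: "(\<lambda>\<beta>. v \<beta> [^]\<^bsub>qring D\<^esub> (n \<beta> :: nat)) \<in> par_pos_roots D J \<rightarrow> carrier (qring D)"
  using v_closed[OF par_pos_rootsD(1)] by (auto intro!: Q.nat_pow_closed)

lemma qpow_closed: "(\<lambda>j. qdiff D j [^]\<^bsub>qring D\<^esub> (n j :: nat)) \<in> aff_idx D \<rightarrow> carrier (qring D)"
  using qdiff_closed by (auto intro!: Q.nat_pow_closed)

lemma step_weight_closed: "step_weight s i s' \<in> carrier (qring D)"
  unfolding step_weight_def by (intro Q.m_closed Q.finprod_closed vpow_closed qpow_closed)

lemma path_weight_closed: "path_weight D J v js p \<in> carrier (qring D)"
  unfolding path_weight_def by (intro Q.m_closed Q.finprod_closed vpow_closed qpow_closed)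

lemma path_weight_Cons:
  "path_weight D J v (i # js) (s # p) = step_weight s i (p ! 0) \<otimes>\<^bsub>qring D\<^esub> path_weight D J v js p"
proof -
  let ?n = "\<lambda>\<beta>. if p ! 0 = s \<and> s \<circ> sgen D i \<notin> par_ext_weyl D J then bounces s i \<beta> else 0"
  let ?k = "\<lambda>j. of_bool (i = j \<and> p ! 0 = s \<and> s \<circ> sgen D i \<in> par_ext_weyl D J) :: nat"
  have 1: "(\<Otimes>\<^bsub>qring D\<^esub>\<beta>\<in>par_pos_roots D J. v \<beta> [^]\<^bsub>qring D\<^esub> bounce_count D J (i # js) (s # p) \<beta>)
    = (\<Otimes>\<^bsub>qring D\<^esub>\<beta>\<in>par_pos_roots D J. v \<beta> [^]\<^bsub>qring D\<^esub> ?n \<beta>) \<otimes>\<^bsub>qring D\<^esub>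
      (\<Otimes>\<^bsub>qring D\<^esub>\<beta>\<in>par_pos_roots D J. v \<beta> [^]\<^bsub>qring D\<^esub> bounce_count D J js p \<beta>)" (is "?A = ?B")
  proof -
    have "?A = (\<Otimes>\<^bsub>qring D\<^esub>\<beta>\<in>par_pos_roots D J. v \<beta> [^]\<^bsub>qring D\<^esub> ?n \<beta> \<otimes>\<^bsub>qring D\<^esub> v \<beta> [^]\<^bsub>qring D\<^esub> bounce_count D J js p \<beta>)"
    proof (rule Q.finprod_cong')
      show "(\<lambda>\<beta>. v \<beta> [^]\<^bsub>qring D\<^esub> ?n \<beta> \<otimes>\<^bsub>qring D\<^esub> v \<beta> [^]\<^bsub>qring D\<^esub> bounce_count D J js p \<beta>) \<in> par_pos_roots D J \<rightarrow> carrier (qring D)"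
        by (intro Pi_I Q.m_closed Q.nat_pow_closed v_closed par_pos_rootsD(1))
      fix \<beta> assume b: "\<beta> \<in> par_pos_roots D J"
      have "bounce_count D J (i # js) (s # p) \<beta> = ?n \<beta> + bounce_count D J js p \<beta>"
        by (simp add: bounce_count_Cons bounces_def)
      then show "v \<beta> [^]\<^bsub>qring D\<^esub> bounce_count D J (i # js) (s # p) \<beta>
          = v \<beta> [^]\<^bsub>qring D\<^esub> ?n \<beta> \<otimes>\<^bsub>qring D\<^esub> v \<beta> [^]\<^bsub>qring D\<^esub> bounce_count D J js p \<beta>"
        using Q.nat_pow_mult[OF v_closed[OF par_pos_rootsD(1)[OF b]]] by simp
    qed simp
    also have "\<dots> = ?B" by (intro Q.finprod_multf vpow_closed)
    finally show ?thesis .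
  qed
  have 2: "(\<Otimes>\<^bsub>qring D\<^esub>j\<in>aff_idx D. qdiff D j [^]\<^bsub>qring D\<^esub> fold_count D J (i # js) (s # p) j)
    = (\<Otimes>\<^bsub>qring D\<^esub>j\<in>aff_idx D. qdiff D j [^]\<^bsub>qring D\<^esub> ?k j) \<otimes>\<^bsub>qring D\<^esub>
      (\<Otimes>\<^bsub>qring D\<^esub>j\<in>aff_idx D. qdiff D j [^]\<^bsub>qring D\<^esub> fold_count D J js p j)" (is "?A = ?B")
  proof -
    have "?A = (\<Otimes>\<^bsub>qring D\<^esub>j\<in>aff_idx D. qdiff D j [^]\<^bsub>qring D\<^esub> ?k j \<otimes>\<^bsub>qring D\<^esub> qdiff D j [^]\<^bsub>qring D\<^esub> fold_count D J js p j)"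
    proof (rule Q.finprod_cong')
      show "(\<lambda>j. qdiff D j [^]\<^bsub>qring D\<^esub> ?k j \<otimes>\<^bsub>qring D\<^esub> qdiff D j [^]\<^bsub>qring D\<^esub> fold_count D J js p j) \<in> aff_idx D \<rightarrow> carrier (qring D)"
        by (intro Pi_I Q.m_closed Q.nat_pow_closed qdiff_closed)
      fix j assume j: "j \<in> aff_idx D"
      show "qdiff D j [^]\<^bsub>qring D\<^esub> fold_count D J (i # js) (s # p) j
          = qdiff D j [^]\<^bsub>qring D\<^esub> ?k j \<otimes>\<^bsub>qring D\<^esub> qdiff D j [^]\<^bsub>qring D\<^esub> fold_count D J js p j"
        unfolding Q.nat_pow_mult[OF qdiff_closed[OF j]] fold_count_Cons ..
    qed simp
    also have "\<dots> = ?B" by (intro Q.finprod_multf qpow_closed)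
    finally show ?thesis .
  qed
  have c: "(\<Otimes>\<^bsub>qring D\<^esub>\<beta>\<in>par_pos_roots D J. v \<beta> [^]\<^bsub>qring D\<^esub> n \<beta>) \<in> carrier (qring D)"
    "(\<Otimes>\<^bsub>qring D\<^esub>j\<in>aff_idx D. qdiff D j [^]\<^bsub>qring D\<^esub> k j) \<in> carrier (qring D)" for n k :: "_ \<Rightarrow> nat"
    by (intro Q.finprod_closed vpow_closed qpow_closed)+
  show ?thesis unfolding path_weight_def[of D J v "i # js"] 1 2 
    unfolding step_weight_def path_weight_def
    using c by (simp only: Q.m_ac Q.m_closed)
qed

lemma act_step:
  assumes "s \<in> par_ext_weyl D J" "i \<in> aff_idx D"
  shows "act (bvec s) (T (sgen D i)) =
    (\<Oplus>\<^bsub>M\<^esub>s'\<in>next_alcoves D J s i. embJ D J (step_weight s i s') \<odot>\<^bsub>M\<^esub> bvec s')"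
proof -
  let ?s = "sgen D i"
  have ne: "s \<circ> ?s \<noteq> s" using sgen_moves[OF par_ext_weyl_ext[OF J assms(1)] assms(2)] .
  have bs: "bvec s \<in> carrier M" using bvec_closed[OF assms(1)] .
  have pow0: "(\<Otimes>\<^bsub>qring D\<^esub>\<beta>\<in>A. f \<beta> [^]\<^bsub>qring D\<^esub> (0::nat)) = \<one>\<^bsub>qring D\<^esub>" for A :: "'z set" and f
    by (rule Q.finprod_one_eqI) simp
  show ?thesis
  proof (cases "s \<circ> ?s \<in> par_ext_weyl D J")
    case False
    then have st: "next_alcoves D J s i = {s}" using assms(1) ne by (auto simp: next_alcoves_def)
    have "(\<Otimes>\<^bsub>qring D\<^esub>\<beta>\<in>par_pos_roots D J. v \<beta> [^]\<^bsub>qring D\<^esub> bounces s i \<beta>) \<in> carrier (qring D)"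
      by (intro Q.finprod_closed vpow_closed)
    then have "step_weight s i s = (\<Otimes>\<^bsub>qring D\<^esub>\<beta>\<in>par_pos_roots D J. v \<beta> [^]\<^bsub>qring D\<^esub> bounces s i \<beta>)"
      using False pow0[of "qdiff D" "aff_idx D"] by (simp add: step_weight_def)
    then have "act (bvec s) (T ?s) = embJ D J (step_weight s i s) \<odot>\<^bsub>M\<^esub> bvec s"
      using act_bounce[OF assms False] by simp
    then show ?thesis unfolding st using bs
      by (simp add: embJ_closed[OF J step_weight_closed] M.smult_closed)
  next
    case True
    have bw: "bvec (s \<circ> ?s) \<in> carrier M" using bvec_closed[OF True] .
    have w1: "step_weight s i (s \<circ> ?s) = \<one>\<^bsub>qring D\<^esub>"
      using ne pow0 by (simp add: step_weight_def)
    have "(\<Otimes>\<^bsub>qring D\<^esub>j\<in>aff_idx D. qdiff D j [^]\<^bsub>qring D\<^esub> (of_bool (i = j) :: nat))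
        = (\<Otimes>\<^bsub>qring D\<^esub>j\<in>aff_idx D. if i = j then qdiff D j else \<one>\<^bsub>qring D\<^esub>)"
      by (rule Q.finprod_cong') (use qdiff_closed[of _ D] in auto)
    also have "\<dots> = qdiff D i" by (rule Q.finprod_singleton) (use assms(2) qdiff_closed[of _ D] in auto)
    finally have w2: "step_weight s i s = qdiff D i"
      using True qdiff_closed[OF assms(2)] pow0[of v "par_pos_roots D J"] by (simp add: step_weight_def)
    have e: "embJ D J (qdiff D i) \<in> carrier (zringJ D J)" using embJ_closed[OF J qdiff_closed[OF assms(2)]] .
    show ?thesis
    proof (cases "negative_crossing D s i")
      case neg: True
      then have st: "next_alcoves D J s i = {s \<circ> ?s, s}" using assms(1) True by (auto simp: next_alcoves_def)
      show ?thesis unfolding st using act_crossing[OF assms True] neg ne bs bw e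
        by (simp add: w1 w2 embJ_one[OF J])
    next
      case False
      then have st: "next_alcoves D J s i = {s \<circ> ?s}" using assms(1) True ne by (auto simp: next_alcoves_def)
      show ?thesis unfolding st using act_crossing[OF assms True] False bw
        by (simp add: w1 embJ_one[OF J])
    qed
  qed
qed

lemma act_zero: "h \<in> carrier H \<Longrightarrow> act \<zero>\<^bsub>M\<^esub> h = \<zero>\<^bsub>M\<^esub>"
  using act_add_l[of "\<zero>\<^bsub>M\<^esub>" "\<zero>\<^bsub>M\<^esub>" h] act_closed[of "\<zero>\<^bsub>M\<^esub>" h]
  by (metis M.M.add.l_cancel_one' M.M.add.one_closed M.M.l_zero)

lemma act_finsum:
  assumes "finite A" "f \<in> A \<rightarrow> carrier M" "h \<in> carrier H"
  shows "act (\<Oplus>\<^bsub>M\<^esub>a\<in>A. f a) h = (\<Oplus>\<^bsub>M\<^esub>a\<in>A. act (f a) h)"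
  using assms(1,2)
proof (induction A)
  case empty
  then show ?case using act_zero assms(3) by simp
next
  case (insert a A)
  then have "(\<lambda>a. act (f a) h) \<in> A \<rightarrow> carrier M" "act (f a) h \<in> carrier M"
    using act_closed assms(3) by auto
  then show ?case using insert act_add_l[of "f a" "\<Oplus>\<^bsub>M\<^esub>a\<in>A. f a" h] assms(3) by (simp add: Pi_iff)
qed

text \<open>
  Acting by the first generator of the word moves \<open>b\<^sub>s\<close> to the possible second alcoves of a path,
  with the weight of the step; the rest of the word produces the tails of the paths.
\<close>

lemma act_path_sum:
  assumes "reduced_expression D w js \<sigma>" "s \<in> par_ext_weyl D J"
  shows "act (bvec s) (T w) =
    (\<Oplus>\<^bsub>M\<^esub>p\<in>folded_paths D J js \<sigma> s. embJ D J (path_weight D J v js p) \<odot>\<^bsub>M\<^esub> bvec (last p))"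
  using assms
proof (induction js arbitrary: w s)
  case Nil
  then have s: "\<sigma> \<in> alcove_stab D" "w = \<sigma>" by (auto simp: reduced_expression_def expression_def)
  have m: "s \<circ> \<sigma> \<in> par_ext_weyl D J" using stab_mem[OF Nil(2) s(1)] .
  have "path_weight D J v [] [s, s \<circ> \<sigma>] = \<one>\<^bsub>qring D\<^esub>"
    unfolding path_weight_def fold_count_def bounce_count_def bounce_at_def
    by (simp add: Q.finprod_one_eqI)
  then show ?case unfolding folded_paths_Nil[OF Nil(2) m]
    using act_stab[OF Nil(2) s(1)] s(2) bvec_closed[OF m] by (simp add: embJ_one[OF J])
next
  case (Cons i js)
  let ?w' = "wprod D js \<circ> \<sigma>" and ?S = "next_alcoves D J s i"
  let ?P = "\<lambda>s'. folded_paths D J js \<sigma> s'"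
  note r = reduced_Cons[OF Cons.prems(1)]
  have Tw: "T w = T (sgen D i) \<otimes>\<^bsub>H\<^esub> T ?w'"
    using T_mult[OF sgen_ext_weyl[OF r(1)] r(2) r(5)[unfolded r(3)]] unfolding r(3) by simp
  have Tc: "T (sgen D i) \<in> carrier H" "T ?w' \<in> carrier H"
    using T_closed sgen_ext_weyl[OF r(1)] r(2) by auto
  have S: "s' \<in> par_ext_weyl D J" if "s' \<in> ?S" for s' using that by (simp add: next_alcoves_def)
  have e: "embJ D J (step_weight s i s') \<in> carrier (zringJ D J)" for s'
    using embJ_closed[OF J step_weight_closed] .
  have term_closed: "embJ D J (path_weight D J v js' q) \<odot>\<^bsub>M\<^esub> bvec (last p) \<in> carrier M"
    if "p \<in> folded_paths D J js'' \<sigma> s'" for p q s' js' js''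
    using bvec_closed[OF folded_path_last[OF that]] embJ_closed[OF J path_weight_closed]
    by (simp add: M.smult_closed)
  have last: "last (s # p) = last p" if "p \<in> ?P s'" for s' p
    using that by (auto simp: folded_paths_def)
  have hd: "p ! 0 = s'" if "p \<in> ?P s'" for s' p using that by (simp add: folded_paths_def)
  have tail: "embJ D J (step_weight s i s') \<odot>\<^bsub>M\<^esub> act (bvec s') (T ?w')
    = (\<Oplus>\<^bsub>M\<^esub>q\<in>(#) s ` ?P s'. embJ D J (path_weight D J v (i # js) q) \<odot>\<^bsub>M\<^esub> bvec (last q))"
    if s': "s' \<in> ?S" for s'
  proof -
    have pw: "embJ D J (path_weight D J v (i # js) (s # p)) \<odot>\<^bsub>M\<^esub> bvec (last (s # p)) =
      embJ D J (step_weight s i s') \<odot>\<^bsub>M\<^esub> (embJ D J (path_weight D J v js p) \<odot>\<^bsub>M\<^esub> bvec (last p))"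
      if p: "p \<in> ?P s'" for p
      unfolding path_weight_Cons hd[OF p] last[OF p] embJ_mult[OF J step_weight_closed path_weight_closed]
      using bvec_closed[OF folded_path_last[OF p]] embJ_closed[OF J path_weight_closed] e
      by (simp add: M.smult_assoc1)
    have "embJ D J (step_weight s i s') \<odot>\<^bsub>M\<^esub> act (bvec s') (T ?w') =
      (\<Oplus>\<^bsub>M\<^esub>p\<in>?P s'. embJ D J (step_weight s i s') \<odot>\<^bsub>M\<^esub>
         (embJ D J (path_weight D J v js p) \<odot>\<^bsub>M\<^esub> bvec (last p)))"
      unfolding Cons.IH[OF r(4) S[OF s']]
      by (rule M.finsum_smult_ldistr) (use finite_folded_paths[OF S[OF s']] term_closed e in auto)
    also have "\<dots> = (\<Oplus>\<^bsub>M\<^esub>p\<in>?P s'. embJ D J (path_weight D J v (i # js) (s # p)) \<odot>\<^bsub>M\<^esub> bvec (last (s # p)))"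
      by (rule M.M.add.finprod_cong') (use pw term_closed e M.smult_closed in auto)
    also have "\<dots> = (\<Oplus>\<^bsub>M\<^esub>q\<in>(#) s ` ?P s'. embJ D J (path_weight D J v (i # js) q) \<odot>\<^bsub>M\<^esub> bvec (last q))"
      by (rule M.M.finsum_reindex[symmetric]) (use pw term_closed e M.smult_closed in \<open>auto simp: inj_on_def\<close>)
    finally show ?thesis .
  qed
  have "act (bvec s) (T w) = act (act (bvec s) (T (sgen D i))) (T ?w')"
    unfolding Tw by (rule act_mult[OF bvec_closed[OF Cons.prems(2)] Tc])
  also have "\<dots> = (\<Oplus>\<^bsub>M\<^esub>s'\<in>?S. act (embJ D J (step_weight s i s') \<odot>\<^bsub>M\<^esub> bvec s') (T ?w'))"
    unfolding act_step[OF Cons.prems(2) r(1)]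
    by (rule act_finsum) (use finite_next_alcoves S bvec_closed e M.smult_closed Tc in auto)
  also have "\<dots> = (\<Oplus>\<^bsub>M\<^esub>s'\<in>?S. \<Oplus>\<^bsub>M\<^esub>q\<in>(#) s ` ?P s'. embJ D J (path_weight D J v (i # js) q) \<odot>\<^bsub>M\<^esub> bvec (last q))"
  proof (rule M.M.add.finprod_cong')
    fix s' assume s': "s' \<in> ?S"
    then show "act (embJ D J (step_weight s i s') \<odot>\<^bsub>M\<^esub> bvec s') (T ?w') =
      (\<Oplus>\<^bsub>M\<^esub>q\<in>(#) s ` ?P s'. embJ D J (path_weight D J v (i # js) q) \<odot>\<^bsub>M\<^esub> bvec (last q))"
      using act_smult_l[OF e bvec_closed[OF S[OF s']] Tc(2)] tail[OF s'] by simp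
  qed (use last term_closed in \<open>auto intro!: M.M.finsum_closed\<close>)
  also have "\<dots> = (\<Oplus>\<^bsub>M\<^esub>q\<in>folded_paths D J (i # js) \<sigma> s. embJ D J (path_weight D J v (i # js) q) \<odot>\<^bsub>M\<^esub> bvec (last q))"
    unfolding folded_paths_Cons[OF Cons.prems(2)]
  proof (rule M.M.add.finprod_UN_disjoint[symmetric])
    show "pairwise (\<lambda>x y. disjnt ((#) s ` ?P x) ((#) s ` ?P y)) ?S"
      using hd by (auto simp: pairwise_def disjnt_def)
    show "finite ((#) s ` ?P s')" if "s' \<in> ?S" for s'
      using finite_folded_paths[OF S[OF that]] by (rule finite_imageI)
  qed (use finite_next_alcoves last term_closed in auto)
  finally show ?case .
qed

section \<open>Fundamental domains\<close>

context
  fixes F :: "('a \<Rightarrow> 'a) set" assumes F: "fundamental_domain D J F"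
begin

lemma F_mem: "u \<in> F \<Longrightarrow> u \<in> par_ext_weyl D J"
  using F by (auto simp: fundamental_domain_def)

lemma dom_decomposition:
  assumes "w \<in> par_ext_weyl D J"
  shows "dom_wt D J F w \<in> par_coweights D J" "dom_rep D J F w \<in> F"
    "w = tau D J (dom_wt D J F w) \<circ> dom_rep D J F w"
proof -
  have "\<exists>!z. fst z \<in> par_coweights D J \<and> snd z \<in> F \<and> w = tau D J (fst z) \<circ> snd z"
    using F assms by (auto simp: fundamental_domain_def)
  then obtain z where z: "fst z \<in> par_coweights D J" "snd z \<in> F" "w = tau D J (fst z) \<circ> snd z"
    and u: "\<And>z'. fst z' \<in> par_coweights D J \<and> snd z' \<in> F \<and> w = tau D J (fst z') \<circ> snd z' \<Longrightarrow> z' = z"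
    by (elim ex1E) blast
  have u': "\<mu> = fst z \<and> f = snd z"
    if "\<mu> \<in> par_coweights D J" "f \<in> F" "w = tau D J \<mu> \<circ> f" for \<mu> f
    using u[of "(\<mu>, f)"] that by auto
  have "dom_wt D J F w = fst z" unfolding dom_wt_def
    by (rule the_equality) (use z u' in blast)+
  moreover have "dom_rep D J F w = snd z" unfolding dom_rep_def
    by (rule the_equality) (use z u' in blast)+
  ultimately show "dom_wt D J F w \<in> par_coweights D J" "dom_rep D J F w \<in> F"
    "w = tau D J (dom_wt D J F w) \<circ> dom_rep D J F w" using z by simp_all
qed

lemma dom_unique:
  assumes "aligned J \<mu> y" "aligned J \<nu> z" "f \<in> F" "g \<in> F" "transl \<mu> \<circ> y \<circ> f = transl \<nu> \<circ> z \<circ> g"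
  shows "f = g"
proof -
  let ?w = "transl \<mu> \<circ> y \<circ> f"
  have "\<exists>!z. fst z \<in> par_coweights D J \<and> snd z \<in> F \<and> ?w = tau D J (fst z) \<circ> snd z"
    using F aligned_mem[OF assms(1) F_mem[OF assms(3)]] by (auto simp: fundamental_domain_def)
  moreover have "?w = tau D J \<mu> \<circ> f" "?w = tau D J \<nu> \<circ> g"
    using tau_eq[OF J assms(1)] tau_eq[OF J assms(2)] assms(5) by simp_all
  moreover have "\<mu> \<in> par_coweights D J" "\<nu> \<in> par_coweights D J"
    using aligned_coweight[OF J] assms(1,2) by blast+
  ultimately have "(\<mu>, f) = (\<nu>, g)" using assms(3,4) by (metis fst_conv snd_conv)
  then show ?thesis by simp
qed

lemma bvec_dom:
  assumes "w \<in> par_ext_weyl D J"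
  shows "bvec w = zmonJ D J (dom_wt D J F w) \<odot>\<^bsub>M\<^esub> bvec (dom_rep D J F w)"
proof -
  note d = dom_decomposition[OF assms]
  obtain y where y: "aligned J (dom_wt D J F w) y" "tau D J (dom_wt D J F w) = transl (dom_wt D J F w) \<circ> y"
    using tau_aligned[OF J d(1)] by blast
  have "w = transl (dom_wt D J F w) \<circ> y \<circ> dom_rep D J F w" using d(3) y(2) by simp
  then show ?thesis using bvec_aligned[OF y(1) F_mem[OF d(2)]] by simp
qed

text \<open>Each orbit of \<open>\<T>\<^sub>J\<close> meets both \<open>W\<^sup>J\<close> and \<open>F\<close> exactly once.\<close>

lemma dom_bij_min_reps: "bij_betw (lin_min D J) F (min_reps D J)"
proof (rule bij_betw_imageI)
  have orbit: "\<exists>\<mu> y. aligned J \<mu> y \<and> lin_min D J f = transl \<mu> \<circ> y \<circ> dom_rep D J F (lin_min D J f)"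
    if "f \<in> F" for f
  proof -
    have u: "lin_min D J f \<in> par_ext_weyl D J" using min_reps_par_ext[OF J lin_min_mem[OF F_mem[OF that]]] .
    show ?thesis using dom_decomposition[OF u] tau_aligned[OF J dom_decomposition(1)[OF u]] by metis
  qed
  \<comment> \<open>Both \<open>f\<close> and the representative \<open>?g\<close> of \<open>lin_min f\<close> in \<open>F\<close> lie in one orbit, so the uniqueness
    of decompositions over \<open>F\<close> identifies them.\<close>
  have rep: "f = dom_rep D J F (lin_min D J f)" if f: "f \<in> F" for f
  proof -
    let ?u = "lin_min D J f" and ?g = "dom_rep D J F (lin_min D J f)"
    have u: "?u \<in> min_reps D J" using lin_min_mem[OF F_mem[OF f]] .
    obtain y where d: "aligned J (wt f) y" "f = transl (wt f) \<circ> y \<circ> ?u"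
      using par_ext_decomposition[OF J F_mem[OF f]] by metis
    obtain \<nu> z where o: "aligned J \<nu> z" "?u = transl \<nu> \<circ> z \<circ> ?g" using orbit[OF f] by blast
    note a = alignedD[OF J d(1)]
    have lin: "linear y" using fin_weyl_linear[OF a(3)] .
    have "transl (wt f) \<circ> y \<circ> (transl \<nu> \<circ> z \<circ> ?g) = transl (wt f + y \<nu>) \<circ> (y \<circ> z) \<circ> ?g"
      by (rule ext) (simp add: transl_def linear_add[OF lin])
    then have f': "f = transl (wt f + y \<nu>) \<circ> (y \<circ> z) \<circ> ?g" using d(2) o(2) by metis
    have id: "aligned J 0 id"
      by (auto simp: aligned_def[OF J] coweights_iff par_weyl_id inj_imp_inv_eq par_pos_rootsD(2) inv_id[unfolded id_def])
    have "transl 0 \<circ> id \<circ> f = transl (wt f + y \<nu>) \<circ> (y \<circ> z) \<circ> ?g" using f' by (simp add: transl_0)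
    then show ?thesis
      using dom_unique[OF id aligned_comp[OF J d(1) o(1)] f
          dom_decomposition(2)[OF min_reps_par_ext[OF J u]]] by blast
  qed
  show "inj_on (lin_min D J) F" using rep by (metis inj_onI)
  show "lin_min D J ` F = min_reps D J"
  proof (intro equalityI subsetI)
    fix u assume "u \<in> lin_min D J ` F"
    then show "u \<in> min_reps D J" using lin_min_mem F_mem by auto
  next
    fix u assume u: "u \<in> min_reps D J"
    have up: "u \<in> par_ext_weyl D J" using min_reps_par_ext[OF J u] .
    note d = dom_decomposition[OF up]
    obtain y where y: "aligned J (dom_wt D J F u) y" "tau D J (dom_wt D J F u) = transl (dom_wt D J F u) \<circ> y"
      using tau_aligned[OF J d(1)] by blast
    have "u = transl (dom_wt D J F u) \<circ> y \<circ> dom_rep D J F u" using d(3) y(2) by simp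
    then have "lin_min D J u = lin_min D J (dom_rep D J F u)"
      using lin_min_aligned[OF y(1) F_mem[OF d(2)]] by metis
    moreover have "lin_min D J u = u"
      by (rule lin_par_min_eqI(2)[OF J par_weyl_id u]) (simp add: min_reps_fin[OF J u])
    ultimately show "u \<in> lin_min D J ` F" using d(2) by force
  qed
qed

lemma bvec_basis: "module_basis (zringJ D J) M F bvec"
proof (rule module_basis_rescale[OF M_module m_basis dom_bij_min_reps])
  show "zmonJ D J (wt u) \<in> Units (zringJ D J)" if "u \<in> F" for u
    using zmonJ_Units[OF J ext_weyl_wt[OF par_ext_weyl_ext[OF J F_mem[OF that]]]] .
qed (use bvec_eq F_mem in blast)

lemma matrix_entry_path_sum:
  assumes "reduced_expression D w js \<sigma>" "u \<in> F" "u' \<in> F"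
  shows "matrix_entry (zringJ D J) M F bvec (\<lambda>x. act x (T w)) u u' =
    (\<Oplus>\<^bsub>zringJ D J\<^esub>p\<in>{p \<in> folded_paths D J js \<sigma> u. dom_rep D J F (last p) = u'}.
       embJ D J (path_weight D J v js p) \<otimes>\<^bsub>zringJ D J\<^esub> zmonJ D J (dom_wt D J F (last p)))"
proof -
  let ?P = "folded_paths D J js \<sigma> u" and ?x = "act (bvec u) (T w)"
  let ?g = "\<lambda>p. embJ D J (path_weight D J v js p) \<otimes>\<^bsub>zringJ D J\<^esub> zmonJ D J (dom_wt D J F (last p))"
  let ?c = "\<lambda>u'\<in>F. \<Oplus>\<^bsub>zringJ D J\<^esub>p\<in>{p \<in> ?P. dom_rep D J F (last p) = u'}. ?g p"
  have up: "u \<in> par_ext_weyl D J" using F_mem[OF assms(2)] .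
  have e: "embJ D J (path_weight D J v js p) \<in> carrier (zringJ D J)" for p
    using embJ_closed[OF J path_weight_closed] .
  have z: "zmonJ D J \<mu> \<in> carrier (zringJ D J)" for \<mu> using zmonJ_closed[OF J] .
  have b: "bvec ` F \<subseteq> carrier M" using bvec_closed F_mem by auto
  have rep: "dom_rep D J F (last p) \<in> F" if "p \<in> ?P" for p
    using dom_decomposition(2)[OF folded_path_last[OF that]] .
  have "?x = (\<Oplus>\<^bsub>M\<^esub>p\<in>?P. embJ D J (path_weight D J v js p) \<odot>\<^bsub>M\<^esub> bvec (last p))"
    by (rule act_path_sum[OF assms(1) up])
  also have "\<dots> = (\<Oplus>\<^bsub>M\<^esub>p\<in>?P. ?g p \<odot>\<^bsub>M\<^esub> bvec (dom_rep D J F (last p)))"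
  proof (rule M.M.add.finprod_cong')
    show "(\<lambda>p. ?g p \<odot>\<^bsub>M\<^esub> bvec (dom_rep D J F (last p))) \<in> ?P \<rightarrow> carrier M"
      using e z rep b by (auto intro!: M.smult_closed)
    fix p assume p: "p \<in> ?P"
    have "bvec (dom_rep D J F (last p)) \<in> carrier M" using rep[OF p] b by auto
    then show "embJ D J (path_weight D J v js p) \<odot>\<^bsub>M\<^esub> bvec (last p) = ?g p \<odot>\<^bsub>M\<^esub> bvec (dom_rep D J F (last p))"
      using bvec_dom[OF folded_path_last[OF p]] e z by (simp add: M.smult_assoc1)
  qed simp
  finally have x: "?x = \<dots>" .
  have ex: "expansion (zringJ D J) M F bvec ?x ?c"
    by (rule expansion_grouped[where r = "\<lambda>p. dom_rep D J F (last p)" and g = ?g,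
          OF M_module b finite_folded_paths[OF up]]) (use rep e z x in auto)
  have "w \<in> ext_weyl D"
    using assms(1) by (auto simp: reduced_expression_def expression_def intro: ext_weyl_comp wprod_ext_weyl alcove_stab_ext)
  then have "?x \<in> carrier M" using act_closed[OF bvec_closed[OF up] T_closed] by blast
  then have "\<exists>!c. expansion (zringJ D J) M F bvec ?x c" using bvec_basis by (simp add: module_basis_def)
  then have "(THE c. expansion (zringJ D J) M F bvec ?x c) = ?c" using ex
    by (rule the1_equality[where P = "expansion (zringJ D J) M F bvec ?x"])
  then show ?thesis unfolding matrix_entry_def using assms(3) by simp
qed

end

end

theorem theorem5p14:
  fixes D :: "'a::euclidean_space based_roots"
    and J :: "nat set"
    and v :: "'a \<Rightarrow> qpoly"
    and F :: "('a \<Rightarrow> 'a) set"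
    and H :: "(qpoly, 'h) module"
    and T :: "('a \<Rightarrow> 'a) \<Rightarrow> 'h"
    and M :: "(zpoly set, 'm) module"
    and act :: "'m \<Rightarrow> 'h \<Rightarrow> 'm"
    and m :: "('a \<Rightarrow> 'a) \<Rightarrow> 'm"
    and varpi :: "'h \<Rightarrow> 'm"
  assumes "irreducible_root_datum D"
    and "J \<subseteq> fin_idx D"
    and "parameter_system D J v"
    and "fundamental_domain D J F"
    and "hecke_algebra D H T"
    and "induced_module D J H M act v T m"
    and "varpi_map D J v H T M m varpi"
  shows "module_basis (zringJ D J) M F (\<lambda>u. varpi (X_elt D H T u)) \<and>
    (\<forall>w js \<sigma>. w \<in> ext_weyl D \<longrightarrow> reduced_expression D w js \<sigma> \<longrightarrow>
      (\<forall>u\<in>F. \<forall>u'\<in>F.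
        matrix_entry (zringJ D J) M F (\<lambda>u. varpi (X_elt D H T u)) (\<lambda>x. act x (T w)) u u' =
        (\<Oplus>\<^bsub>zringJ D J\<^esub>p\<in>{p \<in> folded_paths D J js \<sigma> u. dom_rep D J F (last p) = u'}.
           embJ D J (path_weight D J v js p) \<otimes>\<^bsub>zringJ D J\<^esub> zmonJ D J (dom_wt D J F (last p)))))"
proof -
  interpret irreducible_root_datum D by fact
  interpret parameter_system D J v by fact
  interpret hecke_algebra D H T by fact
  interpret induced_module D J H M act v T m by fact
  interpret varpi_map D J v H T M m varpi by fact
  interpret hecke_setting D J v H T M act m varpi by unfold_locales fact
  have b: "(\<lambda>u. varpi (X_elt D H T u)) = bvec" by (simp add: fun_eq_iff bvec_def)
  show ?thesis unfolding b using bvec_basis[OF assms(4)] matrix_entry_path_sum[OF assms(4)] by blast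
qed

end
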